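(* Let $X_n$ be an excited random walk on $\mathbb{Z}$ whose random cookie environment has a distribution $\mathbf{P}$ satisfying assumptions (A1), (A2), (A3) given in the context, and let $P$ be the averaged law. Then $X_n/n$ satisfies a large deviation principle with rate function $I_X$ (defined in the context). That is, for any open set $G\subset[-1,1]$, $$\liminf_{n\to\infty}\frac1n\log P(X_n/n\in G)\ \ge\ -\inf_{x\in G}I_X(x),$$ and for any closed set $F\subset[-1,1]$, $$\limsup_{n\to\infty}\frac1n\log P(X_n/n\in F)\ \le\ -\inf_{x\in F}I_X(x).$$
   Context: **Excited random walk.** A cookie environment is an element $\omega=\{\omega_i(j)\}_{i\in\mathbb{Z},\,j\ge1}$ of $\Omega=[0,1]^{\mathbb{Z}\times\mathbb{N}}$, $\mathbb{N}=\{1,2,\dots\}$. Given $\omega$, the quenched law $P_\omega$ is the law of the nearest-neighbor walk $(X_n)_{n\ge0}$ on $\mathbb{Z}$ with $P_\omega(X_0=0)=1$ and $$P_\omega(X_{n+1}=X_n+1\mid\mathcal{F}_n)=1-P_\omega(X_{n+1}=X_n-1\mid\mathcal{F}_n)=\omega_{X_n}\big(\#\{k\le n:X_k=X_n\}\big),$$ where $\mathcal{F}_n=\sigma(X_0,\dots,X_n)$. For a probability distribution $\mathbf{P}$ on $\Omega$ (with expectation $\mathbf{E}$), the averaged law is $P(\cdot)=\int_\Omega P_\omega(\cdot)\,\mathbf{P}(d\omega)$. **Assumptions.** (A1) There is an integer $M<\infty$ such that $\mathbf{P}$-a.s. $\omega_i(j)=1/2$ for all $i\in\mathbb{Z}$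 and all $j>M$. (A2) Under $\mathbf{P}$ the sequence $\{\omega_i(\cdot)\}_{i\in\mathbb{Z}}$ is i.i.d. (A3) $\mathbf{E}\big[\prod_{j=1}^M\omega_0(j)\big]>0$ and $\mathbf{E}\big[\prod_{j=1}^M(1-\omega_0(j))\big]>0$. **Associated branching process.** Choose $\omega$ according to $\mathbf{P}$ and, given $\omega$, let $\{\xi_{i,j}\}_{i\in\mathbb{Z},j\ge1}$ be independent Bernoulli variables with $P(\xi_{i,j}=1)=\omega_i(j)$. For $m\ge1$ let $F^{(i)}_m=\min\{\ell\ge1:\sum_{j=1}^\ell\xi_{i,j}=m\}-m$ be the number of failures (zeros) before the $m$-th success (one) in $\{\xi_{i,j}\}_{j\ge1}$. Let $V_0=0$ and $V_{i+1}=F^{(i)}_{V_i+1}$ for $i\ge0$. Let $\sigma_1=\inf\{i>0:V_i=0\}$ (with $\inf\emptyset=\infty$) and $W_1=\sum_{i=1}^{\sigma_1}V_i$. All probabilities and expectations are averaged over $\omega$. **Rate functions.** For $\lambda,\eta\in\mathbb{R}$ let $\Lambda_{W,\sigma}(\lambda,\eta)=\log E\big[e^{\lambda W_1+\eta\sigma_1}\mathbf{1}_{\{\sigma_1<\infty\}}\big]$, $\Lambda_V(\lambda)=-\sup\{\eta:\Lambda_{W,\sigma}(\lambda,\eta)\le0\}$ (with $\sup\emptyset=-\infty$), $I_V(x)=\sup_{\lambda\in\mathbb{R}}\{\lambda x-\Lambda_V(\lambda)\}$, and $I_T(t)=I_V((t-1)/2)$. Let $I_{\overline T}$ be the function obtained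 by the same construction as $I_T$ but with the random environment $\omega$ replaced by $\overline\omega$, $\overline\omega_i(j)=1-\omega_i(j)$. Define, for $x\in[-1,1]$, $$I_X(x)=\begin{cases}x\,I_T(1/x)&x>0\\0&x=0\\|x|\,I_{\overline T}(1/|x|)&x<0.\end{cases}$$ The infimum over the empty set is $+\infty$. Open and closed refer to the topology of $[-1,1]$. *)

theory Defs
  imports "HOL-Probability.Probability"
begin

text \<open>Cookies are numbered from 1, as in \<open>\<nat> = {1, 2, \<dots>}\<close>. A stack of cookies is
  an extensional function on \<open>{1..}\<close>, so that the value at index 0 carries no information.\<close>

type_synonym env = "int \<Rightarrow> nat \<Rightarrow> real"

definition cookie_space :: "(nat \<Rightarrow> real) measure" where
  "cookie_space = PiM {1..} (\<lambda>_. restrict_space borel {0..1})"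

definition env_space :: "env measure" where
  "env_space = PiM UNIV (\<lambda>_. cookie_space)"

definition mirror_env :: "env \<Rightarrow> env" where
  "mirror_env \<omega> = (\<lambda>i. \<lambda>j\<in>{1..}. 1 - \<omega> i j)"

definition mirror_law :: "env measure \<Rightarrow> env measure" where
  "mirror_law P = distr P env_space mirror_env"

abbreviation path_space :: "(nat \<Rightarrow> int) measure" where
  "path_space \<equiv> PiM UNIV (\<lambda>_. count_space UNIV)"

definition visits :: "(nat \<Rightarrow> int) \<Rightarrow> nat \<Rightarrow> nat" where
  "visits x n = card {k. k \<le> n \<and> x k = x n}"

text \<open>The conditional law of \<open>X n\<close> given \<open>X 0, \<dots>, X (n - 1)\<close>.\<close>

definition erw_kernel :: "env \<Rightarrow> nat \<Rightarrow> (nat \<Rightarrow> int) \<Rightarrow> int measure" where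
  "erw_kernel \<omega> n x = (case n of
     0 \<Rightarrow> measure_pmf (return_pmf 0)
   | Suc m \<Rightarrow> measure_pmf (map_pmf (\<lambda>b. if b then x m + 1 else x m - 1)
                              (bernoulli_pmf (\<omega> (x m) (visits x m)))))"

text \<open>The law on path space with these conditional laws, given by the Ionescu-Tulcea theorem.
  The lemmas \<open>quenched_law_start\<close> and \<open>quenched_law_step\<close> below are the defining
  properties of the quenched walk. Since the walk takes countably many values, conditional
  probabilities given \<open>X 0, \<dots>, X n\<close> are described by the events that fix a finite initial
  piece of the path.\<close>

definition quenched_law :: "env \<Rightarrow> (nat \<Rightarrow> int) measure" where
  "quenched_law \<omega> = projective_family.lim UNIV
     (Ionescu_Tulcea.CI (erw_kernel \<omega>) (\<lambda>_. count_space UNIV)) (\<lambda>_. count_space UNIV)"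

definition averaged_prob :: "env measure \<Rightarrow> (nat \<Rightarrow> int) set \<Rightarrow> ennreal" where
  "averaged_prob P A = (\<integral>\<^sup>+\<omega>. emeasure (quenched_law \<omega>) A \<partial>P)"

lemma Ionescu_Tulcea_erw: "Ionescu_Tulcea (erw_kernel \<omega>) (\<lambda>_. count_space UNIV)"
proof (rule Ionescu_Tulcea.intro)
  show "erw_kernel \<omega> i \<in> measurable (PiM {0..<i} (\<lambda>_. count_space UNIV)) (subprob_algebra (count_space UNIV))" for i
    by (subst count_space_PiM_finite)
       (auto simp: erw_kernel_def measure_pmf_in_subprob_algebra split: nat.split)
  show "prob_space (erw_kernel \<omega> i x)" for i x
    by (auto simp: erw_kernel_def prob_space_measure_pmf split: nat.split)
qed

lemma sets_quenched_law: "sets (quenched_law \<omega>) = sets path_space"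
  and prob_space_quenched_law: "prob_space (quenched_law \<omega>)"
proof -
  interpret Ionescu_Tulcea "erw_kernel \<omega>" "\<lambda>_. count_space UNIV"
    by (rule Ionescu_Tulcea_erw)
  show "sets (quenched_law \<omega>) = sets path_space"
    unfolding quenched_law_def by (rule PF.sets_lim)
  have "emeasure (quenched_law \<omega>) (prod_emb UNIV (\<lambda>_. count_space UNIV) {} {\<lambda>_. undefined})
     = emeasure (CI {}) {\<lambda>_. undefined}"
    unfolding quenched_law_def by (rule lim) (auto simp: PiM_empty)
  also have "\<dots> = 1"
    using prob_space.emeasure_space_1[OF PF.prob_space_P[of "{}"]]
    by (simp add: CI_def PiM_empty)
  finally have "emeasure (quenched_law \<omega>) UNIV = 1"
    by (simp add: prod_emb_def space_PiM restrict_def vimage_def)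
  moreover have "space (quenched_law \<omega>) = UNIV"
    unfolding quenched_law_def by (simp add: space_PiM)
  ultimately show "prob_space (quenched_law \<omega>)"
    by (simp add: prob_spaceI)
qed

lemma cylinder_step:
  "emeasure (quenched_law \<omega>) {X. \<forall>k<Suc n. X k = x k}
     = emeasure (quenched_law \<omega>) {X. \<forall>k<n. X k = x k} * emeasure (erw_kernel \<omega> n x) {x n}"
proof -
  interpret Ionescu_Tulcea "erw_kernel \<omega>" "\<lambda>_. count_space UNIV"
    by (rule Ionescu_Tulcea_erw)
  let ?r = "\<lambda>n. restrict x {0..<n}"
  have PiM_eq: "PiM {0..<n} (\<lambda>_. count_space (UNIV::int set)) = count_space (PiE {0..<n} (\<lambda>_. UNIV))" for n :: nat
    by (rule count_space_PiM_finite) auto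
  have cyl: "emeasure (quenched_law \<omega>) {X. \<forall>k<n. X k = x k} = emeasure (C 0 n (\<lambda>_. undefined)) {?r n}" for n
  proof -
    have fin: "finite {0..<n}" by simp
    have s: "{?r n} \<in> sets (PiM {0..<n} (\<lambda>_. count_space UNIV))"
      by (simp add: PiM_eq)
    have "{X. \<forall>k<n. X k = x k} = prod_emb UNIV (\<lambda>_. count_space UNIV) {0..<n} {?r n}"
      by (auto simp: prod_emb_def space_PiM restrict_def fun_eq_iff) metis
    then have "emeasure (quenched_law \<omega>) {X. \<forall>k<n. X k = x k} = emeasure (CI {0..<n}) {?r n}"
      unfolding quenched_law_def using lim[OF fin s] by simp
    also have "\<dots> = emeasure (C 0 n (\<lambda>_. undefined)) {?r n}"
      using s by (subst emeasure_CI[of _ n]) (auto simp: PiM_eq prod_emb_id)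
    finally show ?thesis .
  qed
  have kern: "erw_kernel \<omega> n (?r n) = erw_kernel \<omega> n x"
  proof (cases n)
    case (Suc m)
    have "{k. k \<le> m \<and> ?r n k = ?r n m} = {k. k \<le> m \<and> x k = x m}"
      using Suc by auto
    then show ?thesis using Suc by (simp add: erw_kernel_def visits_def cong: if_cong)
  qed (simp add: erw_kernel_def)
  have e: "emeasure (eP n y) {?r (Suc n)} = emeasure (erw_kernel \<omega> n x) {x n} * indicator {?r n} y"
    if y: "y \<in> space (PiM {0..<n} (\<lambda>_. count_space UNIV))" for y
  proof -
    have "emeasure (eP n y) {?r (Suc n)} = emeasure (erw_kernel \<omega> n y) ((\<lambda>z. y(n := z)) -` {?r (Suc n)} \<inter> UNIV)"
      using emeasure_eP[OF y, of "{?r (Suc n)}"] by (simp add: PiM_eq)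
    also have "(\<lambda>z. y(n := z)) -` {?r (Suc n)} \<inter> UNIV = (if y = ?r n then {x n} else {})"
    proof -
      have yn: "k \<ge> n \<Longrightarrow> y k = undefined" for k
        using y by (auto simp: space_PiM PiE_iff extensional_def)
      have "y(n := z) = ?r (Suc n) \<longleftrightarrow> y = ?r n \<and> z = x n" for z
        using yn by (auto simp: fun_eq_iff less_Suc_eq restrict_def split: if_splits)
      then show ?thesis by auto
    qed
    also have "emeasure (erw_kernel \<omega> n y) (if y = ?r n then {x n} else {})
        = emeasure (erw_kernel \<omega> n x) {x n} * indicator {?r n} y"
      by (cases "y = ?r n") (simp_all only: kern if_True if_False indicator_simps singleton_iff mult_1_right emeasure_empty mult_zero_right simp_thms)
    finally show ?thesis .
  qed
  have u: "(\<lambda>_. undefined) \<in> space (PiM {0..<0::nat} (\<lambda>_. count_space (UNIV::int set)))"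
    by (simp add: space_PiM)
  have "emeasure (C 0 (Suc n) (\<lambda>_. undefined)) {?r (Suc n)}
      = (\<integral>\<^sup>+y. emeasure (eP n y) {?r (Suc n)} \<partial>C 0 n (\<lambda>_. undefined))"
  proof -
    have m: "eP n \<in> measurable (C 0 n (\<lambda>_. undefined)) (subprob_algebra (PiM {0..<Suc n} (\<lambda>_. count_space UNIV)))"
      using measurable_eP[of n] sets_C[OF u, of n] by (simp cong: measurable_cong_sets)
    have "space (C 0 n (\<lambda>_. undefined)) \<noteq> {}"
      using space_C[OF u, of n] by (simp add: PiE_eq_empty_iff space_PiM)
    moreover have "{?r (Suc n)} \<in> sets (PiM {0..<Suc n} (\<lambda>_. count_space (UNIV::int set)))"
      by (simp add: PiM_eq)
    ultimately show ?thesis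
      using emeasure_bind[OF _ m] by simp
  qed
  also have "\<dots> = (\<integral>\<^sup>+y. emeasure (erw_kernel \<omega> n x) {x n} * indicator {?r n} y \<partial>C 0 n (\<lambda>_. undefined))"
    using space_C[OF u, of n] by (intro nn_integral_cong) (simp add: e)
  also have "\<dots> = emeasure (erw_kernel \<omega> n x) {x n} * emeasure (C 0 n (\<lambda>_. undefined)) {?r n}"
    using sets_C[OF u, of n] by (intro nn_integral_cmult_indicator) (simp add: PiM_eq)
  finally show ?thesis by (simp add: cyl mult.commute del: C.simps)
qed

lemma quenched_law_start: "emeasure (quenched_law \<omega>) {X. X 0 = 0} = 1"
proof -
  interpret prob_space "quenched_law \<omega>" by (rule prob_space_quenched_law)
  have "space (quenched_law \<omega>) = UNIV"
    using sets_eq_imp_space_eq[OF sets_quenched_law] by (simp add: space_PiM)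
  then show ?thesis
    using cylinder_step[of \<omega> 0 "\<lambda>_. 0"] emeasure_space_1
    by (simp add: erw_kernel_def)
qed

lemma quenched_law_step:
  assumes "\<omega> \<in> space env_space"
  shows "emeasure (quenched_law \<omega>) {X. (\<forall>k\<le>n. X k = x k) \<and> X (Suc n) = X n + 1}
     = ennreal (\<omega> (x n) (visits x n)) * emeasure (quenched_law \<omega>) {X. \<forall>k\<le>n. X k = x k}"
  and "emeasure (quenched_law \<omega>) {X. (\<forall>k\<le>n. X k = x k) \<and> X (Suc n) = X n - 1}
     = ennreal (1 - \<omega> (x n) (visits x n)) * emeasure (quenched_law \<omega>) {X. \<forall>k\<le>n. X k = x k}"
proof -
  have "card {k. k \<le> n \<and> x k = x n} \<noteq> 0"
    by (subst card_0_eq) auto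
  then have "visits x n \<in> {1..}"
    by (simp add: visits_def Suc_le_eq del: card_eq_0_iff card_0_eq)
  then have p: "0 \<le> \<omega> (x n) (visits x n)" "\<omega> (x n) (visits x n) \<le> 1"
    using assms by (auto simp: env_space_def cookie_space_def space_PiM space_restrict_space PiE_iff)
  have *: "emeasure (quenched_law \<omega>) {X. (\<forall>k\<le>n. X k = x k) \<and> X (Suc n) = X n + d}
     = emeasure (quenched_law \<omega>) {X. \<forall>k\<le>n. X k = x k} * emeasure (erw_kernel \<omega> (Suc n) x) {x n + d}" for d
  proof -
    let ?x = "x(Suc n := x n + d)"
    have v: "visits ?x n = visits x n"
      unfolding visits_def by (intro arg_cong[of _ _ card]) auto
    have "{X. (\<forall>k\<le>n. X k = x k) \<and> X (Suc n) = X n + d} = {X. \<forall>k<Suc (Suc n). X k = ?x k}"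
      by (auto simp: less_Suc_eq_le le_Suc_eq)
    moreover have "{X. \<forall>k\<le>n. X k = x k} = {X. \<forall>k<Suc n. X k = ?x k}"
      by (auto simp: less_Suc_eq_le)
    moreover have "erw_kernel \<omega> (Suc n) ?x = erw_kernel \<omega> (Suc n) x"
      by (simp add: erw_kernel_def v cong: if_cong)
    ultimately show ?thesis
      using cylinder_step[of \<omega> "Suc n" ?x] by simp
  qed
  have "(\<lambda>b. if b then x n + 1 else x n - 1) -` {x n + 1} = {True}"
       "(\<lambda>b. if b then x n + 1 else x n - 1) -` {x n - 1} = {False}"
    by (auto split: if_splits)
  then have "emeasure (erw_kernel \<omega> (Suc n) x) {x n + 1} = ennreal (\<omega> (x n) (visits x n))"
       "emeasure (erw_kernel \<omega> (Suc n) x) {x n - 1} = ennreal (1 - \<omega> (x n) (visits x n))"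
    using p by (simp_all add: erw_kernel_def emeasure_pmf_single del: measure_map_pmf)
       (simp_all add: pmf_map measure_pmf_single)
  then show "emeasure (quenched_law \<omega>) {X. (\<forall>k\<le>n. X k = x k) \<and> X (Suc n) = X n + 1}
     = ennreal (\<omega> (x n) (visits x n)) * emeasure (quenched_law \<omega>) {X. \<forall>k\<le>n. X k = x k}"
    and "emeasure (quenched_law \<omega>) {X. (\<forall>k\<le>n. X k = x k) \<and> X (Suc n) = X n - 1}
     = ennreal (1 - \<omega> (x n) (visits x n)) * emeasure (quenched_law \<omega>) {X. \<forall>k\<le>n. X k = x k}"
    using *[of 1] *[of "-1"] by (simp_all add: mult.commute)
qed

text \<open>The law, given the environment, of the Bernoulli variables \<open>\<xi> i j\<close>, with
  \<open>True\<close> for a success.\<close>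

definition coin_law :: "env \<Rightarrow> (int \<Rightarrow> nat \<Rightarrow> bool) measure" where
  "coin_law \<omega> = PiM UNIV (\<lambda>i. PiM {1..} (\<lambda>j. measure_pmf (bernoulli_pmf (\<omega> i j))))"

text \<open>If there are fewer than \<open>m\<close> successes the minimum does not exist and \<open>LEAST\<close> returns an
  unspecified number. When all but finitely many cookies of each stack have strength 1/2, this
  has probability 0.\<close>

definition failures :: "(nat \<Rightarrow> bool) \<Rightarrow> nat \<Rightarrow> nat" where
  "failures s m = (LEAST l. l \<ge> 1 \<and> (\<Sum>j=1..l. of_bool (s j)) = m) - m"

primrec V :: "(int \<Rightarrow> nat \<Rightarrow> bool) \<Rightarrow> nat \<Rightarrow> nat" where
  "V \<xi> 0 = 0"
| "V \<xi> (Suc i) = failures (\<xi> (int i)) (V \<xi> i + 1)"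

definition sigma1 :: "(int \<Rightarrow> nat \<Rightarrow> bool) \<Rightarrow> enat" where
  "sigma1 \<xi> = Inf {enat i |i. i > 0 \<and> V \<xi> i = 0}"

text \<open>Only used when \<open>sigma1 \<xi>\<close> is finite.\<close>

definition W1 :: "(int \<Rightarrow> nat \<Rightarrow> bool) \<Rightarrow> nat" where
  "W1 \<xi> = (\<Sum>i=1..the_enat (sigma1 \<xi>). V \<xi> i)"

definition elog :: "ennreal \<Rightarrow> ereal" where
  "elog p = (if p = 0 then -\<infinity> else if p = \<infinity> then \<infinity> else ereal (ln (enn2real p)))"

definition Lambda_W_sigma :: "env measure \<Rightarrow> real \<Rightarrow> real \<Rightarrow> ereal" where
  "Lambda_W_sigma P l \<eta> = elog (\<integral>\<^sup>+\<omega>. (\<integral>\<^sup>+\<xi>.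
     ennreal (exp (l * real (W1 \<xi>) + \<eta> * real (the_enat (sigma1 \<xi>)))) * indicator {\<xi>. sigma1 \<xi> < \<infinity>} \<xi>
     \<partial>coin_law \<omega>) \<partial>P)"

definition Lambda_V :: "env measure \<Rightarrow> real \<Rightarrow> ereal" where
  "Lambda_V P l = - (SUP \<eta>\<in>{\<eta>. Lambda_W_sigma P l \<eta> \<le> 0}. ereal \<eta>)"

definition I_V :: "env measure \<Rightarrow> real \<Rightarrow> ereal" where
  "I_V P x = (SUP l. ereal (l * x) - Lambda_V P l)"

definition I_T :: "env measure \<Rightarrow> real \<Rightarrow> ereal" where
  "I_T P t = I_V P ((t - 1) / 2)"

definition I_X :: "env measure \<Rightarrow> real \<Rightarrow> ereal" where
  "I_X P x = (if x > 0 then ereal x * I_T P (1 / x)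
              else if x = 0 then 0
              else ereal \<bar>x\<bar> * I_T (mirror_law P) (1 / \<bar>x\<bar>))"

end

theory Submission
  imports Defs "HOL-Real_Asymp.Real_Asymp"
begin

text \<open>Let the walk run on the coins \<open>\<xi> i j\<close>. If it first hits \<open>m\<close> at time \<open>t\<close>, the numbers of its
  left steps from the sites \<open>m - 1, \<dots>, 0\<close> form a trajectory of the branching process and
  \<open>m + 2 \<Sum> V\<^sub>k \<le> t\<close>, with equality when the trajectory returns to 0. Call \<open>(\<mu>, \<eta>)\<close> admissible
  if the sum of \<open>exp (\<mu> W + \<eta> \<sigma>)\<close> over excursions is at most 1; then \<open>I_X x\<close> is the supremum of
  \<open>\<mu> (1 - x) / 2 + \<eta> x\<close> over admissible pairs. Admissibility forces \<open>\<mu> \<le> 0\<close>, and for \<open>\<mu> < 0\<close> the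
  hitting sum of 0 yields an almost superharmonic function bounded below, which gives the upper
  bound through a Chernoff estimate. For the lower bound, the cost of return paths is
  subadditive under concatenation. A point that cannot be approximated by rescaled return paths
  is cut off from them by a hyperplane whose slopes are an admissible pair, contradicting the
  formula for \<open>I_X\<close>; repeating a nearly optimal return path gives the bound. Negative \<open>x\<close> follow
  by reflection, as the averaged law does not change when the sites are reflected.\<close>

section \<open>The walk driven by coins\<close>

text \<open>The hitting sum alone does not bound the weight of a trajectory with given length and
  area: such a trajectory may stop at any height, and the hitting sum is bounded below only on
  finite ranges of heights. A positive constant is therefore added. At large heights it is dominated
  by the factor \<open>exp (- \<mu> v)\<close> left over from the tilt, which grows only for
  \<open>\<mu> < 0\<close>; a pair with \<open>\<mu> = 0\<close> is first moved slightly below 0.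

  In the lower bound the trajectories must return to 0 because pieces concatenate independently
  there, and because the area then fixes the hitting time exactly. The bound
  \<open>\<mu> \<le> 0\<close> has its origin in the fair coins beyond M: staying at a large height
  h has a cost only logarithmic in h.\<close>

fun walk_state :: "(int \<Rightarrow> nat \<Rightarrow> bool) \<Rightarrow> nat \<Rightarrow> int \<times> (int \<Rightarrow> nat)" where
  "walk_state \<xi> 0 = (0, \<lambda>_. 0)"
| "walk_state \<xi> (Suc n) = (case walk_state \<xi> n of (y, N) \<Rightarrow>
     (if \<xi> y (Suc (N y)) then y + 1 else y - 1, N(y := Suc (N y))))"

definition walk :: "(int \<Rightarrow> nat \<Rightarrow> bool) \<Rightarrow> nat \<Rightarrow> int" where
  "walk \<xi> n = fst (walk_state \<xi> n)"

text \<open>Counts the departures from a site before time n, whereas \<open>visits\<close> in the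
  kernel also counts time n itself. Coins are numbered from 1, so the coin tossed at time n has the
  successor of this count as its number.\<close>

definition used :: "(int \<Rightarrow> nat \<Rightarrow> bool) \<Rightarrow> nat \<Rightarrow> int \<Rightarrow> nat" where
  "used \<xi> n = snd (walk_state \<xi> n)"

lemma walk_0 [simp]: "walk \<xi> 0 = 0"
  by (simp add: walk_def)

lemma used_0 [simp]: "used \<xi> 0 i = 0"
  by (simp add: used_def)

lemma walk_Suc: "walk \<xi> (Suc n) =
    (if \<xi> (walk \<xi> n) (Suc (used \<xi> n (walk \<xi> n))) then walk \<xi> n + 1 else walk \<xi> n - 1)"
  by (simp add: walk_def used_def split: prod.split)

lemma used_Suc: "used \<xi> (Suc n) = (used \<xi> n)(walk \<xi> n := Suc (used \<xi> n (walk \<xi> n)))"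
  by (simp add: walk_def used_def split: prod.split)

section \<open>Successes and failures in a single stack of coins\<close>

definition succs :: "(nat \<Rightarrow> bool) \<Rightarrow> nat \<Rightarrow> nat" where
  "succs s n = card {j \<in> {1..n}. s j}"

definition fails :: "(nat \<Rightarrow> bool) \<Rightarrow> nat \<Rightarrow> nat" where
  "fails s n = card {j \<in> {1..n}. \<not> s j}"

lemma succs_0 [simp]: "succs s 0 = 0" and fails_0 [simp]: "fails s 0 = 0"
  by (auto simp: succs_def fails_def)

lemma succs_Suc: "succs s (Suc n) = succs s n + of_bool (s (Suc n))"
proof -
  have "{j \<in> {1..Suc n}. s j} = (if s (Suc n) then insert (Suc n) {j \<in> {1..n}. s j} else {j \<in> {1..n}. s j})"
    by (auto simp: le_Suc_eq)
  then show ?thesis by (simp add: succs_def)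
qed

lemma fails_Suc: "fails s (Suc n) = fails s n + of_bool (\<not> s (Suc n))"
proof -
  have "{j \<in> {1..Suc n}. \<not> s j} = (if s (Suc n) then {j \<in> {1..n}. \<not> s j} else insert (Suc n) {j \<in> {1..n}. \<not> s j})"
    by (auto simp: le_Suc_eq)
  then show ?thesis by (simp add: fails_def)
qed

lemma succs_add_fails: "succs s n + fails s n = n"
  by (induction n) (auto simp: succs_Suc fails_Suc)

lemma succs_mono: "m \<le> n \<Longrightarrow> succs s m \<le> succs s n"
  unfolding succs_def by (intro card_mono) auto

lemma fails_mono: "m \<le> n \<Longrightarrow> fails s m \<le> fails s n"
  unfolding fails_def by (intro card_mono) auto

text \<open>The event \<open>F\<^sub>v\<^sub>+\<^sub>1 = v'\<close>. Unlike \<open>failures s (v + 1) = v'\<close> it is not affected by the junk value that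
  \<open>failures\<close> takes when there are too few successes.\<close>

definition fails_before :: "(nat \<Rightarrow> bool) \<Rightarrow> nat \<Rightarrow> nat \<Rightarrow> bool" where
  "fails_before s v v' \<longleftrightarrow> succs s (v + v') = v \<and> s (Suc (v + v'))"

lemma fails_before_unique:
  assumes "fails_before s v a" "fails_before s v b"
  shows "a = b"
proof -
  have False if "fails_before s v a" "fails_before s v b" "a < b" for a b
  proof -
    have "succs s (Suc (v + a)) \<le> succs s (v + b)"
      using that by (intro succs_mono) auto
    then show False
      using that by (auto simp: fails_before_def succs_Suc)
  qed
  then show ?thesis
    using assms by (metis linorder_neqE_nat)
qed

text \<open>Success number v + 1 sits at coin \<open>Suc (v + v')\<close>, and monotonicity of the
  success count excludes any smaller coin. This connects \<open>fails_before\<close> with the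
  recursion for \<open>V\<close>.\<close>

lemma failures_eq:
  assumes "fails_before s v v'"
  shows "failures s (Suc v) = v'"
proof -
  have sum: "(\<Sum>j=1..l. of_bool (s j)) = succs s l" for l
    by (induction l) (auto simp: succs_Suc)
  have "(LEAST l. 1 \<le> l \<and> (\<Sum>j=1..l. of_bool (s j)) = Suc v) = Suc (v + v')"
  proof (rule Least_equality)
    show "1 \<le> Suc (v + v') \<and> (\<Sum>j=1..Suc (v + v'). of_bool (s j)) = Suc v"
      using assms unfolding sum by (simp add: fails_before_def succs_Suc)
  next
    fix l assume l: "1 \<le> l \<and> (\<Sum>j=1..l. of_bool (s j)) = Suc v"
    show "Suc (v + v') \<le> l"
    proof (rule ccontr)
      assume "\<not> Suc (v + v') \<le> l"
      then have "succs s l \<le> succs s (v + v')" by (intro succs_mono) auto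
      then show False using l assms unfolding sum by (simp add: fails_before_def)
    qed
  qed
  then show ?thesis by (simp add: failures_def)
qed

text \<open>Take the first coin at which the count exceeds v. The count grows by at most one per
  coin, so it equals v just before, and this coin is a success.\<close>

lemma fails_before_exists:
  assumes "\<exists>l. succs s l > v"
  shows "\<exists>v'. fails_before s v v'"
proof -
  define l where "l = (LEAST l. succs s l > v)"
  have l: "succs s l > v" unfolding l_def using assms by (rule LeastI_ex)
  then obtain k where k: "l = Suc k" by (cases l) auto
  have "\<not> succs s k > v"
    using not_less_Least[of k "\<lambda>l. succs s l > v"] k by (auto simp: l_def)
  then have "succs s k = v" "s (Suc k)"
    using l k by (auto simp: succs_Suc of_bool_def split: if_splits)
  moreover have "k = v + (k - v)"
    using succs_add_fails[of s k] \<open>succs s k = v\<close> by simp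
  ultimately show ?thesis
    unfolding fails_before_def by metis
qed

section \<open>Edge crossings of the walk\<close>

text \<open>Each departure from i consumes the next coin of the stack at i, so the successes among
  the consumed coins are the steps from i to i + 1.\<close>

definition rights :: "(int \<Rightarrow> nat \<Rightarrow> bool) \<Rightarrow> nat \<Rightarrow> int \<Rightarrow> nat" where
  "rights \<xi> n i = succs (\<xi> i) (used \<xi> n i)"

definition lefts :: "(int \<Rightarrow> nat \<Rightarrow> bool) \<Rightarrow> nat \<Rightarrow> int \<Rightarrow> nat" where
  "lefts \<xi> n i = fails (\<xi> i) (used \<xi> n i)"

lemma rights_Suc: "rights \<xi> (Suc n) i = rights \<xi> n i + of_bool (i = walk \<xi> n \<and> walk \<xi> (Suc n) = walk \<xi> n + 1)"
  by (auto simp: rights_def used_Suc walk_Suc succs_Suc)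

lemma lefts_Suc: "lefts \<xi> (Suc n) i = lefts \<xi> n i + of_bool (i = walk \<xi> n \<and> walk \<xi> (Suc n) = walk \<xi> n - 1)"
  by (auto simp: lefts_def used_Suc walk_Suc fails_Suc)

lemma rights_add_lefts: "rights \<xi> n i + lefts \<xi> n i = used \<xi> n i"
  by (simp add: rights_def lefts_def succs_add_fails)

lemma walk_nearest_neighbour: "walk \<xi> (Suc n) = walk \<xi> n + 1 \<or> walk \<xi> (Suc n) = walk \<xi> n - 1"
  by (simp add: walk_Suc)

text \<open>Conservation of crossings of the edge between i and i + 1: the two directions alternate,
  so their numbers differ only by whether the start 0 and the current position lie to the right of
  the edge.\<close>

lemma rights_lefts_flow:
  "int (rights \<xi> n i) + of_bool (0 > i) = int (lefts \<xi> n (i + 1)) + of_bool (walk \<xi> n > i)"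
proof (induction n)
  case 0
  then show ?case by (simp add: rights_def lefts_def)
next
  case (Suc n)
  have "walk \<xi> (Suc n) = walk \<xi> n + 1 \<or> walk \<xi> (Suc n) = walk \<xi> n - 1"
    by (rule walk_nearest_neighbour)
  with Suc show ?case
    by (auto simp: rights_Suc lefts_Suc of_bool_def split: if_splits)
qed

text \<open>A nearest-neighbour walk that now stands to the right of i made its last departure from
  i to the right. Hence the coins used at i end with a success, as \<open>fails_before\<close>
  demands.\<close>

lemma last_departure_right:
  "used \<xi> n i > 0 \<Longrightarrow> walk \<xi> n > i \<Longrightarrow> \<xi> i (used \<xi> n i)"
proof (induction n)
  case (Suc n)
  then show ?case
    by (cases "i = walk \<xi> n") (auto simp: used_Suc walk_Suc split: if_splits)
qed simp

lemma sum_used_le: "finite I \<Longrightarrow> (\<Sum>i\<in>I. used \<xi> n i) \<le> n"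
proof (induction n)
  case (Suc n)
  have "(\<Sum>i\<in>I. used \<xi> (Suc n) i) = (\<Sum>i\<in>I. used \<xi> n i + of_bool (i = walk \<xi> n))"
    by (intro sum.cong) (auto simp: used_Suc)
  also have "\<dots> \<le> (\<Sum>i\<in>I. used \<xi> n i) + 1"
    using Suc.prems by (simp add: sum.distrib of_bool_def)
  finally show ?case using Suc by simp
qed simp

lemma sum_used_eq:
  assumes "finite I" "\<And>k. k < n \<Longrightarrow> walk \<xi> k \<in> I"
  shows "(\<Sum>i\<in>I. used \<xi> n i) = n"
  using assms(2)
proof (induction n)
  case (Suc n)
  have "(\<Sum>i\<in>I. used \<xi> (Suc n) i) = (\<Sum>i\<in>I. used \<xi> n i + of_bool (i = walk \<xi> n))"
    by (intro sum.cong) (auto simp: used_Suc)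
  also have "\<dots> = (\<Sum>i\<in>I. used \<xi> n i) + 1"
    using assms(1) Suc.prems[of n] by (simp add: sum.distrib of_bool_def)
  finally show ?case using Suc by simp
qed simp

lemma used_eq_0: "(\<And>k. k < n \<Longrightarrow> walk \<xi> k \<noteq> i) \<Longrightarrow> used \<xi> n i = 0"
  by (induction n) (auto simp: used_Suc)

text \<open>The lower bound places the walk at a known site at a time that is only close to n; this
  estimate transfers the position to time n.\<close>

lemma walk_lipschitz: "\<bar>walk \<xi> n - walk \<xi> m\<bar> \<le> \<bar>int n - int m\<bar>"
proof -
  have *: "\<bar>walk \<xi> (m + d) - walk \<xi> m\<bar> \<le> int d" for m d
  proof (induction d)
    case (Suc d)
    then show ?case using walk_nearest_neighbour[of \<xi> "m + d"] by auto
  qed simp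
  show ?thesis
  proof (cases "m \<le> n")
    case True
    then show ?thesis using *[of m "n - m"] by simp
  next
    case False
    then show ?thesis using *[of n "m - n"] by simp
  qed
qed

lemma walk_abs_le: "\<bar>walk \<xi> n\<bar> \<le> int n"
  using walk_lipschitz[of \<xi> n 0] by simp

text \<open>For \<open>g = int\<close> the list \<open>l\<close> is the beginning of the branching process \<open>V\<close> after time 0; for
  \<open>g k = m - 1 - k\<close> it lists the left steps that the walk makes from these sites before hitting \<open>m\<close>.\<close>

definition chain_event :: "(nat \<Rightarrow> int) \<Rightarrow> nat list \<Rightarrow> (int \<Rightarrow> nat \<Rightarrow> bool) \<Rightarrow> bool" where
  "chain_event g l \<xi> \<longleftrightarrow> (\<forall>k<length l. fails_before (\<xi> (g k)) ((0 # l) ! k) (l ! k))"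

text \<open>Each entry is determined by the previous one through \<open>fails_before_unique\<close>.
  Hence the events of different lists of one length are disjoint, and a list is identified by any
  chain event that it shares.\<close>

lemma chain_event_unique:
  assumes "chain_event g l \<xi>" "chain_event g l' \<xi>" "length l = length l'"
  shows "l = l'"
proof -
  have "k \<le> length l \<Longrightarrow> (0 # l) ! k = (0 # l') ! k" for k
  proof (induction k)
    case (Suc k)
    then have "(0 # l) ! k = (0 # l') ! k" by simp
    with Suc.prems assms show ?case
      unfolding chain_event_def by (metis Suc_le_lessD fails_before_unique nth_Cons_Suc)
  qed simp
  from this[of "Suc _"] show ?thesis
    using assms(3) by (intro nth_equalityI) auto
qed

lemma first_hit:
  assumes "walk \<xi> n \<ge> int m" "m > 0"
  obtains t where "t \<le> n" "walk \<xi> t = int m" "\<And>k. k < t \<Longrightarrow> walk \<xi> k < int m"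
proof -
  define t where "t = (LEAST t. walk \<xi> t \<ge> int m)"
  have t: "walk \<xi> t \<ge> int m" unfolding t_def using assms(1) by (rule LeastI)
  have tn: "t \<le> n" unfolding t_def using assms(1) by (rule Least_le)
  have lt: "walk \<xi> k < int m" if "k < t" for k
    using not_less_Least[OF that[unfolded t_def]] by simp
  obtain k where k: "t = Suc k" using t assms(2) by (cases t) auto
  have "walk \<xi> t = int m"
    using t lt[of k] k walk_nearest_neighbour[of \<xi> k] by auto
  with tn lt show ?thesis using that by blast
qed

lemma sum_int_interval: "(\<Sum>i\<in>{0..<int m}. f i) = (\<Sum>k<m. f (int k))"
  by (rule sum.reindex_bij_witness[of _ int nat]) auto

text \<open>At the hitting time every edge between 0 and m carries one more right step than left
  steps. So site i has made \<open>lefts \<xi> t (i + 1) + 1\<close> right steps, the last of its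
  coins being a success: this is one generation of the branching process. The bound on t adds up the
  coins used at the sites -1 to m - 1; visits further to the left are the reason for an
  inequality.\<close>

lemma hit_chain_event:
  assumes t: "walk \<xi> t = int m" "\<And>k. k < t \<Longrightarrow> walk \<xi> k < int m"
  defines "l \<equiv> map (\<lambda>k. lefts \<xi> t (int m - 1 - int k)) [0..<m]"
  shows "chain_event (\<lambda>k. int m - 1 - int k) l \<xi>" "m + 2 * sum_list l \<le> t"
proof -
  have L0: "lefts \<xi> t (int m) = 0"
    using used_eq_0[of t \<xi> "int m"] t(2) by (force simp: lefts_def)
  have R: "rights \<xi> t i = Suc (lefts \<xi> t (i + 1))" if "0 \<le> i" "i < int m" for i
    using rights_lefts_flow[of \<xi> t i] that t(1) by simp
  have fb: "fails_before (\<xi> i) (lefts \<xi> t (i + 1)) (lefts \<xi> t i)" if i: "0 \<le> i" "i < int m" for i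
  proof -
    have u: "used \<xi> t i = Suc (lefts \<xi> t (i + 1) + lefts \<xi> t i)"
      using rights_add_lefts[of \<xi> t i] R[OF i] by simp
    have "\<xi> i (used \<xi> t i)"
      using last_departure_right[of \<xi> t i] u i t(1) by simp
    then show ?thesis
      using R[OF i] unfolding rights_def u by (simp add: fails_before_def succs_Suc)
  qed
  have nth: "(0 # l) ! k = lefts \<xi> t (int m - int k)" if "k \<le> m" for k
    using that L0 by (cases k) (auto simp: l_def algebra_simps)
  show "chain_event (\<lambda>k. int m - 1 - int k) l \<xi>"
    unfolding chain_event_def
  proof (intro allI impI)
    fix k assume "k < length l"
    then have k: "k < m" by (simp add: l_def)
    with fb[of "int m - 1 - int k"] nth[of k] show "fails_before (\<xi> (int m - 1 - int k)) ((0 # l) ! k) (l ! k)"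
      by (simp add: l_def algebra_simps)
  qed
  have sl: "sum_list l = (\<Sum>k<m. lefts \<xi> t (int k))"
  proof -
    have "sum_list l = (\<Sum>k<m. lefts \<xi> t (int m - 1 - int k))"
      unfolding l_def by (simp add: interv_sum_list_conv_sum_set_nat atLeast0LessThan)
    also have "\<dots> = (\<Sum>k<m. lefts \<xi> t (int k))"
      by (rule sum.reindex_bij_witness[of _ "\<lambda>k. m - 1 - k" "\<lambda>k. m - 1 - k"]) (auto simp: of_nat_diff algebra_simps)
    finally show ?thesis .
  qed
  have tel: "(\<Sum>k<m. lefts \<xi> t (int k + 1)) + lefts \<xi> t 0 = (\<Sum>k<m. lefts \<xi> t (int k))"
  proof -
    have "lefts \<xi> t 0 + (\<Sum>k<m. lefts \<xi> t (int (Suc k))) = (\<Sum>k<Suc m. lefts \<xi> t (int k))"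
      by (subst sum.lessThan_Suc_shift) simp
    then show ?thesis using L0 by (simp add: ac_simps)
  qed
  \<comment> \<open>Every left step from 0 is answered by a step from -1 back to 0. These steps
    supply the term \<open>lefts \<xi> t 0\<close> that the telescoping sum over the sites 0 to m -
    1 lacks.\<close>
  have R1: "rights \<xi> t (-1) = lefts \<xi> t 0"
    using rights_lefts_flow[of \<xi> t "-1"] t(1) by simp
  have "(\<Sum>i\<in>insert (-1) {0..<int m}. used \<xi> t i) \<le> t"
    by (intro sum_used_le) auto
  moreover have "(\<Sum>i\<in>insert (-1) {0..<int m}. used \<xi> t i) = used \<xi> t (-1) + (\<Sum>k<m. used \<xi> t (int k))"
    by (subst sum.insert) (auto simp: sum_int_interval)
  moreover have "used \<xi> t (-1) \<ge> lefts \<xi> t 0"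
    using rights_add_lefts[of \<xi> t "-1"] R1 by simp
  moreover have "(\<Sum>k<m. used \<xi> t (int k)) = (\<Sum>k<m. lefts \<xi> t (int k) + (lefts \<xi> t (int k + 1) + 1))"
    using R by (intro sum.cong) (auto simp flip: rights_add_lefts)
  ultimately show "m + 2 * sum_list l \<le> t"
    unfolding sl using tel by (simp add: sum.distrib sum_Suc)
qed

text \<open>The final entry 0 prescribes no left step at site 0, which confines the walk to
  nonnegative sites before the hit. If m were not reached by time \<open>m + 2 * sum_list l\<close>,
  the left steps at each site would respect the list, and the coins used would account for fewer
  steps than that time.\<close>

lemma chain_event_hit:
  assumes ch: "chain_event (\<lambda>k. int m - 1 - int k) l \<xi>" and len: "length l = m"
    and last0: "last (0 # l) = 0"
  shows "walk \<xi> (m + 2 * sum_list l) = int m"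
proof -
  define N where "N = m + 2 * sum_list l"
  \<comment> \<open>The number of left steps that the list prescribes for site i; the leading 0
    belongs to site m.\<close>
  define d where "d i = (0 # l) ! nat (int m - i)" for i :: int
  have dm: "d (int m) = 0" by (simp add: d_def)
  have d0: "d 0 = 0"
    using last0 len last_conv_nth[of "0 # l"] by (simp add: d_def)
  have fb: "fails_before (\<xi> i) (d (i + 1)) (d i)" if i: "0 \<le> i" "i < int m" for i
  proof -
    have *: "nat (int m - i) = Suc (nat (int m - 1 - i))" "nat (int m - (i + 1)) = nat (int m - 1 - i)"
      using i by auto
    have "nat (int m - 1 - i) < length l" using i len by auto
    with ch have "fails_before (\<xi> (int m - 1 - int (nat (int m - 1 - i)))) ((0 # l) ! nat (int m - 1 - i)) (l ! nat (int m - 1 - i))"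
      unfolding chain_event_def by blast
    moreover have "int m - 1 - int (nat (int m - 1 - i)) = i" using i by simp
    ultimately show ?thesis unfolding d_def * by simp
  qed
  have sl: "sum_list l = (\<Sum>k<m. d (int k))"
  proof -
    have "sum_list l = (\<Sum>k<m. l ! k)"
      using len by (simp add: sum_list_sum_nth atLeast0LessThan)
    also have "\<dots> = (\<Sum>k<m. d (int k))"
    proof (rule sum.reindex_bij_witness[of _ "\<lambda>k. m - 1 - k" "\<lambda>k. m - 1 - k"])
      fix k assume "k \<in> {..<m}"
      then have "nat (int m - int (m - 1 - k)) = Suc k" by auto
      then show "d (int (m - 1 - k)) = l ! k" by (simp only: d_def nth_Cons_Suc)
    qed auto
    finally show ?thesis .
  qed
  have hit: "\<exists>t\<le>N. walk \<xi> t \<ge> int m"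
  proof (rule ccontr)
    assume "\<not> ?thesis"
    then have below: "walk \<xi> k < int m" if "k \<le> N" for k using that by force
    \<comment> \<open>To exceed the prescription at its position y the walk would need a failure
      beyond the first \<open>d y\<close>. By the flow identity at most \<open>d (y + 1)\<close>
      right steps have been made from y, and the first \<open>Suc (d (y + 1) + d y)\<close> coins
      there contain only \<open>d y\<close> failures.\<close>
    have inv: "n \<le> N \<Longrightarrow> \<forall>i\<in>{0..int m}. lefts \<xi> n i \<le> d i" for n
    proof (induction n)
      case 0
      then show ?case by (simp add: lefts_def)
    next
      case (Suc n)
      then have IH: "\<And>i. 0 \<le> i \<Longrightarrow> i \<le> int m \<Longrightarrow> lefts \<xi> n i \<le> d i" by auto
      let ?y = "walk \<xi> n"
      have y: "0 \<le> ?y" "?y < int m"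
        using rights_lefts_flow[of \<xi> n "-1"] IH[of 0] d0 below[of n] Suc.prems
        by (auto simp: of_bool_def split: if_splits)
      have "lefts \<xi> n ?y < d ?y" if left: "walk \<xi> (Suc n) = ?y - 1"
      proof (rule ccontr)
        assume "\<not> lefts \<xi> n ?y < d ?y"
        then have e: "lefts \<xi> n ?y = d ?y" using IH[of ?y] y by auto
        have r: "rights \<xi> n ?y \<le> d (?y + 1)"
          using rights_lefts_flow[of \<xi> n ?y] IH[of "?y + 1"] y by auto
        have "Suc (used \<xi> n ?y) \<le> Suc (d (?y + 1) + d ?y)"
          using rights_add_lefts[of \<xi> n ?y] e r by simp
        then have "fails (\<xi> ?y) (Suc (used \<xi> n ?y)) \<le> fails (\<xi> ?y) (Suc (d (?y + 1) + d ?y))"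
          by (rule fails_mono)
        moreover have "fails (\<xi> ?y) (Suc (used \<xi> n ?y)) = Suc (d ?y)"
          using left e by (auto simp: fails_Suc lefts_def walk_Suc split: if_splits)
        moreover have "fails (\<xi> ?y) (Suc (d (?y + 1) + d ?y)) = d ?y"
          using fb[of ?y] y succs_add_fails[of "\<xi> ?y" "d (?y + 1) + d ?y"]
          by (simp add: fails_before_def fails_Suc)
        ultimately show False by simp
      qed
      then show ?case
        using IH by (auto simp: lefts_Suc of_bool_def Suc_le_eq)
    qed
    have nonneg: "0 \<le> walk \<xi> n" if "n \<le> N" for n
      using rights_lefts_flow[of \<xi> n "-1"] bspec[OF inv[OF that], of 0] d0 by (auto simp: of_bool_def split: if_splits)
    have "N = (\<Sum>i\<in>{0..<int m}. used \<xi> N i)"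
      by (rule sum_used_eq[symmetric]) (use below nonneg in auto)
    also have "\<dots> = (\<Sum>k<m. used \<xi> N (int k))" by (rule sum_int_interval)
    finally have "int N = int (\<Sum>k<m. used \<xi> N (int k))" by (rule arg_cong)
    also have "\<dots> = (\<Sum>k<m. int (used \<xi> N (int k)))" by (rule of_nat_sum)
    also have "\<dots> = (\<Sum>k<m. int (lefts \<xi> N (int k)) + int (lefts \<xi> N (int k + 1)) + of_bool (int k < walk \<xi> N))"
    proof (intro sum.cong refl)
      fix k
      show "int (used \<xi> N (int k)) = int (lefts \<xi> N (int k)) + int (lefts \<xi> N (int k + 1)) + of_bool (int k < walk \<xi> N)"
        using rights_lefts_flow[of \<xi> N "int k"] by (simp flip: rights_add_lefts)
    qed
    also have "\<dots> \<le> (\<Sum>k<m. int (d (int k)) + int (d (int k + 1)) + of_bool (int k < walk \<xi> N))"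
      using inv[of N] by (intro sum_mono add_mono) auto
    also have "\<dots> = (\<Sum>k<m. int (d (int k))) + (\<Sum>k<m. int (d (int k + 1))) + (\<Sum>k<m. of_bool (int k < walk \<xi> N))"
      by (simp add: sum.distrib)
    also have "(\<Sum>k<m. int (d (int k + 1))) = (\<Sum>k<m. int (d (int k)))"
    proof -
      have "int (d 0) + (\<Sum>k<m. int (d (int (Suc k)))) = (\<Sum>k<Suc m. int (d (int k)))"
        by (subst sum.lessThan_Suc_shift) simp
      then show ?thesis using d0 dm by (simp add: ac_simps)
    qed
    also have "(\<Sum>k<m. of_bool (int k < walk \<xi> N)) = (int (card {k\<in>{..<m}. int k < walk \<xi> N}) :: int)"
      by (simp add: of_bool_def Int_def flip: sum.inter_filter)
    also have "{k\<in>{..<m}. int k < walk \<xi> N} = {..<nat (walk \<xi> N)}"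
      using below[of N] by auto
    finally have "int N \<le> 2 * int (sum_list l) + walk \<xi> N"
      using nonneg[of N] unfolding sl by simp
    then show False using below[of N] by (simp add: N_def)
  qed
  show ?thesis
  proof (cases "m = 0")
    case True
    then show ?thesis using len by simp
  next
    case False
    obtain t0 where "t0 \<le> N" "walk \<xi> t0 \<ge> int m" using hit by blast
    then obtain t where t: "t \<le> N" "walk \<xi> t = int m" "\<And>k. k < t \<Longrightarrow> walk \<xi> k < int m"
      using first_hit[of m \<xi> t0] False by (metis le_trans neq0_conv)
    \<comment> \<open>The list read off from the actual hit must be \<open>l\<close> by uniqueness.
      So N is a lower bound for the hitting time t, and \<open>t \<le> N\<close> is known
      already.\<close>
    note h = hit_chain_event[OF t(2,3)]
    have "map (\<lambda>k. lefts \<xi> t (int m - 1 - int k)) [0..<m] = l"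
      by (rule chain_event_unique[OF h(1) ch]) (simp_all add: len)
    with h(2) t(1) have "t = N" by (simp add: N_def)
    with t(2) show ?thesis by (simp add: N_def)
  qed
qed

section \<open>Laws of stacks and paths\<close>

definition stack_law :: "(nat \<Rightarrow> real) \<Rightarrow> (nat \<Rightarrow> bool) measure" where
  "stack_law c = PiM {1..} (\<lambda>j. measure_pmf (bernoulli_pmf (c j)))"

lemma coin_law_eq: "coin_law \<omega> = PiM UNIV (\<lambda>i. stack_law (\<omega> i))"
  by (simp add: coin_law_def stack_law_def)

lemma prob_space_stack_law: "prob_space (stack_law c)"
  unfolding stack_law_def by (intro prob_space_PiM prob_space_measure_pmf)

lemma product_prob_space_stack: "product_prob_space (\<lambda>j. measure_pmf (bernoulli_pmf (c j)))"
  by (intro product_prob_spaceI prob_space_measure_pmf)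

lemma product_prob_space_coin: "product_prob_space (\<lambda>i. stack_law (\<omega> i))"
  by (intro product_prob_spaceI prob_space_stack_law)

lemma sets_stack_law: "sets (stack_law c) = sets (PiM {1..} (\<lambda>_. count_space UNIV))"
  unfolding stack_law_def by (intro sets_PiM_cong) auto

lemma space_stack_law: "space (stack_law c) = extensional {1..}"
  using sets_eq_imp_space_eq[OF sets_stack_law] by (simp add: space_PiM PiE_def)

lemma measurable_stack_coin [measurable (raw)]: 
  "j \<in> {1..} \<Longrightarrow> (\<lambda>s. s j) \<in> measurable (stack_law c) (count_space UNIV)"
  unfolding measurable_cong_sets[OF sets_stack_law refl] by (rule measurable_component_singleton)

lemma measurable_coin_stack:
  "(\<lambda>\<xi>. \<xi> i) \<in> measurable (coin_law \<omega>) (stack_law (\<omega> i))"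
  unfolding coin_law_eq by (rule measurable_component_singleton) simp

lemma stack_pattern_sets:
  assumes "J \<subseteq> {1..}" "finite J"
  shows "{s \<in> space (stack_law c). \<forall>j\<in>J. s j = b j} \<in> sets (stack_law c)"
proof -
  have "\<And>j. j \<in> J \<Longrightarrow> {s \<in> space (stack_law c). s j = b j} \<in> sets (stack_law c)"
    using assms measurable_sets_Collect[OF measurable_stack_coin, of _ "\<lambda>x. x = b _" c] by auto
  then show ?thesis
    using assms by (intro sets.sets_Collect_finite_All) auto
qed

lemma emeasure_stack_pattern:
  assumes "J \<subseteq> {1..}" "finite J"
  shows "emeasure (stack_law c) {s \<in> space (stack_law c). \<forall>j\<in>J. s j = b j}
    = (\<Prod>j\<in>J. ennreal (pmf (bernoulli_pmf (c j)) (b j)))"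
proof -
  interpret product_prob_space "\<lambda>j. measure_pmf (bernoulli_pmf (c j))" "{1..}"
    by (rule product_prob_space_stack)
  show ?thesis
    using emeasure_PiM_Collect[OF assms, of "\<lambda>j. {b j}"]
    by (simp add: stack_law_def emeasure_pmf_single)
qed

lemma coin_rect_sets:
  assumes "finite I" "\<And>i. i \<in> I \<Longrightarrow> A i \<in> sets (stack_law (\<omega> i))"
  shows "{\<xi> \<in> space (coin_law \<omega>). \<forall>i\<in>I. \<xi> i \<in> A i} \<in> sets (coin_law \<omega>)"
proof -
  have "{\<xi> \<in> space (coin_law \<omega>). \<xi> i \<in> A i} \<in> sets (coin_law \<omega>)" if "i \<in> I" for i
    using measurable_sets[OF measurable_coin_stack[of i \<omega>] assms(2)[OF that]] by (simp add: vimage_def Int_def conj_commute)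
  then show ?thesis
    using assms by (intro sets.sets_Collect_finite_All) auto
qed

lemma emeasure_coin_rect:
  assumes "finite I" "\<And>i. i \<in> I \<Longrightarrow> A i \<in> sets (stack_law (\<omega> i))"
  shows "emeasure (coin_law \<omega>) {\<xi> \<in> space (coin_law \<omega>). \<forall>i\<in>I. \<xi> i \<in> A i}
    = (\<Prod>i\<in>I. emeasure (stack_law (\<omega> i)) (A i))"
proof -
  interpret product_prob_space "\<lambda>i. stack_law (\<omega> i)" UNIV
    by (rule product_prob_space_coin)
  show ?thesis
    using emeasure_PiM_Collect[of I A] assms by (simp add: coin_law_eq)
qed

lemma space_coin_lawD: "\<xi> \<in> space (coin_law \<omega>) \<Longrightarrow> \<xi> i \<in> space (stack_law c)"
  unfolding coin_law_eq by (auto simp: space_PiM space_stack_law)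

text \<open>\<open>coin_law\<close> is a product over sites of products over coins, so a finite
  pattern is split into its sections over the sites.\<close>

lemma coin_pattern:
  assumes "finite K" "K \<subseteq> UNIV \<times> {1..}"
  shows "{\<xi> \<in> space (coin_law \<omega>). \<forall>(i,j)\<in>K. \<xi> i j = b i j} \<in> sets (coin_law \<omega>)"
    and "emeasure (coin_law \<omega>) {\<xi> \<in> space (coin_law \<omega>). \<forall>(i,j)\<in>K. \<xi> i j = b i j}
    = (\<Prod>(i,j)\<in>K. ennreal (pmf (bernoulli_pmf (\<omega> i j)) (b i j)))"
proof -
  let ?A = "\<lambda>i. {s \<in> space (stack_law (\<omega> i)). \<forall>j\<in>K `` {i}. s j = b i j}"
  have K: "finite (K `` {i})" "K `` {i} \<subseteq> {1..}" for i
    using assms by auto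
  have A: "?A i \<in> sets (stack_law (\<omega> i))" for i
    using K by (intro stack_pattern_sets) auto
  have eq: "{\<xi> \<in> space (coin_law \<omega>). \<forall>(i,j)\<in>K. \<xi> i j = b i j} = {\<xi> \<in> space (coin_law \<omega>). \<forall>i\<in>fst ` K. \<xi> i \<in> ?A i}"
    using space_coin_lawD by force
  show "{\<xi> \<in> space (coin_law \<omega>). \<forall>(i,j)\<in>K. \<xi> i j = b i j} \<in> sets (coin_law \<omega>)"
    unfolding eq using assms A by (intro coin_rect_sets) auto
  have "emeasure (coin_law \<omega>) {\<xi> \<in> space (coin_law \<omega>). \<forall>(i,j)\<in>K. \<xi> i j = b i j}
      = (\<Prod>i\<in>fst ` K. emeasure (stack_law (\<omega> i)) (?A i))"
    unfolding eq using assms A by (intro emeasure_coin_rect) auto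
  also have "\<dots> = (\<Prod>i\<in>fst ` K. \<Prod>j\<in>K `` {i}. ennreal (pmf (bernoulli_pmf (\<omega> i j)) (b i j)))"
    using K by (intro prod.cong refl emeasure_stack_pattern) auto
  also have "\<dots> = (\<Prod>(i,j)\<in>Sigma (fst ` K) (\<lambda>i. K `` {i}). ennreal (pmf (bernoulli_pmf (\<omega> i j)) (b i j)))"
    using assms K by (intro prod.Sigma) auto
  also have "Sigma (fst ` K) (\<lambda>i. K `` {i}) = K" by force
  finally show "emeasure (coin_law \<omega>) {\<xi> \<in> space (coin_law \<omega>). \<forall>(i,j)\<in>K. \<xi> i j = b i j}
    = (\<Prod>(i,j)\<in>K. ennreal (pmf (bernoulli_pmf (\<omega> i j)) (b i j)))" .
qed

section \<open>Path probabilities and the quenched law\<close>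

lemma visits_pos: "visits x n \<ge> 1"
proof -
  have "{n} \<subseteq> {k. k \<le> n \<and> x k = x n}" by auto
  then have "card {n} \<le> visits x n" unfolding visits_def by (intro card_mono) auto
  then show ?thesis by simp
qed

text \<open>Different times of a path toss different coins. This is what makes path probabilities
  products of independent factors.\<close>

lemma visits_inj: "inj_on (\<lambda>k. (x k, visits x k)) A"
proof -
  have *: "visits x k < visits x k'" if "k < k'" "x k = x k'" for k k'
  proof -
    have "k' \<in> {i. i \<le> k' \<and> x i = x k'}" "k' \<notin> {i. i \<le> k \<and> x i = x k}"
      using that by auto
    then have "{i. i \<le> k \<and> x i = x k} \<subset> {i. i \<le> k' \<and> x i = x k'}"
      using that by fastforce
    then show ?thesis
      unfolding visits_def by (intro psubset_card_mono) auto
  qed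
  show ?thesis
    by (rule inj_onI) (metis * less_irrefl linorder_neqE_nat prod.inject)
qed

lemma used_eq_card: "used \<xi> n i = card {k. k < n \<and> walk \<xi> k = i}"
proof (induction n)
  case (Suc n)
  have "{k. k < Suc n \<and> walk \<xi> k = i} = (if walk \<xi> n = i then insert n {k. k < n \<and> walk \<xi> k = i} else {k. k < n \<and> walk \<xi> k = i})"
    by (auto simp: less_Suc_eq)
  with Suc show ?case by (auto simp: used_Suc)
qed simp

lemma Suc_used_eq_visits:
  assumes "\<And>k. k \<le> n \<Longrightarrow> walk \<xi> k = x k"
  shows "Suc (used \<xi> n (walk \<xi> n)) = visits x n"
proof -
  have "{k. k \<le> n \<and> x k = x n} = insert n {k. k < n \<and> walk \<xi> k = walk \<xi> n}"
    using assms by auto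
  then show ?thesis by (simp add: visits_def used_eq_card)
qed

text \<open>Following a prescribed path is a condition on finitely many coins: at time k the coin
  tossed is number \<open>visits x k\<close> at site \<open>x k\<close>.\<close>

lemma walk_path_iff:
  "(\<forall>k\<le>n. walk \<xi> k = x k) \<longleftrightarrow> x 0 = 0 \<and> (\<forall>k<n. x (Suc k) = x k + 1 \<or> x (Suc k) = x k - 1) \<and>
     (\<forall>k<n. \<xi> (x k) (visits x k) = (x (Suc k) = x k + 1))"
proof (induction n)
  case (Suc n)
  have "(\<forall>k\<le>Suc n. walk \<xi> k = x k) \<longleftrightarrow> (\<forall>k\<le>n. walk \<xi> k = x k) \<and> walk \<xi> (Suc n) = x (Suc n)"
    by (auto simp: le_Suc_eq)
  also have "\<dots> \<longleftrightarrow> (\<forall>k\<le>n. walk \<xi> k = x k) \<and> (x (Suc n) = x n + 1 \<or> x (Suc n) = x n - 1) \<and>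
      \<xi> (x n) (visits x n) = (x (Suc n) = x n + 1)"
  proof (intro conj_cong refl)
    assume w: "\<forall>k\<le>n. walk \<xi> k = x k"
    have "Suc (used \<xi> n (walk \<xi> n)) = visits x n"
      using w by (intro Suc_used_eq_visits) auto
    with w show "walk \<xi> (Suc n) = x (Suc n) \<longleftrightarrow> (x (Suc n) = x n + 1 \<or> x (Suc n) = x n - 1) \<and>
      \<xi> (x n) (visits x n) = (x (Suc n) = x n + 1)"
      by (auto simp: walk_Suc)
  qed
  finally show ?case
    unfolding Suc by (auto simp: less_Suc_eq)
qed auto

text \<open>Common value of the probability of an initial path under \<open>quenched_law\<close> and
  under the coin-driven walk; the two laws are compared through it.\<close>

definition path_weight :: "env \<Rightarrow> (nat \<Rightarrow> int) \<Rightarrow> nat \<Rightarrow> ennreal" where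
  "path_weight \<omega> x n = (if x 0 = 0 \<and> (\<forall>k<n. x (Suc k) = x k + 1 \<or> x (Suc k) = x k - 1)
     then \<Prod>k<n. ennreal (pmf (bernoulli_pmf (\<omega> (x k) (visits x k))) (x (Suc k) = x k + 1)) else 0)"

lemma coin_law_walk_path:
  shows "{\<xi> \<in> space (coin_law \<omega>). \<forall>k\<le>n. walk \<xi> k = x k} \<in> sets (coin_law \<omega>)" (is ?meas)
    and "emeasure (coin_law \<omega>) {\<xi> \<in> space (coin_law \<omega>). \<forall>k\<le>n. walk \<xi> k = x k} = path_weight \<omega> x n" (is ?prob)
proof -
  have "?meas \<and> ?prob" if nn: "\<not> (x 0 = 0 \<and> (\<forall>k<n. x (Suc k) = x k + 1 \<or> x (Suc k) = x k - 1))"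
  proof
    have "\<not> (\<forall>k\<le>n. walk \<xi> k = x k)" for \<xi>
      using nn walk_path_iff[of n \<xi> x] by argo
    then have eq: "{\<xi> \<in> space (coin_law \<omega>). \<forall>k\<le>n. walk \<xi> k = x k} = {}"
      by (simp only: simp_thms Collect_empty_eq)
    show ?meas unfolding eq by simp
    show ?prob unfolding eq path_weight_def if_not_P[OF nn] by simp
  qed
  moreover have "?meas \<and> ?prob" if nn: "x 0 = 0 \<and> (\<forall>k<n. x (Suc k) = x k + 1 \<or> x (Suc k) = x k - 1)"
  proof
    let ?K = "(\<lambda>k. (x k, visits x k)) ` {..<n}"
    \<comment> \<open>The outcome that the path prescribes for each coin, unambiguous because no
      coin is tossed twice.\<close>
    define b where "b i j = (\<exists>k<n. (x k, visits x k) = (i, j) \<and> x (Suc k) = x k + 1)" for i j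
    have b: "b (x k) (visits x k) = (x (Suc k) = x k + 1)" if "k < n" for k
      using inj_onD[OF visits_inj[of x UNIV]] that unfolding b_def by blast
    have eq: "{\<xi> \<in> space (coin_law \<omega>). \<forall>k\<le>n. walk \<xi> k = x k} = {\<xi> \<in> space (coin_law \<omega>). \<forall>(i,j)\<in>?K. \<xi> i j = b i j}"
    proof (intro Collect_cong conj_cong refl)
      fix \<xi>
      have "(\<forall>k\<le>n. walk \<xi> k = x k) \<longleftrightarrow> (\<forall>k<n. \<xi> (x k) (visits x k) = (x (Suc k) = x k + 1))"
        using walk_path_iff[of n \<xi> x] nn by argo
      also have "\<dots> \<longleftrightarrow> (\<forall>(i,j)\<in>?K. \<xi> i j = b i j)"
        using b by auto
      finally show "(\<forall>k\<le>n. walk \<xi> k = x k) \<longleftrightarrow> (\<forall>(i,j)\<in>?K. \<xi> i j = b i j)" .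
    qed
    have K: "finite ?K" "?K \<subseteq> UNIV \<times> {1..}" using visits_pos by auto
    show ?meas unfolding eq by (rule coin_pattern[OF K])
    have "emeasure (coin_law \<omega>) {\<xi> \<in> space (coin_law \<omega>). \<forall>k\<le>n. walk \<xi> k = x k}
       = (\<Prod>(i,j)\<in>?K. ennreal (pmf (bernoulli_pmf (\<omega> i j)) (b i j)))"
      unfolding eq by (rule coin_pattern[OF K])
    also have "\<dots> = (\<Prod>k<n. ennreal (pmf (bernoulli_pmf (\<omega> (x k) (visits x k))) (x (Suc k) = x k + 1)))"
      by (subst prod.reindex[OF visits_inj]) (auto intro!: prod.cong simp: b)
    finally show ?prob unfolding path_weight_def if_P[OF nn] .
  qed
  ultimately show ?meas ?prob by argo+
qed

lemma emeasure_erw_kernel_Suc: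
  "emeasure (erw_kernel \<omega> (Suc k) x) {y} = (if y = x k + 1 \<or> y = x k - 1
     then ennreal (pmf (bernoulli_pmf (\<omega> (x k) (visits x k))) (y = x k + 1)) else 0)"
proof -
  have "(\<lambda>b. if b then x k + 1 else x k - 1) -` {y} = (if y = x k + 1 then {True} else if y = x k - 1 then {False} else {})"
    by (auto split: if_splits)
  then show ?thesis
    by (auto simp: erw_kernel_def emeasure_pmf_single simp del: measure_map_pmf)
      (simp_all add: pmf_map measure_pmf_single)
qed

lemma quenched_law_path:
  "emeasure (quenched_law \<omega>) {X. \<forall>k\<le>n. X k = x k} = path_weight \<omega> x n"
proof (induction n)
  case 0
  interpret prob_space "quenched_law \<omega>" by (rule prob_space_quenched_law)
  have "space (quenched_law \<omega>) = UNIV"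
    using sets_eq_imp_space_eq[OF sets_quenched_law] by (simp add: space_PiM)
  then show ?case
    using cylinder_step[of \<omega> 0 x] emeasure_space_1
    by (simp add: path_weight_def erw_kernel_def indicator_def)
next
  case (Suc n)
  have "emeasure (quenched_law \<omega>) {X. \<forall>k\<le>Suc n. X k = x k} = path_weight \<omega> x n * emeasure (erw_kernel \<omega> (Suc n) x) {x (Suc n)}"
    using cylinder_step[of \<omega> "Suc n" x] Suc by (simp add: less_Suc_eq_le)
  then show ?case
    unfolding emeasure_erw_kernel_Suc by (auto simp: path_weight_def less_Suc_eq)
qed

definition path_of :: "int list \<Rightarrow> nat \<Rightarrow> int" where
  "path_of l k = (if k < length l then l ! k else 0)"

text \<open>Initial paths are coded as lists, of which there are countably many, so an event at time
  n is a countable disjoint union of path events. The process \<open>f\<close> is left abstract to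
  cover both the coordinate process and \<open>walk\<close>.\<close>

lemma emeasure_path_decomp:
  fixes f :: "'a \<Rightarrow> nat \<Rightarrow> int"
  assumes "\<And>x. {\<xi> \<in> space N. \<forall>k\<le>n. f \<xi> k = x k} \<in> sets N"
  shows "{\<xi> \<in> space N. f \<xi> n \<in> S} \<in> sets N" 
    and "emeasure N {\<xi> \<in> space N. f \<xi> n \<in> S}
    = (\<integral>\<^sup>+l. emeasure N {\<xi> \<in> space N. \<forall>k\<le>n. f \<xi> k = l ! k} \<partial>count_space {l. length l = Suc n \<and> l ! n \<in> S})"
proof -
  let ?I = "{l. length l = Suc n \<and> l ! n \<in> S}"
  have eq: "{\<xi> \<in> space N. f \<xi> n \<in> S} = (\<Union>l\<in>?I. {\<xi> \<in> space N. \<forall>k\<le>n. f \<xi> k = l ! k})"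
  proof (intro set_eqI iffI)
    fix \<xi> assume "\<xi> \<in> {\<xi> \<in> space N. f \<xi> n \<in> S}"
    then have "map (f \<xi>) [0..<Suc n] \<in> ?I \<and> \<xi> \<in> {\<xi>' \<in> space N. \<forall>k\<le>n. f \<xi>' k = map (f \<xi>) [0..<Suc n] ! k}"
      by (auto simp: nth_append simp del: upt_Suc)
    then show "\<xi> \<in> (\<Union>l\<in>?I. {\<xi> \<in> space N. \<forall>k\<le>n. f \<xi> k = l ! k})" by blast
  qed auto
  show "{\<xi> \<in> space N. f \<xi> n \<in> S} \<in> sets N"
    unfolding eq by (intro sets.countable_UN'[OF countableI_type] image_subsetI assms)
  show "emeasure N {\<xi> \<in> space N. f \<xi> n \<in> S}
    = (\<integral>\<^sup>+l. emeasure N {\<xi> \<in> space N. \<forall>k\<le>n. f \<xi> k = l ! k} \<partial>count_space ?I)"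
    unfolding eq
  proof (rule emeasure_UN_countable[OF assms countableI_type])
    show "disjoint_family_on (\<lambda>l. {\<xi> \<in> space N. \<forall>k\<le>n. f \<xi> k = l ! k}) ?I"
    proof (unfold disjoint_family_on_def, intro ballI impI)
      fix l l' assume l: "l \<in> ?I" "l' \<in> ?I" "l \<noteq> l'"
      then obtain k where "k < Suc n" "l ! k \<noteq> l' ! k" by (auto simp: list_eq_iff_nth_eq)
      then show "{\<xi> \<in> space N. \<forall>k\<le>n. f \<xi> k = l ! k} \<inter> {\<xi> \<in> space N. \<forall>k\<le>n. f \<xi> k = l' ! k} = {}"
        by (auto simp: less_Suc_eq_le)
    qed
  qed
qed

lemma sets_quenched_path: "{X \<in> space (quenched_law \<omega>). \<forall>k\<le>n. X k = x k} \<in> sets (quenched_law \<omega>)"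
proof -
  have "(\<lambda>X. X k) \<in> measurable (quenched_law \<omega>) (count_space UNIV)" for k
    unfolding measurable_cong_sets[OF sets_quenched_law refl]
    by (rule measurable_component_singleton) simp
  note [measurable] = this
  have "{X \<in> space (quenched_law \<omega>). \<forall>k\<in>{..n}. X k = x k} \<in> sets (quenched_law \<omega>)"
    by measurable
  then show ?thesis by (simp add: Ball_def)
qed

lemma space_quenched_law: "space (quenched_law \<omega>) = UNIV"
  using sets_eq_imp_space_eq[OF sets_quenched_law] by (simp add: space_PiM)

lemma quenched_law_sum:
  "emeasure (quenched_law \<omega>) {X. X n \<in> S}
    = (\<integral>\<^sup>+l. path_weight \<omega> (\<lambda>k. l ! k) n \<partial>count_space {l. length l = Suc n \<and> l ! n \<in> S})"
  using emeasure_path_decomp(2)[where f = "\<lambda>X. X", OF sets_quenched_path, of \<omega> n S]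
  by (simp add: space_quenched_law quenched_law_path)

lemma walk_measurable: "{\<xi> \<in> space (coin_law \<omega>). walk \<xi> n \<in> S} \<in> sets (coin_law \<omega>)"
  by (rule emeasure_path_decomp(1)[where f = walk, OF coin_law_walk_path(1)])

lemma quenched_law_eq_walk:
  "emeasure (quenched_law \<omega>) {X. X n \<in> S} = emeasure (coin_law \<omega>) {\<xi> \<in> space (coin_law \<omega>). walk \<xi> n \<in> S}"
  unfolding quenched_law_sum emeasure_path_decomp(2)[where f = walk, OF coin_law_walk_path(1)]
  by (simp add: coin_law_walk_path)

section \<open>Laws of failure counts and of chain events\<close>

text \<open>S is the set of positions of the first v successes; coin \<open>Suc (v + v')\<close> is
  success number v + 1.\<close>

definition fail_prob :: "(nat \<Rightarrow> real) \<Rightarrow> nat \<Rightarrow> nat \<Rightarrow> ennreal" where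
  "fail_prob c v v' = (\<Sum>S\<in>{S. S \<subseteq> {1..v + v'} \<and> card S = v}.
     \<Prod>j\<in>{1..Suc (v + v')}. ennreal (pmf (bernoulli_pmf (c j)) (j \<in> insert (Suc (v + v')) S)))"

lemma fails_before_law:
  shows "{s \<in> space (stack_law c). fails_before s v v'} \<in> sets (stack_law c)" (is ?meas)
    and "emeasure (stack_law c) {s \<in> space (stack_law c). fails_before s v v'} = fail_prob c v v'" (is ?prob)
proof -
  let ?N = "Suc (v + v')"
  let ?I = "{S. S \<subseteq> {1..v + v'} \<and> card S = v}"
  let ?A = "\<lambda>S. {s \<in> space (stack_law c). \<forall>j\<in>{1..?N}. s j = (j \<in> insert ?N S)}"
  have fin: "finite ?I" by (rule finite_subset[of _ "Pow {1..v + v'}"]) auto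
  have rec: "{j\<in>{1..v + v'}. s j} = S" if "S \<in> ?I" "s \<in> ?A S" for s S
    using that by force
  have eq: "{s \<in> space (stack_law c). fails_before s v v'} = (\<Union>S\<in>?I. ?A S)"
  proof (intro equalityI subsetI)
    fix s assume s: "s \<in> {s \<in> space (stack_law c). fails_before s v v'}"
    let ?S = "{j\<in>{1..v + v'}. s j}"
    have "?S \<in> ?I" using s by (auto simp: fails_before_def succs_def)
    moreover have "s \<in> ?A ?S" using s by (auto simp: fails_before_def le_Suc_eq)
    ultimately show "s \<in> (\<Union>S\<in>?I. ?A S)" by (rule UN_I)
  next
    fix s assume "s \<in> (\<Union>S\<in>?I. ?A S)"
    then obtain S where S: "S \<in> ?I" "s \<in> ?A S" by (rule UN_E)
    then have "{j\<in>{1..v + v'}. s j} = S" by (rule rec)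
    with S show "s \<in> {s \<in> space (stack_law c). fails_before s v v'}"
      by (auto simp: fails_before_def succs_def)
  qed
  have m: "?A S \<in> sets (stack_law c)" for S
    by (rule stack_pattern_sets) auto
  show ?meas unfolding eq by (rule sets.finite_UN[OF fin m])
  have disj: "disjoint_family_on ?A ?I"
  proof (unfold disjoint_family_on_def, intro ballI impI)
    fix S S' assume S: "S \<in> ?I" "S' \<in> ?I" "S \<noteq> S'"
    show "?A S \<inter> ?A S' = {}"
    proof (rule equals0I)
      fix s assume "s \<in> ?A S \<inter> ?A S'"
      then have "s \<in> ?A S" "s \<in> ?A S'" by (rule IntD1, rule IntD2)
      from rec[OF S(1) this(1)] rec[OF S(2) this(2)] have "S = S'"
        by (rule trans[OF sym])
      with S(3) show False by contradiction
    qed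
  qed
  have "emeasure (stack_law c) (\<Union>S\<in>?I. ?A S) = (\<Sum>S\<in>?I. emeasure (stack_law c) (?A S))"
    by (rule sum_emeasure[OF _ disj fin, symmetric]) (intro image_subsetI m)
  also have "\<dots> = fail_prob c v v'"
    unfolding fail_prob_def by (intro sum.cong refl emeasure_stack_pattern) auto
  finally show ?prob unfolding eq .
qed

text \<open>Since \<open>g\<close> is injective, different entries of the list concern different
  sites, whose stacks are independent.\<close>

lemma chain_event_law:
  assumes g: "inj_on g {..<length l}"
  shows "{\<xi> \<in> space (coin_law \<omega>). chain_event g l \<xi>} \<in> sets (coin_law \<omega>)" (is ?meas)
    and "emeasure (coin_law \<omega>) {\<xi> \<in> space (coin_law \<omega>). chain_event g l \<xi>}
      = (\<Prod>k<length l. fail_prob (\<omega> (g k)) ((0 # l) ! k) (l ! k))" (is ?prob)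
proof -
  let ?h = "the_inv_into {..<length l} g"
  let ?A = "\<lambda>i. {s \<in> space (stack_law (\<omega> i)). fails_before s ((0 # l) ! ?h i) (l ! ?h i)}"
  have h: "?h (g k) = k" if "k < length l" for k
    using that g by (simp add: the_inv_into_f_f)
  have eq: "{\<xi> \<in> space (coin_law \<omega>). chain_event g l \<xi>} = {\<xi> \<in> space (coin_law \<omega>). \<forall>i\<in>g ` {..<length l}. \<xi> i \<in> ?A i}"
    using h space_coin_lawD by (auto simp: chain_event_def)
  show ?meas unfolding eq by (intro coin_rect_sets fails_before_law) auto
  have "emeasure (coin_law \<omega>) {\<xi> \<in> space (coin_law \<omega>). chain_event g l \<xi>}
     = (\<Prod>i\<in>g ` {..<length l}. emeasure (stack_law (\<omega> i)) (?A i))"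
    unfolding eq by (intro emeasure_coin_rect fails_before_law) auto
  also have "\<dots> = (\<Prod>k<length l. fail_prob (\<omega> (g k)) ((0 # l) ! k) (l ! k))"
    by (subst prod.reindex[OF g]) (auto intro!: prod.cong simp: fails_before_law h)
  finally show ?prob .
qed

section \<open>The averaged law and excursions\<close>

text \<open>\<open>bernoulli_pmf\<close> truncates its parameter to the unit interval. The explicit
  form yields measurability in the parameter and the symmetry between p and 1 - p for every real
  p.\<close>

lemma pmf_bernoulli_clamp: "pmf (bernoulli_pmf p) b = (if b then min 1 (max 0 p) else 1 - min 1 (max 0 p))"
  by (simp add: bernoulli_pmf.rep_eq)

lemma measurable_cookie: "j \<in> {1..} \<Longrightarrow> (\<lambda>c. c j) \<in> borel_measurable cookie_space"
proof -
  assume "j \<in> {1..}"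
  then have "(\<lambda>c. c j) \<in> measurable cookie_space (restrict_space borel {0..1})"
    unfolding cookie_space_def by (rule measurable_component_singleton)
  from measurable_restrict_space2_iff[THEN iffD1, OF this] show ?thesis by simp
qed

lemma measurable_stack: "(\<lambda>\<omega>. \<omega> i) \<in> measurable env_space cookie_space"
  unfolding env_space_def by (rule measurable_component_singleton) simp

lemma measurable_cookie_bernoulli:
  "j \<in> {1..} \<Longrightarrow> (\<lambda>c. ennreal (pmf (bernoulli_pmf (c j)) b)) \<in> borel_measurable cookie_space"
  using measurable_cookie[of j] unfolding pmf_bernoulli_clamp by measurable

lemma measurable_fail_prob: "(\<lambda>c. fail_prob c v v') \<in> borel_measurable cookie_space"
  unfolding fail_prob_def
  by (intro borel_measurable_sum borel_measurable_prod_ennreal measurable_cookie_bernoulli) auto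

text \<open>Each generation of \<open>V\<close> consumes a fresh stack, so averaging over an i.i.d.
  environment leaves a Markov chain with this kernel.\<close>

definition transition :: "env measure \<Rightarrow> nat \<Rightarrow> nat \<Rightarrow> ennreal" where
  "transition P v v' = (\<integral>\<^sup>+\<omega>. fail_prob (\<omega> 0) v v' \<partial>P)"

primrec path_prob :: "env measure \<Rightarrow> nat \<Rightarrow> nat list \<Rightarrow> ennreal" where
  "path_prob P v [] = 1"
| "path_prob P v (v' # l) = transition P v v' * path_prob P v' l"

lemma path_prob_append: "path_prob P v (l @ l') = path_prob P v l * path_prob P (last (v # l)) l'"
  by (induction l arbitrary: v) (auto simp: mult.assoc)

lemma path_prob_prod: "path_prob P v l = (\<Prod>k<length l. transition P ((v # l) ! k) (l ! k))"
  by (induction l arbitrary: v) (auto simp: prod.lessThan_Suc_shift simp del: prod.lessThan_Suc)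

text \<open>The initial 0 of the trajectory is omitted, so that the length of the list corresponds
  to \<open>sigma1\<close> and its sum to \<open>W1\<close>.\<close>

definition excursions :: "nat list set" where
  "excursions = {l. l \<noteq> [] \<and> last l = 0 \<and> 0 \<notin> set (butlast l)}"

definition tilted :: "env measure \<Rightarrow> real \<Rightarrow> real \<Rightarrow> nat \<Rightarrow> nat list \<Rightarrow> ennreal" where
  "tilted P \<mu> \<eta> v l = path_prob P v l * ennreal (exp (\<mu> * real (sum_list l) + \<eta> * real (length l)))"

definition excursion_sum :: "env measure \<Rightarrow> real \<Rightarrow> real \<Rightarrow> nat \<Rightarrow> ennreal" where
  "excursion_sum P \<mu> \<eta> v = (\<integral>\<^sup>+l. tilted P \<mu> \<eta> v l \<partial>count_space excursions)"

lemma inj_reversed: "inj_on (\<lambda>k. int m - 1 - int k) A"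
  by (auto intro: inj_onI)

lemma finite_bounded_lists: "finite {l. length l = m \<and> sum_list l \<le> (y::nat)}"
proof (rule finite_subset)
  show "{l. length l = m \<and> sum_list l \<le> y} \<subseteq> {l. set l \<subseteq> {..y} \<and> length l = m}"
    using member_le_sum_list by (auto intro: le_trans)
qed (simp add: finite_lists_length_eq)

text \<open>Independence enters as the factorization of integrals of nonnegative functions of
  distinct sites, and (A3) as positivity of such integrals. The mirrored law satisfies the same
  conditions, so that results of the locale serve both signs of x.\<close>

locale cookie_law =
  fixes P :: "env measure" and M :: nat
  assumes prob_space_P: "prob_space P" and sets_P: "sets P = sets env_space"
    and fair: "AE \<omega> in P. \<forall>i. \<forall>j>M. \<omega> i j = 1 / 2"
    and iid: "\<And>(g :: nat \<Rightarrow> int) f n. inj_on g {..<n} \<Longrightarrow>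
      (\<And>k. k < n \<Longrightarrow> f k \<in> borel_measurable cookie_space) \<Longrightarrow>
      (\<integral>\<^sup>+\<omega>. (\<Prod>k<n. f k (\<omega> (g k)) :: ennreal) \<partial>P) = (\<Prod>k<n. \<integral>\<^sup>+\<omega>. f k (\<omega> 0) \<partial>P)"
    and succ_pos: "(\<integral>\<^sup>+\<omega>. (\<Prod>j=1..M. ennreal (\<omega> 0 j)) \<partial>P) > 0"
    and fail_pos: "(\<integral>\<^sup>+\<omega>. (\<Prod>j=1..M. ennreal (1 - \<omega> 0 j)) \<partial>P) > 0"
begin

lemma measurable_P: "f \<in> borel_measurable cookie_space \<Longrightarrow> (\<lambda>\<omega>. f (\<omega> i) :: ennreal) \<in> borel_measurable P"
  unfolding measurable_cong_sets[OF sets_P refl]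
  by (rule measurable_compose[OF measurable_stack])

text \<open>The value does not depend on \<open>g\<close>. The sites that \<open>V\<close> reads
  upwards and the sites that the walk reads downwards from m - 1 give the same probabilities; this
  links the walk to the branching process.\<close>

lemma averaged_chain:
  assumes g: "inj_on g {..<length l}"
  shows "(\<lambda>\<omega>. emeasure (coin_law \<omega>) {\<xi> \<in> space (coin_law \<omega>). chain_event g l \<xi>}) \<in> borel_measurable P"
    and "(\<integral>\<^sup>+\<omega>. emeasure (coin_law \<omega>) {\<xi> \<in> space (coin_law \<omega>). chain_event g l \<xi>} \<partial>P) = path_prob P 0 l"
proof -
  show "(\<lambda>\<omega>. emeasure (coin_law \<omega>) {\<xi> \<in> space (coin_law \<omega>). chain_event g l \<xi>}) \<in> borel_measurable P"
    unfolding chain_event_law(2)[OF g]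
    by (intro borel_measurable_prod_ennreal measurable_P measurable_fail_prob)
  show "(\<integral>\<^sup>+\<omega>. emeasure (coin_law \<omega>) {\<xi> \<in> space (coin_law \<omega>). chain_event g l \<xi>} \<partial>P) = path_prob P 0 l"
    unfolding chain_event_law(2)[OF g] path_prob_prod transition_def
    by (rule iid[OF g measurable_fail_prob])
qed

lemma averaged_prob_walk:
  "averaged_prob P {X. X n \<in> S} = (\<integral>\<^sup>+\<omega>. emeasure (coin_law \<omega>) {\<xi> \<in> space (coin_law \<omega>). walk \<xi> n \<in> S} \<partial>P)"
  unfolding averaged_prob_def quenched_law_eq_walk ..

text \<open>A walk at or above m at time n first hit m at some \<open>t \<le> n\<close>, and
  \<open>m + 2 * sum_list l \<le> t\<close> bounds the area of its list. A union bound over the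
  finitely many such lists follows.\<close>

lemma averaged_prob_le_paths:
  assumes "m > 0"
  shows "averaged_prob P {X. X n \<in> {int m..}} \<le> (\<Sum>l\<in>{l. length l = m \<and> sum_list l \<le> (n - m) div 2}. path_prob P 0 l)"
proof -
  let ?L = "{l. length l = m \<and> sum_list l \<le> (n - m) div 2}"
  let ?g = "\<lambda>k. int m - 1 - int k"
  let ?C = "\<lambda>\<omega> l. {\<xi> \<in> space (coin_law \<omega>). chain_event ?g l \<xi>}"
  have sub: "{\<xi> \<in> space (coin_law \<omega>). walk \<xi> n \<in> {int m..}} \<subseteq> (\<Union>l\<in>?L. ?C \<omega> l)" for \<omega>
  proof
    fix \<xi> assume "\<xi> \<in> {\<xi> \<in> space (coin_law \<omega>). walk \<xi> n \<in> {int m..}}"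
    then have \<xi>: "\<xi> \<in> space (coin_law \<omega>)" "walk \<xi> n \<ge> int m" by auto
    obtain t where t: "t \<le> n" "walk \<xi> t = int m" "\<And>k. k < t \<Longrightarrow> walk \<xi> k < int m"
      using first_hit[OF \<xi>(2) assms] by metis
    let ?l = "map (\<lambda>k. lefts \<xi> t (int m - 1 - int k)) [0..<m]"
    have "chain_event ?g ?l \<xi>" by (rule hit_chain_event(1)[OF t(2,3)])
    moreover have "m + 2 * sum_list ?l \<le> t" by (rule hit_chain_event(2)[OF t(2,3)])
    with t(1) have "?l \<in> ?L" by auto
    ultimately show "\<xi> \<in> (\<Union>l\<in>?L. ?C \<omega> l)" using \<xi>(1) by blast
  qed
  have C: "?C \<omega> l \<in> sets (coin_law \<omega>)" for \<omega> l
    by (rule chain_event_law(1)[OF inj_reversed])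
  have "averaged_prob P {X. X n \<in> {int m..}} \<le> (\<integral>\<^sup>+\<omega>. (\<Sum>l\<in>?L. emeasure (coin_law \<omega>) (?C \<omega> l)) \<partial>P)"
    unfolding averaged_prob_walk
  proof (rule nn_integral_mono)
    fix \<omega>
    have "emeasure (coin_law \<omega>) {\<xi> \<in> space (coin_law \<omega>). walk \<xi> n \<in> {int m..}} \<le> emeasure (coin_law \<omega>) (\<Union>l\<in>?L. ?C \<omega> l)"
      using C by (intro emeasure_mono sub sets.finite_UN finite_bounded_lists)
    also have "\<dots> \<le> (\<Sum>l\<in>?L. emeasure (coin_law \<omega>) (?C \<omega> l))"
      using C by (intro emeasure_subadditive_finite finite_bounded_lists) auto
    finally show "emeasure (coin_law \<omega>) {\<xi> \<in> space (coin_law \<omega>). walk \<xi> n \<in> {int m..}} \<le> \<dots>" .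
  qed
  also have "\<dots> = (\<Sum>l\<in>?L. path_prob P 0 l)"
    using averaged_chain[OF inj_reversed] by (subst nn_integral_sum) auto
  finally show ?thesis .
qed

text \<open>On the chain event of a returning list the walk is at m at time m + 2 w. The condition
  on S allows for every position at time n compatible with that, whether n is earlier or
  later.\<close>

lemma averaged_prob_ge_paths:
  assumes L: "finite L" "\<And>l. l \<in> L \<Longrightarrow> length l = m \<and> last (0 # l) = 0 \<and> sum_list l = w"
    and S: "\<And>y. \<bar>y - int m\<bar> \<le> \<bar>int n - int (m + 2 * w)\<bar> \<Longrightarrow> \<bar>y\<bar> \<le> int n \<Longrightarrow> y \<in> S"
  shows "(\<Sum>l\<in>L. path_prob P 0 l) \<le> averaged_prob P {X. X n \<in> S}"
proof -
  let ?g = "\<lambda>k. int m - 1 - int k"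
  let ?C = "\<lambda>\<omega> l. {\<xi> \<in> space (coin_law \<omega>). chain_event ?g l \<xi>}"
  have C: "?C \<omega> l \<in> sets (coin_law \<omega>)" for \<omega> l
    by (rule chain_event_law(1)[OF inj_reversed])
  have "(\<Sum>l\<in>L. path_prob P 0 l) = (\<integral>\<^sup>+\<omega>. (\<Sum>l\<in>L. emeasure (coin_law \<omega>) (?C \<omega> l)) \<partial>P)"
    using averaged_chain[OF inj_reversed] by (subst nn_integral_sum) auto
  also have "\<dots> \<le> averaged_prob P {X. X n \<in> S}"
    unfolding averaged_prob_walk
  proof (rule nn_integral_mono)
    fix \<omega>
    have disj: "disjoint_family_on (?C \<omega>) L"
      unfolding disjoint_family_on_def using chain_event_unique L(2) by auto
    have "(\<Sum>l\<in>L. emeasure (coin_law \<omega>) (?C \<omega> l)) = emeasure (coin_law \<omega>) (\<Union>l\<in>L. ?C \<omega> l)"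
      by (rule sum_emeasure[OF _ disj L(1)]) (intro image_subsetI C)
    also have "\<dots> \<le> emeasure (coin_law \<omega>) {\<xi> \<in> space (coin_law \<omega>). walk \<xi> n \<in> S}"
    proof (rule emeasure_mono[OF _ walk_measurable])
      show "(\<Union>l\<in>L. ?C \<omega> l) \<subseteq> {\<xi> \<in> space (coin_law \<omega>). walk \<xi> n \<in> S}"
      proof safe
        fix l \<xi> assume l: "l \<in> L" "chain_event ?g l \<xi>"
        have "walk \<xi> (m + 2 * sum_list l) = int m"
          using L(2)[OF l(1)] by (intro chain_event_hit l(2)) auto
        then show "walk \<xi> n \<in> S"
          using walk_lipschitz[of \<xi> n "m + 2 * w"] walk_abs_le[of \<xi> n] L(2)[OF l(1)]
          by (intro S) auto
      qed
    qed
    finally show "(\<Sum>l\<in>L. emeasure (coin_law \<omega>) (?C \<omega> l)) \<le> emeasure (coin_law \<omega>) {\<xi> \<in> space (coin_law \<omega>). walk \<xi> n \<in> S}" .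
  qed
  finally show ?thesis .
qed

end

section \<open>Excursions of the branching process\<close>

lemma succs_unbounded:
  assumes "\<And>N. \<exists>j>N. s j"
  shows "\<exists>l. succs s l > v"
proof (induction v)
  case 0
  obtain j where "j > 0" "s j" using assms[of 0] by blast
  then show ?case by (intro exI[of _ j]) (cases j, auto simp: succs_Suc)
next
  case (Suc v)
  then obtain l where l: "succs s l > v" by blast
  obtain j where j: "j > l" "s j" using assms[of l] by blast
  then obtain k where k: "j = Suc k" by (cases j) auto
  have "succs s l \<le> succs s k" using j k by (intro succs_mono) auto
  with l j k show ?case by (intro exI[of _ j]) (auto simp: succs_Suc)
qed

text \<open>Beyond coin M the coins at i are fair, and k failures in a row have probability
  \<open>(1 / 2) ^ k\<close>.\<close>

lemma AE_coin_law_success: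
  assumes half: "\<forall>j>M. \<omega> i j = 1 / 2"
  shows "AE \<xi> in coin_law \<omega>. \<exists>j>N. \<xi> i j"
proof -
  define K where "K = max N M"
  let ?B = "\<lambda>k. {\<xi> \<in> space (coin_law \<omega>). \<forall>(i,j)\<in>{i} \<times> {K+1..K+k}. \<xi> i j = False}"
  have B: "?B k \<in> sets (coin_law \<omega>)" "emeasure (coin_law \<omega>) (?B k) = ennreal ((1 / 2) ^ k)" for k
  proof -
    have fin: "finite ({i} \<times> {K+1..K+k})" "{i} \<times> {K+1..K+k} \<subseteq> UNIV \<times> {1..}" by auto
    show "?B k \<in> sets (coin_law \<omega>)" by (rule coin_pattern(1)[OF fin])
    have hh: "pmf (bernoulli_pmf (\<omega> i j)) False = 1 / 2" if "Suc K \<le> j" for j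
    proof -
      have "\<omega> i j = 1 / 2" using half that unfolding K_def by (metis Suc_le_lessD max_less_iff_conj)
      then show ?thesis by (simp only: pmf_bernoulli_half)
    qed
    have "emeasure (coin_law \<omega>) (?B k) = (\<Prod>(i,j)\<in>{i} \<times> {K+1..K+k}. ennreal (pmf (bernoulli_pmf (\<omega> i j)) False))"
      by (rule coin_pattern(2)[OF fin])
    also have "\<dots> = (\<Prod>(i,j)\<in>{i} \<times> {K+1..K+k}. ennreal (1 / 2))"
      by (intro prod.cong refl) (auto simp: hh)
    also have "\<dots> = ennreal ((1 / 2) ^ k)"
      using ennreal_power[of "1 / 2" k] by (simp add: card_cartesian_product)
    finally show "emeasure (coin_law \<omega>) (?B k) = ennreal ((1 / 2) ^ k)" .
  qed
  have I: "(\<Inter>k. ?B k) \<in> sets (coin_law \<omega>)" using B(1) by (intro sets.countable_INT) auto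
  have "emeasure (coin_law \<omega>) (\<Inter>k. ?B k) \<le> ennreal ((1 / 2) ^ k)" for k
    using emeasure_mono[OF _ B(1)[of k], of "\<Inter>k. ?B k"] B(2)[of k] by auto
  moreover have "(\<lambda>k. ennreal ((1 / 2) ^ k)) \<longlonglongrightarrow> ennreal 0"
    by (intro tendsto_ennrealI LIMSEQ_power_zero) simp
  ultimately have "emeasure (coin_law \<omega>) (\<Inter>k. ?B k) \<le> ennreal 0"
    by (intro tendsto_lowerbound[of _ _ sequentially]) auto
  then have z: "emeasure (coin_law \<omega>) (\<Inter>k. ?B k) = 0" by simp
  show ?thesis
    by (rule AE_I[OF _ z I]) (auto simp: K_def)
qed

text \<open>With unboundedly many successes in each stack \<open>failures\<close> never takes a junk
  value, so the trajectory of \<open>V\<close> realizes a chain event, and uniqueness gives the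
  converse.\<close>

lemma V_eq_iff_chain_event:
  assumes "\<And>i v. \<exists>l. succs (\<xi> i) l > v"
  shows "chain_event int l \<xi> \<longleftrightarrow> l = map (\<lambda>k. V \<xi> (Suc k)) [0..<length l]"
proof -
  have fb: "fails_before (\<xi> (int k)) (V \<xi> k) (V \<xi> (Suc k))" for k
  proof -
    obtain v' where v': "fails_before (\<xi> (int k)) (V \<xi> k) v'"
      using fails_before_exists assms by blast
    with failures_eq[OF v'] show ?thesis by simp
  qed
  have ev: "chain_event int (map (\<lambda>k. V \<xi> (Suc k)) [0..<n]) \<xi>" for n
    unfolding chain_event_def
  proof (intro allI impI)
    fix k assume "k < length (map (\<lambda>k. V \<xi> (Suc k)) [0..<n])"
    then have k: "k < n" by simp
    have "(0 # map (\<lambda>k. V \<xi> (Suc k)) [0..<n]) ! k = V \<xi> k"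
      using k by (cases k) auto
    with k fb[of k] show "fails_before (\<xi> (int k)) ((0 # map (\<lambda>k. V \<xi> (Suc k)) [0..<n]) ! k) (map (\<lambda>k. V \<xi> (Suc k)) [0..<n] ! k)"
      by simp
  qed
  show ?thesis
    using ev[of "length l"] chain_event_unique[of int l \<xi> "map (\<lambda>k. V \<xi> (Suc k)) [0..<length l]"]
    by auto
qed

lemma V_path_excursion_iff:
  "map (\<lambda>k. V \<xi> (Suc k)) [0..<n] \<in> excursions \<longleftrightarrow> n > 0 \<and> V \<xi> n = 0 \<and> (\<forall>k. 0 < k \<and> k < n \<longrightarrow> V \<xi> k \<noteq> 0)"
proof (cases n)
  case (Suc m)
  have "0 \<notin> (\<lambda>k. V \<xi> (Suc k)) ` {..<m} \<longleftrightarrow> (\<forall>k. 0 < k \<and> k < Suc m \<longrightarrow> V \<xi> k \<noteq> 0)"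
  proof (intro iffI allI impI notI)
    fix k assume *: "0 \<notin> (\<lambda>k. V \<xi> (Suc k)) ` {..<m}" and k: "0 < k \<and> k < Suc m" and V: "V \<xi> k = 0"
    obtain j where j: "k = Suc j" using k by (cases k) auto
    then have "V \<xi> (Suc j) \<in> (\<lambda>k. V \<xi> (Suc k)) ` {..<m}" using k by (intro imageI) simp
    with * V j show False by (simp only:)
  next
    assume *: "\<forall>k. 0 < k \<and> k < Suc m \<longrightarrow> V \<xi> k \<noteq> 0" and im: "0 \<in> (\<lambda>k. V \<xi> (Suc k)) ` {..<m}"
    from im obtain j where j: "0 = V \<xi> (Suc j)" "j \<in> {..<m}" by (rule imageE)
    then have "0 < Suc j \<and> Suc j < Suc m" by simp
    with * j(1) show False by metis
  qed
  then show ?thesis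
    by (simp add: excursions_def Suc atLeast0LessThan del: V.simps)
qed (simp add: excursions_def)

text \<open>Only the actual first excursion of \<open>V\<close> contributes to the sum; if
  \<open>V\<close> never returns to 0, both sides vanish.\<close>

lemma excursion_functional:
  assumes good: "\<And>i v. \<exists>l. succs (\<xi> i) l > v"
  shows "ennreal (exp (\<mu> * real (W1 \<xi>) + \<eta> * real (the_enat (sigma1 \<xi>)))) * indicator {\<xi>. sigma1 \<xi> < \<infinity>} \<xi>
    = (\<integral>\<^sup>+l. ennreal (exp (\<mu> * real (sum_list l) + \<eta> * real (length l))) * of_bool (chain_event int l \<xi>) \<partial>count_space excursions)"
proof -
  let ?V = "\<lambda>n. map (\<lambda>k. V \<xi> (Suc k)) [0..<n]"
  let ?S = "{i. i > 0 \<and> V \<xi> i = 0}"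
  have ce: "chain_event int l \<xi> \<longleftrightarrow> l = ?V (length l)" for l
    by (rule V_eq_iff_chain_event[OF good])
  show ?thesis
  proof (cases "?S = {}")
    case True
    then have "sigma1 \<xi> = \<infinity>" by (auto simp: sigma1_def Inf_enat_def)
    moreover have "\<not> chain_event int l \<xi>" if "l \<in> excursions" for l
      using that ce[of l] V_path_excursion_iff[of \<xi> "length l"] True by auto
    ultimately show ?thesis
      by (auto simp: nn_integral_0_iff_AE AE_count_space)
  next
    case False
    define s where "s = (LEAST i. i > 0 \<and> V \<xi> i = 0)"
    have s: "s > 0" "V \<xi> s = 0" using False LeastI_ex[of "\<lambda>i. i > 0 \<and> V \<xi> i = 0"] by (auto simp: s_def)
    have min: "V \<xi> k \<noteq> 0" if "0 < k" "k < s" for k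
      using not_less_Least[of k "\<lambda>i. i > 0 \<and> V \<xi> i = 0"] that by (auto simp: s_def)
    have sig: "sigma1 \<xi> = enat s"
      unfolding sigma1_def
    proof (rule antisym)
      show "Inf {enat i |i. 0 < i \<and> V \<xi> i = 0} \<le> enat s" using s by (intro Inf_lower) auto
      show "enat s \<le> Inf {enat i |i. 0 < i \<and> V \<xi> i = 0}"
      proof (rule Inf_greatest)
        fix z assume "z \<in> {enat i |i. 0 < i \<and> V \<xi> i = 0}"
        then obtain i where "z = enat i" "0 < i" "V \<xi> i = 0" by blast
        with min[of i] show "enat s \<le> z" by (cases "i < s") auto
      qed
    qed
    have W: "W1 \<xi> = sum_list (?V s)"
      unfolding W1_def sig by (simp add: interv_sum_list_conv_sum_set_nat atLeast0LessThan sum.atLeast1_atMost_eq del: V.simps)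
    have exc: "?V s \<in> excursions" using s min by (subst V_path_excursion_iff) auto
    have uniq: "l = ?V s" if "l \<in> excursions" "chain_event int l \<xi>" for l
    proof -
      have l: "l = ?V (length l)" using ce that by blast
      then have "length l > 0 \<and> V \<xi> (length l) = 0 \<and> (\<forall>k. 0 < k \<and> k < length l \<longrightarrow> V \<xi> k \<noteq> 0)"
        using that(1) V_path_excursion_iff[of \<xi> "length l"] by metis
      then have "length l = s" using s min by (metis linorder_neqE_nat)
      with l show ?thesis by simp
    qed
    have "(\<integral>\<^sup>+l. ennreal (exp (\<mu> * real (sum_list l) + \<eta> * real (length l))) * of_bool (chain_event int l \<xi>) \<partial>count_space excursions)
      = (\<Sum>l\<in>{?V s}. ennreal (exp (\<mu> * real (sum_list l) + \<eta> * real (length l))) * of_bool (chain_event int l \<xi>))"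
      using uniq exc by (intro nn_integral_count_space') auto
    also have "\<dots> = ennreal (exp (\<mu> * real (W1 \<xi>) + \<eta> * real s))"
      using ce[of "?V s"] by (simp add: W del: V.simps)
    finally show ?thesis by (simp add: sig)
  qed
qed

context cookie_law
begin

lemma AE_good: "AE \<omega> in P. AE \<xi> in coin_law \<omega>. \<forall>i v. \<exists>l. succs (\<xi> i) l > v"
  using fair
proof eventually_elim
  case (elim \<omega>)
  then have "AE \<xi> in coin_law \<omega>. \<exists>j>N. \<xi> i j" for i N
    by (intro AE_coin_law_success) auto
  then have "AE \<xi> in coin_law \<omega>. \<forall>i N. \<exists>j>N. \<xi> i j"
    by (simp add: AE_all_countable)
  then show ?case
    by eventually_elim (auto intro: succs_unbounded)
qed

text \<open>Both integrals are exchanged with the countable sum over excursions, and the averaged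
  probability of each excursion is its \<open>path_prob\<close>.\<close>

lemma Lambda_W_sigma_eq: "Lambda_W_sigma P \<mu> \<eta> = elog (excursion_sum P \<mu> \<eta> 0)"
proof -
  let ?e = "\<lambda>l. ennreal (exp (\<mu> * real (sum_list l) + \<eta> * real (length l)))"
  let ?C = "\<lambda>\<omega> l. {\<xi> \<in> space (coin_law \<omega>). chain_event int l \<xi>}"
  have inj: "inj_on int A" for A by (auto intro: inj_onI)
  have C: "?C \<omega> l \<in> sets (coin_law \<omega>)" for \<omega> l by (rule chain_event_law(1)[OF inj])
  have m: "(\<lambda>\<xi>. ?e l * of_bool (chain_event int l \<xi>)) \<in> borel_measurable (coin_law \<omega>)" for \<omega> l
  proof -
    have "(\<lambda>\<xi>. ?e l * indicator (?C \<omega> l) \<xi>) \<in> borel_measurable (coin_law \<omega>)"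
      using C by measurable
    then show ?thesis by (subst measurable_cong[of _ _ "\<lambda>\<xi>. ?e l * indicator (?C \<omega> l) \<xi>"]) (auto simp: indicator_def)
  qed
  have i: "(\<integral>\<^sup>+\<xi>. ?e l * of_bool (chain_event int l \<xi>) \<partial>coin_law \<omega>) = ?e l * emeasure (coin_law \<omega>) (?C \<omega> l)" for \<omega> l
  proof -
    have "(\<integral>\<^sup>+\<xi>. ?e l * of_bool (chain_event int l \<xi>) \<partial>coin_law \<omega>) = (\<integral>\<^sup>+\<xi>. ?e l * indicator (?C \<omega> l) \<xi> \<partial>coin_law \<omega>)"
      by (intro nn_integral_cong) (auto simp: indicator_def)
    then show ?thesis using C by (simp add: nn_integral_cmult_indicator)
  qed
  have "(\<integral>\<^sup>+\<omega>. (\<integral>\<^sup>+\<xi>. ennreal (exp (\<mu> * real (W1 \<xi>) + \<eta> * real (the_enat (sigma1 \<xi>)))) * indicator {\<xi>. sigma1 \<xi> < \<infinity>} \<xi>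
       \<partial>coin_law \<omega>) \<partial>P)
     = (\<integral>\<^sup>+\<omega>. (\<integral>\<^sup>+\<xi>. (\<integral>\<^sup>+l. ?e l * of_bool (chain_event int l \<xi>) \<partial>count_space excursions) \<partial>coin_law \<omega>) \<partial>P)"
  proof (intro nn_integral_cong_AE)
    show "AE \<omega> in P. (\<integral>\<^sup>+\<xi>. ennreal (exp (\<mu> * real (W1 \<xi>) + \<eta> * real (the_enat (sigma1 \<xi>)))) * indicator {\<xi>. sigma1 \<xi> < \<infinity>} \<xi>
       \<partial>coin_law \<omega>) = (\<integral>\<^sup>+\<xi>. (\<integral>\<^sup>+l. ?e l * of_bool (chain_event int l \<xi>) \<partial>count_space excursions) \<partial>coin_law \<omega>)"
      using AE_good
    proof eventually_elim
      case (elim \<omega>)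
      show ?case
        by (intro nn_integral_cong_AE, use elim in eventually_elim) (rule excursion_functional, blast)
    qed
  qed
  also have "\<dots> = (\<integral>\<^sup>+\<omega>. (\<integral>\<^sup>+l. ?e l * emeasure (coin_law \<omega>) (?C \<omega> l) \<partial>count_space excursions) \<partial>P)"
    by (simp add: nn_integral_count_space_nn_integral[OF countableI_type m] i)
  also have "\<dots> = (\<integral>\<^sup>+l. (\<integral>\<^sup>+\<omega>. ?e l * emeasure (coin_law \<omega>) (?C \<omega> l) \<partial>P) \<partial>count_space excursions)"
    using averaged_chain(1)[OF inj] by (intro nn_integral_count_space_nn_integral countableI_type borel_measurable_times_ennreal) auto
  also have "\<dots> = excursion_sum P \<mu> \<eta> 0"
    unfolding excursion_sum_def tilted_def
    by (intro nn_integral_cong) (simp add: nn_integral_cmult averaged_chain[OF inj] mult.commute)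
  finally show ?thesis by (simp add: Lambda_W_sigma_def)
qed

end

section \<open>Upper bound\<close>

lemma fail_prob_ge_pattern:
  assumes "S \<subseteq> {1..v + v'}" "card S = v"
  shows "(\<Prod>j\<in>{1..Suc (v + v')}. ennreal (pmf (bernoulli_pmf (c j)) (j \<in> insert (Suc (v + v')) S))) \<le> fail_prob c v v'"
proof -
  have "finite {S. S \<subseteq> {1..v + v'} \<and> card S = v}" by (rule finite_subset[of _ "Pow {1..v + v'}"]) auto
  then show ?thesis
    unfolding fail_prob_def
    using member_le_sum[of S _ "\<lambda>S. \<Prod>j\<in>{1..Suc (v + v')}. ennreal (pmf (bernoulli_pmf (c j)) (j \<in> insert (Suc (v + v')) S))"] assms
    by auto
qed

lemma fair_tail_prod_ge:
  fixes a d :: "nat \<Rightarrow> real"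
  assumes d: "\<And>j. j \<ge> 1 \<Longrightarrow> 0 \<le> d j \<and> d j \<le> 1"
    and a: "\<And>j. 1 \<le> j \<Longrightarrow> j \<le> N \<Longrightarrow> a j = (if j \<le> M then d j else 1 / 2)"
  shows "(\<Prod>j=1..M. d j) * (1 / 2) ^ N \<le> (\<Prod>j=1..N. a j)"
proof -
  define e where "e j = (if j \<le> M then d j else 1)" for j
  have e: "0 \<le> e j" "e j \<le> 1" if "j \<ge> 1" for j using d[OF that] by (auto simp: e_def)
  have "(\<Prod>j=1..M. d j) = (\<Prod>j=1..M. e j)" by (intro prod.cong) (auto simp: e_def)
  also have "\<dots> = (\<Prod>j=1..max M N. e j)" by (intro prod.mono_neutral_left) (auto simp: e_def)
  also have "\<dots> \<le> (\<Prod>j=1..N. e j)"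
  proof -
    have "(\<Prod>j=1..max M N. e j) = (\<Prod>j\<in>{1..max M N} - {1..N}. e j) * (\<Prod>j=1..N. e j)"
      by (intro prod.subset_diff) auto
    also have "\<dots> \<le> 1 * (\<Prod>j=1..N. e j)"
      using e by (intro mult_right_mono prod_le_1 prod_nonneg) auto
    finally show ?thesis by simp
  qed
  finally have "(\<Prod>j=1..M. d j) * (1 / 2) ^ N \<le> (\<Prod>j=1..N. e j) * (1 / 2) ^ N"
    by (intro mult_right_mono) auto
  also have "\<dots> = (\<Prod>j=1..N. e j * (1 / 2))" by (simp only: prod.distrib prod_constant card_atLeastAtMost diff_Suc_1)
  also have "\<dots> \<le> (\<Prod>j=1..N. a j)"
  proof (intro prod_mono conjI)
    fix j assume "j \<in> {1..N}"
    then have j: "1 \<le> j" "j \<le> N" by auto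
    from e[OF j(1)] show "0 \<le> e j * (1 / 2)" by simp
    from d[OF j(1)] a[OF j] show "e j * (1 / 2) \<le> a j" by (auto simp: e_def)
  qed
  finally show ?thesis .
qed

lemma pattern_prob_ge:
  assumes c: "\<And>j. j \<ge> 1 \<Longrightarrow> 0 \<le> c j \<and> c j \<le> 1" "\<And>j. j > M \<Longrightarrow> c j = 1 / 2"
  assumes d: "\<And>j. d j = (if s then c j else 1 - c j)"
    and b: "\<And>j. 1 \<le> j \<Longrightarrow> j \<le> M \<Longrightarrow> j \<le> N \<Longrightarrow> b j = s"
  shows "(\<Prod>j=1..M. ennreal (d j)) * ennreal ((1 / 2) ^ N) \<le> (\<Prod>j\<in>{1..N}. ennreal (pmf (bernoulli_pmf (c j)) (b j)))"
proof -
  have d01: "0 \<le> d j \<and> d j \<le> 1" if "j \<ge> 1" for j using c(1)[OF that] d by auto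
  have "(\<Prod>j=1..M. d j) * (1 / 2) ^ N \<le> (\<Prod>j=1..N. pmf (bernoulli_pmf (c j)) (b j))"
  proof (rule fair_tail_prod_ge[OF d01])
    fix j assume j: "1 \<le> j" "j \<le> N"
    show "pmf (bernoulli_pmf (c j)) (b j) = (if j \<le> M then d j else 1 / 2)"
    proof (cases "j \<le> M")
      case True
      then show ?thesis using b[of j] j c(1)[OF j(1)] d[of j] by (cases s) auto
    next
      case False
      then have "c j = 1 / 2" using c(2) by simp
      then show ?thesis using False by (simp only: pmf_bernoulli_half if_False)
    qed
  qed auto
  then have "ennreal ((\<Prod>j=1..M. d j) * (1 / 2) ^ N) \<le> ennreal (\<Prod>j=1..N. pmf (bernoulli_pmf (c j)) (b j))"
    by (rule ennreal_leI)
  moreover have "ennreal ((\<Prod>j=1..M. d j) * (1 / 2) ^ N) = (\<Prod>j=1..M. ennreal (d j)) * ennreal ((1 / 2) ^ N)"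
  proof -
    have "(\<Prod>j=1..M. ennreal (d j)) = ennreal (\<Prod>j=1..M. d j)"
      using d01 by (intro prod_ennreal) auto
    moreover have "0 \<le> (\<Prod>j=1..M. d j)" using d01 by (intro prod_nonneg) auto
    ultimately show ?thesis by (simp only: ennreal_mult zero_le_power zero_le_divide_1_iff zero_le_numeral)
  qed
  moreover have "ennreal (\<Prod>j=1..N. pmf (bernoulli_pmf (c j)) (b j)) = (\<Prod>j\<in>{1..N}. ennreal (pmf (bernoulli_pmf (c j)) (b j)))"
    by (simp add: prod_ennreal)
  ultimately show ?thesis by simp
qed

text \<open>Lowering both arguments of the binomial coefficient by one divides it by a ratio that is
  at most 3 while \<open>2 * M \<le> h\<close>; this is done M times.\<close>

lemma central_binomial_shift_ge:
  assumes "2 * M \<le> h"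
  shows "real ((2 * h) choose h) \<le> 3 ^ M * real ((2 * h - M) choose (h - M))"
  using assms
proof (induction M)
  case (Suc M)
  define k n where "k = h - Suc M" and "n = 2 * h - Suc M"
  have kn: "h - M = Suc k" "2 * h - M = Suc n" using Suc.prems by (auto simp: k_def n_def)
  have le: "real (Suc n) \<le> 3 * real (Suc k)" using Suc.prems by (simp add: k_def n_def)
  have "real (Suc k) * real (Suc n choose Suc k) = real (Suc n) * real (n choose k)"
    using Suc_times_binomial_eq[of n k] by (metis mult.commute of_nat_mult)
  also have "\<dots> \<le> 3 * real (Suc k) * real (n choose k)"
    using le by (intro mult_right_mono) auto
  finally have "real (Suc k) * real (Suc n choose Suc k) \<le> real (Suc k) * (3 * real (n choose k))"
    by (simp only: ac_simps)
  then have *: "real (Suc n choose Suc k) \<le> 3 * real (n choose k)"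
    by (subst (asm) mult_le_cancel_left_pos) simp_all
  have "real ((2 * h) choose h) \<le> 3 ^ M * real (Suc n choose Suc k)"
    using Suc.IH Suc.prems unfolding kn by simp
  also have "\<dots> \<le> 3 ^ M * (3 * real (n choose k))"
    using * by (intro mult_left_mono) auto
  finally show ?case by (simp add: k_def n_def)
qed simp

text \<open>To stay at height h the stack must show h failures before success number h + 1. The
  first M coins are forced to succeed, and the other h - M successes are placed freely among fair
  coins. The number of placements is at least of order 4^h / h, and each has weight of order 4^(-h),
  so that only a factor of order h is lost.\<close>

lemma fail_prob_stay_ge:
  assumes c: "\<And>j. j \<ge> 1 \<Longrightarrow> 0 \<le> c j \<and> c j \<le> 1" "\<And>j. j > M \<Longrightarrow> c j = 1 / 2"
    and h: "2 * M \<le> h" "h > 0"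
  shows "(\<Prod>j=1..M. ennreal (c j)) * ennreal (1 / (3 ^ M * (4 * real h))) \<le> fail_prob c h h"
proof -
  let ?N = "Suc (h + h)"
  let ?q = "\<Prod>j=1..M. ennreal (c j)"
  let ?T = "{S. S \<subseteq> {Suc M..h + h} \<and> card S = h - M}"
  let ?I = "{S. S \<subseteq> {1..h + h} \<and> card S = h}"
  let ?f = "\<lambda>S. \<Prod>j\<in>{1..?N}. ennreal (pmf (bernoulli_pmf (c j)) (j \<in> insert ?N S))"
  have finI: "finite ?I" by (rule finite_subset[of _ "Pow {1..h + h}"]) auto
  have finT: "finite ?T" by (rule finite_subset[of _ "Pow {Suc M..h + h}"]) auto
  have sub: "(\<lambda>S. {1..M} \<union> S) ` ?T \<subseteq> ?I"
  proof safe
    fix S assume S: "S \<subseteq> {Suc M..h + h}" "card S = h - M"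
    have "card ({1..M} \<union> S) = card {1..M} + card S"
      using S by (intro card_Un_disjoint) (auto intro: finite_subset)
    then show "card ({1..M} \<union> S) = h" using S h by simp
  qed (use h in auto)
  have inj: "inj_on (\<lambda>S. {1..M} \<union> S) ?T"
  proof (rule inj_onI)
    fix S S' assume S: "S \<in> ?T" "S' \<in> ?T" and eq: "{1..M} \<union> S = {1..M} \<union> S'"
    have "S = ({1..M} \<union> S) - {1..M}" "S' = ({1..M} \<union> S') - {1..M}" using S by auto
    with eq show "S = S'" by (simp only:)
  qed
  have cardT: "card ?T = (2 * h - M) choose (h - M)"
  proof -
    have "card ?T = card {Suc M..h + h} choose (h - M)" by (rule n_subsets) simp
    also have "card {Suc M..h + h} = 2 * h - M" using h by simp
    finally show ?thesis .
  qed
  \<comment> \<open>\<open>3 ^ M\<close> comes from the shift of the binomial coefficient;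
    \<open>4 * real h\<close> combines the bound \<open>4 ^ h / (2 * real h)\<close> for the central
    one with the factor 1/2 of the final success.\<close>
  have "real (card ?T) * (1 / 2) ^ ?N \<ge> 1 / (3 ^ M * (4 * real h))"
  proof -
    have "4 ^ h / (2 * real h) \<le> 3 ^ M * real (card ?T)"
      unfolding cardT using central_binomial_lower_bound[OF h(2)] central_binomial_shift_ge[OF h(1)] by linarith
    moreover have "(1 / 2) ^ ?N = 1 / (2 * 4 ^ h :: real)"
      by (simp add: power_add power_one_over flip: power_mult_distrib)
    ultimately show ?thesis using h by (simp add: field_simps)
  qed
  then have "ennreal (1 / (3 ^ M * (4 * real h))) \<le> ennreal (real (card ?T) * (1 / 2) ^ ?N)"
    by (rule ennreal_leI)
  also have "\<dots> = of_nat (card ?T) * ennreal ((1 / 2) ^ ?N)"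
    by (subst ennreal_mult) (auto simp: ennreal_of_nat_eq_real_of_nat simp del: power_Suc)
  finally have "?q * ennreal (1 / (3 ^ M * (4 * real h))) \<le> ?q * (of_nat (card ?T) * ennreal ((1 / 2) ^ ?N))"
    by (intro mult_left_mono) auto
  also have "\<dots> = (\<Sum>S\<in>?T. ?q * ennreal ((1 / 2) ^ ?N))"
    by (simp add: ac_simps del: power_Suc)
  also have "\<dots> \<le> (\<Sum>S\<in>?T. ?f ({1..M} \<union> S))"
    by (intro sum_mono pattern_prob_ge[where s = True and c = c] c) auto
  also have "\<dots> = (\<Sum>S\<in>(\<lambda>S. {1..M} \<union> S) ` ?T. ?f S)"
    by (subst sum.reindex[OF inj]) (simp only: comp_def)
  also have "\<dots> \<le> (\<Sum>S\<in>?I. ?f S)"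
    by (intro sum_mono2 finI sub) auto
  finally show ?thesis unfolding fail_prob_def .
qed

lemma sum_fail_prob_le_1: "(\<Sum>v'\<le>y. fail_prob c v v') \<le> 1"
proof -
  interpret prob_space "stack_law c" by (rule prob_space_stack_law)
  have disj: "disjoint_family_on (\<lambda>v'. {s \<in> space (stack_law c). fails_before s v v'}) {..y}"
    unfolding disjoint_family_on_def using fails_before_unique by blast
  have "(\<Sum>v'\<le>y. fail_prob c v v') = (\<Sum>v'\<le>y. emeasure (stack_law c) {s \<in> space (stack_law c). fails_before s v v'})"
    by (simp add: fails_before_law)
  also have "\<dots> = emeasure (stack_law c) (\<Union>v'\<le>y. {s \<in> space (stack_law c). fails_before s v v'})"
    by (rule sum_emeasure[OF _ disj]) (auto simp: fails_before_law)
  also have "\<dots> \<le> 1" by (rule emeasure_le_1)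
  finally show ?thesis .
qed

lemma space_env_01: "\<omega> \<in> space env_space \<Longrightarrow> j \<ge> 1 \<Longrightarrow> 0 \<le> \<omega> i j \<and> \<omega> i j \<le> 1"
  by (auto simp: env_space_def cookie_space_def space_PiM space_restrict_space PiE_iff)

lemma ennreal_pos_lower: "(0::ennreal) < x \<Longrightarrow> \<exists>r>0. ennreal r \<le> x"
  by (cases x) (auto intro: exI[of _ 1])

context cookie_law
begin

lemma AE_fair_unit: "AE \<omega> in P. (\<forall>j\<ge>1. 0 \<le> \<omega> 0 j \<and> \<omega> 0 j \<le> 1) \<and> (\<forall>j>M. \<omega> 0 j = 1 / 2)"
  using fair AE_space
proof eventually_elim
  case (elim \<omega>)
  then have "\<omega> \<in> space env_space" using sets_eq_imp_space_eq[OF sets_P] by simp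
  with elim(1) show ?case using space_env_01 by blast
qed

text \<open>Averages a quenched bound that isolates the product over the biased cookies. For
  \<open>f\<close> the identity or \<open>1 - x\<close> this is one of the two products in (A3), and
  \<open>r\<close> is a real lower bound for its expectation.\<close>

lemma transition_ge:
  assumes "\<And>\<omega>. (\<And>j. j \<ge> 1 \<Longrightarrow> 0 \<le> \<omega> 0 j \<and> \<omega> 0 j \<le> 1) \<Longrightarrow> (\<And>j. j > M \<Longrightarrow> \<omega> 0 j = 1 / 2) \<Longrightarrow>
    (\<Prod>j=1..M. ennreal (f (\<omega> 0 j))) * ennreal b \<le> fail_prob (\<omega> 0) v v'"
    and [measurable]: "f \<in> borel_measurable borel" and r: "ennreal r \<le> (\<integral>\<^sup>+\<omega>. (\<Prod>j=1..M. ennreal (f (\<omega> 0 j))) \<partial>P)" "r \<ge> 0" "b \<ge> 0"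
  shows "ennreal (r * b) \<le> transition P v v'"
proof -
  have [measurable]: "(\<lambda>\<omega>. \<Prod>j=1..M. ennreal (f (\<omega> 0 j))) \<in> borel_measurable P"
  proof (rule measurable_P, intro borel_measurable_prod_ennreal)
    fix j assume "j \<in> {1..M}"
    then have [measurable]: "(\<lambda>c. c j) \<in> borel_measurable cookie_space" by (intro measurable_cookie) auto
    show "(\<lambda>c. ennreal (f (c j))) \<in> borel_measurable cookie_space" by measurable
  qed
  have "ennreal (r * b) = ennreal r * ennreal b" using r by (simp add: ennreal_mult)
  also have "\<dots> \<le> (\<integral>\<^sup>+\<omega>. (\<Prod>j=1..M. ennreal (f (\<omega> 0 j))) \<partial>P) * ennreal b"
    using r(1) by (intro mult_right_mono) auto
  also have "\<dots> = (\<integral>\<^sup>+\<omega>. (\<Prod>j=1..M. ennreal (f (\<omega> 0 j))) * ennreal b \<partial>P)"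
    by (rule nn_integral_multc[symmetric]) measurable
  also have "\<dots> \<le> transition P v v'"
    unfolding transition_def using AE_fair_unit
    by (intro nn_integral_mono_AE, eventually_elim) (rule assms(1), auto)
  finally show ?thesis .
qed

text \<open>The moves from which all explicit trajectories are built: a drop to 0, a jump from 0,
  and a stay. The jump requires \<open>h \<ge> M\<close> because all M biased cookies are made to
  fail.\<close>

lemma transition_bounds:
  obtains r where "r > 0" "\<And>v. ennreal (r * (1 / 2) ^ Suc v) \<le> transition P v 0"
    "\<And>h. h \<ge> M \<Longrightarrow> ennreal (r * (1 / 2) ^ Suc h) \<le> transition P 0 h"
    "\<And>h. h \<ge> 2 * M \<Longrightarrow> h > 0 \<Longrightarrow> ennreal (r * (1 / (3 ^ M * (4 * real h)))) \<le> transition P h h"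
proof -
  obtain r1 where r1: "r1 > 0" "ennreal r1 \<le> (\<integral>\<^sup>+\<omega>. (\<Prod>j=1..M. ennreal (\<omega> 0 j)) \<partial>P)"
    using ennreal_pos_lower[OF succ_pos] by blast
  obtain r0 where r0: "r0 > 0" "ennreal r0 \<le> (\<integral>\<^sup>+\<omega>. (\<Prod>j=1..M. ennreal (1 - \<omega> 0 j)) \<partial>P)"
    using ennreal_pos_lower[OF fail_pos] by blast
  define r where "r = min r0 r1"
  have "r \<le> r0" "r \<le> r1" by (auto simp: r_def)
  then have "ennreal r \<le> ennreal r0" "ennreal r \<le> ennreal r1" by (auto intro: ennreal_leI)
  then have r: "r > 0" "ennreal r \<le> (\<integral>\<^sup>+\<omega>. (\<Prod>j=1..M. ennreal (\<omega> 0 j)) \<partial>P)"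
    "ennreal r \<le> (\<integral>\<^sup>+\<omega>. (\<Prod>j=1..M. ennreal (1 - \<omega> 0 j)) \<partial>P)"
    using r0 r1 unfolding r_def by (simp, metis order_trans, metis order_trans)
  show ?thesis
  proof (rule that[OF r(1)])
    fix v
    show "ennreal (r * (1 / 2) ^ Suc v) \<le> transition P v 0"
    proof (rule transition_ge[where f = "\<lambda>x. x"])
      fix \<omega> :: env assume w: "\<And>j. j \<ge> 1 \<Longrightarrow> 0 \<le> \<omega> 0 j \<and> \<omega> 0 j \<le> 1" "\<And>j. j > M \<Longrightarrow> \<omega> 0 j = 1 / 2"
      have "(\<Prod>j=1..M. ennreal (\<omega> 0 j)) * ennreal ((1 / 2) ^ Suc (v + 0))
        \<le> (\<Prod>j\<in>{1..Suc (v + 0)}. ennreal (pmf (bernoulli_pmf (\<omega> 0 j)) (j \<in> insert (Suc (v + 0)) {1..v})))"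
        by (rule pattern_prob_ge[where s = True and c = "\<omega> 0"]) (use w in auto)
      also have "\<dots> \<le> fail_prob (\<omega> 0) v 0" by (rule fail_prob_ge_pattern) auto
      finally show "(\<Prod>j=1..M. ennreal (\<omega> 0 j)) * ennreal ((1 / 2) ^ Suc v) \<le> fail_prob (\<omega> 0) v 0" by simp
    qed (use r in auto)
  next
    fix h assume h: "h \<ge> M"
    show "ennreal (r * (1 / 2) ^ Suc h) \<le> transition P 0 h"
    proof (rule transition_ge[where f = "\<lambda>x. 1 - x"])
      fix \<omega> :: env assume w: "\<And>j. j \<ge> 1 \<Longrightarrow> 0 \<le> \<omega> 0 j \<and> \<omega> 0 j \<le> 1" "\<And>j. j > M \<Longrightarrow> \<omega> 0 j = 1 / 2"
      have "(\<Prod>j=1..M. ennreal (1 - \<omega> 0 j)) * ennreal ((1 / 2) ^ Suc (0 + h))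
        \<le> (\<Prod>j\<in>{1..Suc (0 + h)}. ennreal (pmf (bernoulli_pmf (\<omega> 0 j)) (j \<in> insert (Suc (0 + h)) {})))"
        by (rule pattern_prob_ge[where s = False and c = "\<omega> 0"]) (use w h in auto)
      also have "\<dots> \<le> fail_prob (\<omega> 0) 0 h" by (rule fail_prob_ge_pattern) auto
      finally show "(\<Prod>j=1..M. ennreal (1 - \<omega> 0 j)) * ennreal ((1 / 2) ^ Suc h) \<le> fail_prob (\<omega> 0) 0 h" by simp
    qed (use r in auto)
  next
    fix h assume h: "h \<ge> 2 * M" "h > 0"
    show "ennreal (r * (1 / (3 ^ M * (4 * real h)))) \<le> transition P h h"
    proof (rule transition_ge[where f = "\<lambda>x. x"])
      fix \<omega> :: env assume w: "\<And>j. j \<ge> 1 \<Longrightarrow> 0 \<le> \<omega> 0 j \<and> \<omega> 0 j \<le> 1" "\<And>j. j > M \<Longrightarrow> \<omega> 0 j = 1 / 2"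
      show "(\<Prod>j=1..M. ennreal (\<omega> 0 j)) * ennreal (1 / (3 ^ M * (4 * real h))) \<le> fail_prob (\<omega> 0) h h"
        by (rule fail_prob_stay_ge[OF w h])
    qed (use r in auto)
  qed
qed

lemma sum_transition_le_1: "(\<Sum>v'\<le>y. transition P v v') \<le> 1"
proof -
  have "(\<Sum>v'\<le>y. transition P v v') = (\<integral>\<^sup>+\<omega>. (\<Sum>v'\<le>y. fail_prob (\<omega> 0) v v') \<partial>P)"
    unfolding transition_def by (intro nn_integral_sum[symmetric] measurable_P measurable_fail_prob)
  also have "\<dots> \<le> (\<integral>\<^sup>+\<omega>. 1 \<partial>P)"
    by (intro nn_integral_mono sum_fail_prob_le_1)
  also have "\<dots> = 1" using prob_space.emeasure_space_1[OF prob_space_P] by simp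
  finally show ?thesis .
qed

text \<open>A step that stays at height \<open>h\<close> has a probability of order at least \<open>1 / h\<close>, whereas the tilt
  gains the factor \<open>exp (\<mu> h)\<close>: long excursions at a large height make the sum diverge.\<close>

lemma excursion_sum_gt_1:
  assumes "\<mu> > 0"
  shows "excursion_sum P \<mu> \<eta> 0 > 1"
proof -
  obtain r where r: "r > 0" "\<And>v. ennreal (r * (1 / 2) ^ Suc v) \<le> transition P v 0"
    "\<And>h. h \<ge> M \<Longrightarrow> ennreal (r * (1 / 2) ^ Suc h) \<le> transition P 0 h"
    "\<And>h. h \<ge> 2 * M \<Longrightarrow> h > 0 \<Longrightarrow> ennreal (r * (1 / (3 ^ M * (4 * real h)))) \<le> transition P h h"
    using transition_bounds by blast
  define k where "k = r / (3 ^ M * 4)"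
  have k: "k > 0" using r(1) by (simp add: k_def)
  have "filterlim (\<lambda>h. k / real h * exp (\<mu> * real h + \<eta>)) at_top at_top"
    using k assms by real_asymp
  then have "eventually (\<lambda>h. k / real h * exp (\<mu> * real h + \<eta>) > 1 \<and> h \<ge> 2 * M \<and> h > 0) at_top"
    by (intro eventually_conj eventually_ge_at_top eventually_gt_at_top) (auto simp: filterlim_at_top_dense)
  then obtain h where h: "k / real h * exp (\<mu> * real h + \<eta>) > 1" "h \<ge> 2 * M" "h > 0"
    by (auto dest: eventually_happens)
  \<comment> \<open>\<rho> is the tilted lower bound for one more stay at h and exceeds 1; a
    collects the initial jump and the final drop together with the tilt of the entries h and
    0.\<close>
  define \<rho> where "\<rho> = k / real h * exp (\<mu> * real h + \<eta>)"
  define a where "a = (r * (1 / 2) ^ Suc h) ^ 2 * exp (\<mu> * real h + 2 * \<eta>)"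
  have a: "a > 0" using r(1) by (simp add: a_def)
  have stay: "ennreal (k / real h) \<le> transition P h h"
    using r(4)[OF h(2,3)] by (simp add: k_def mult.assoc)
  have rep: "ennreal ((k / real h) ^ n * (r * (1 / 2) ^ Suc h)) \<le> path_prob P h (replicate n h @ [0])" for n
  proof (induction n)
    case 0
    then show ?case using r(2)[of h] by simp
  next
    case (Suc n)
    have "ennreal ((k / real h) ^ Suc n * (r * (1 / 2) ^ Suc h)) = ennreal (k / real h) * ennreal ((k / real h) ^ n * (r * (1 / 2) ^ Suc h))"
      using k r(1) by (subst ennreal_mult[symmetric]) (auto simp: mult.assoc)
    also have "\<dots> \<le> transition P h h * path_prob P h (replicate n h @ [0])"
      by (intro mult_mono stay Suc) auto
    finally show ?case by simp
  qed
  have low: "ennreal (a * \<rho> ^ n) \<le> excursion_sum P \<mu> \<eta> 0" for n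
  proof -
    let ?l = "h # replicate n h @ [0]"
    have "?l \<in> excursions" using h by (auto simp: excursions_def butlast_append)
    have "a * \<rho> ^ n = (r * (1 / 2) ^ Suc h) * ((k / real h) ^ n * (r * (1 / 2) ^ Suc h)) * (exp (\<mu> * real h + 2 * \<eta>) * exp (\<mu> * real h + \<eta>) ^ n)"
      unfolding a_def \<rho>_def by (simp only: power_mult_distrib power2_eq_square mult.assoc mult.commute mult.left_commute)
    also have "exp (\<mu> * real h + 2 * \<eta>) * exp (\<mu> * real h + \<eta>) ^ n = exp (\<mu> * real (sum_list ?l) + \<eta> * real (length ?l))"
      by (simp add: exp_add[symmetric] exp_of_nat_mult[symmetric] sum_list_replicate algebra_simps)
    finally have "ennreal (a * \<rho> ^ n) = ennreal (r * (1 / 2) ^ Suc h) * ennreal ((k / real h) ^ n * (r * (1 / 2) ^ Suc h))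
        * ennreal (exp (\<mu> * real (sum_list ?l) + \<eta> * real (length ?l)))"
      using k r(1) by (simp only: ennreal_mult mult_nonneg_nonneg zero_le_power exp_ge_zero less_imp_le divide_nonneg_nonneg of_nat_0_le_iff zero_le_divide_1_iff zero_le_numeral)
    also have "\<dots> \<le> transition P 0 h * path_prob P h (replicate n h @ [0]) * ennreal (exp (\<mu> * real (sum_list ?l) + \<eta> * real (length ?l)))"
      using r(3)[of h] h by (intro mult_mono rep) auto
    also have "\<dots> = tilted P \<mu> \<eta> 0 ?l" by (simp add: tilted_def)
    also have "\<dots> \<le> excursion_sum P \<mu> \<eta> 0"
      unfolding excursion_sum_def by (rule nn_integral_ge_point) fact
    finally show ?thesis .
  qed
  have "\<rho> > 1" using h by (simp add: \<rho>_def)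
  then obtain n where "\<rho> ^ n > 1 / a" using real_arch_pow by blast
  then have "a * \<rho> ^ n > 1" using a by (simp add: field_simps)
  then have "1 < ennreal (a * \<rho> ^ n)" by simp
  from less_le_trans[OF this low] show ?thesis .
qed

section \<open>Superharmonic functions and the Chernoff estimate\<close>

definition hitting_sum :: "real \<Rightarrow> real \<Rightarrow> nat \<Rightarrow> ennreal" where
  "hitting_sum \<mu> \<eta> v = (if v = 0 then 1 else excursion_sum P \<mu> \<eta> v)"

text \<open>An excursion is split at its first entry v': either it is \<open>[0]\<close>, or v' is
  positive and the rest again ends at its first 0. Entries above y are discarded, which gives an
  inequality with a finite sum.\<close>

lemma excursion_sum_first_step:
  "(\<Sum>v'\<le>y. transition P v v' * ennreal (exp (\<mu> * real v' + \<eta>)) * hitting_sum \<mu> \<eta> v') \<le> excursion_sum P \<mu> \<eta> v"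
proof -
  define A where "A v' = (if v' = 0 then {[0]} else Cons v' ` excursions)" for v' :: nat
  have sub: "A v' \<subseteq> excursions" for v'
    by (auto simp: A_def excursions_def)
  have disj: "v' = v''" if "l \<in> A v'" "l \<in> A v''" for v' v'' l
    using that by (auto simp: A_def split: if_splits)
  have eq: "transition P v v' * ennreal (exp (\<mu> * real v' + \<eta>)) * hitting_sum \<mu> \<eta> v' = (\<integral>\<^sup>+l. tilted P \<mu> \<eta> v l * indicator (A v') l \<partial>count_space UNIV)" for v'
  proof (cases "v' = 0")
    case True
    have "(\<integral>\<^sup>+l. tilted P \<mu> \<eta> v l * indicator (A v') l \<partial>count_space UNIV) = tilted P \<mu> \<eta> v [0]"
      using True by (subst nn_integral_count_space'[of "{[0]}"]) (auto simp: A_def)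
    then show ?thesis using True by (simp add: hitting_sum_def tilted_def)
  next
    case False
    have bij: "bij_betw (Cons v') excursions (A v')"
      using False by (auto simp: bij_betw_def A_def)
    have "(\<integral>\<^sup>+l. tilted P \<mu> \<eta> v l * indicator (A v') l \<partial>count_space UNIV) = (\<integral>\<^sup>+l. tilted P \<mu> \<eta> v l \<partial>count_space (A v'))"
      by (simp add: nn_integral_count_space_indicator)
    also have "\<dots> = (\<integral>\<^sup>+l. tilted P \<mu> \<eta> v (v' # l) \<partial>count_space excursions)"
      by (rule nn_integral_bij_count_space[OF bij, symmetric])
    also have "\<dots> = (\<integral>\<^sup>+l. (transition P v v' * ennreal (exp (\<mu> * real v' + \<eta>))) * tilted P \<mu> \<eta> v' l \<partial>count_space excursions)"
    proof (intro nn_integral_cong)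
      fix l
      have "exp (\<mu> * real (sum_list (v' # l)) + \<eta> * real (length (v' # l))) = exp (\<mu> * real v' + \<eta>) * exp (\<mu> * real (sum_list l) + \<eta> * real (length l))"
        by (simp add: algebra_simps flip: exp_add)
      then have "ennreal (exp (\<mu> * real (sum_list (v' # l)) + \<eta> * real (length (v' # l)))) = ennreal (exp (\<mu> * real v' + \<eta>)) * ennreal (exp (\<mu> * real (sum_list l) + \<eta> * real (length l)))"
        by (simp only: ennreal_mult exp_ge_zero)
      then show "tilted P \<mu> \<eta> v (v' # l) = (transition P v v' * ennreal (exp (\<mu> * real v' + \<eta>))) * tilted P \<mu> \<eta> v' l"
        unfolding tilted_def path_prob.simps by (simp only: mult.assoc mult.commute mult.left_commute)
    qed
    also have "\<dots> = transition P v v' * ennreal (exp (\<mu> * real v' + \<eta>)) * hitting_sum \<mu> \<eta> v'"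
      using False by (simp add: nn_integral_cmult hitting_sum_def excursion_sum_def)
    finally show ?thesis by simp
  qed
  have "(\<Sum>v'\<le>y. transition P v v' * ennreal (exp (\<mu> * real v' + \<eta>)) * hitting_sum \<mu> \<eta> v')
      = (\<integral>\<^sup>+l. (\<Sum>v'\<le>y. tilted P \<mu> \<eta> v l * indicator (A v') l) \<partial>count_space UNIV)"
    unfolding eq by (rule nn_integral_sum[symmetric]) auto
  also have "\<dots> \<le> (\<integral>\<^sup>+l. tilted P \<mu> \<eta> v l * indicator excursions l \<partial>count_space UNIV)"
  proof (rule nn_integral_mono)
    fix l
    show "(\<Sum>v'\<le>y. tilted P \<mu> \<eta> v l * indicator (A v') l) \<le> tilted P \<mu> \<eta> v l * indicator excursions l"
    proof (cases "\<exists>u. l \<in> A u")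
      case True
      then obtain u where u: "l \<in> A u" by blast
      have "(\<Sum>v'\<le>y. tilted P \<mu> \<eta> v l * indicator (A v') l) = (\<Sum>v'\<le>y. if v' = u then tilted P \<mu> \<eta> v l else 0)"
        using u disj by (intro sum.cong) (auto simp: indicator_def)
      also have "\<dots> \<le> tilted P \<mu> \<eta> v l" by simp
      finally show ?thesis using u sub by (auto simp: indicator_def)
    qed (auto simp: indicator_def)
  qed
  also have "\<dots> = excursion_sum P \<mu> \<eta> v"
    by (simp add: excursion_sum_def nn_integral_count_space_indicator)
  finally show ?thesis .
qed

text \<open>A direct drop to 0 already contributes a positive amount. This amount decays with v,
  hence a common \<gamma> on a finite range of heights.\<close>

lemma hitting_sum_lower:
  obtains \<gamma> where "\<gamma> > 0" "\<And>v. v \<le> K \<Longrightarrow> ennreal \<gamma> \<le> hitting_sum \<mu> \<eta> v"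
proof -
  obtain r where r: "r > 0" "\<And>v. ennreal (r * (1 / 2) ^ Suc v) \<le> transition P v 0"
    "\<And>h. h \<ge> M \<Longrightarrow> ennreal (r * (1 / 2) ^ Suc h) \<le> transition P 0 h"
    "\<And>h. h \<ge> 2 * M \<Longrightarrow> h > 0 \<Longrightarrow> ennreal (r * (1 / (3 ^ M * (4 * real h)))) \<le> transition P h h"
    using transition_bounds by blast
  define \<gamma> where "\<gamma> = min 1 (r * (1 / 2) ^ Suc K * exp \<eta>)"
  show ?thesis
  proof (rule that)
    show "\<gamma> > 0" using r by (simp add: \<gamma>_def)
    fix v assume v: "v \<le> K"
    show "ennreal \<gamma> \<le> hitting_sum \<mu> \<eta> v"
    proof (cases "v = 0")
      case True
      have "\<gamma> \<le> 1" by (simp add: \<gamma>_def)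
      then show ?thesis using True by (simp add: hitting_sum_def)
    next
      case False
      have "\<gamma> \<le> r * (1 / 2) ^ Suc v * exp \<eta>"
      proof -
        have "(1 / 2 :: real) ^ Suc K \<le> (1 / 2) ^ Suc v" using v by (intro power_decreasing) auto
        then have "r * (1 / 2) ^ Suc K * exp \<eta> \<le> r * (1 / 2) ^ Suc v * exp \<eta>"
          using r(1) by (intro mult_right_mono mult_left_mono) auto
        then show ?thesis by (simp add: \<gamma>_def)
      qed
      then have "ennreal \<gamma> \<le> ennreal (r * (1 / 2) ^ Suc v) * ennreal (exp \<eta>)"
        using r(1) by (subst ennreal_mult[symmetric]) (auto intro!: ennreal_leI)
      also have "\<dots> \<le> transition P v 0 * ennreal (exp \<eta>)"
        by (intro mult_right_mono r(2)) auto
      also have "\<dots> \<le> excursion_sum P \<mu> \<eta> v"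
        using excursion_sum_first_step[of v \<mu> \<eta> 0] by (simp add: hitting_sum_def)
      finally show ?thesis using False by (simp add: hitting_sum_def)
    qed
  qed
qed

text \<open>The constant \<open>c\<close> bounds the function below. It is absorbed by \<open>exp (- \<mu> v)\<close> for large \<open>v\<close> and by
  the slack \<open>\<delta>\<close> together with the lower bound on the hitting sum for the finitely many other \<open>v\<close>.\<close>

lemma superharmonic_bound:
  assumes \<mu>: "\<mu> < 0" and adm: "excursion_sum P \<mu> \<eta> 0 \<le> 1" and \<delta>: "\<delta> > 0"
  obtains c where "c > 0"
    "\<And>v y. (\<Sum>v'\<le>y. transition P v v' * (ennreal (exp (\<mu> * real v')) * hitting_sum \<mu> \<eta> v' + ennreal c))
      \<le> ennreal (exp (\<delta> - \<eta> - \<mu> * real v)) * (ennreal (exp (\<mu> * real v)) * hitting_sum \<mu> \<eta> v + ennreal c)"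
proof -
  \<comment> \<open>For v above K one has \<open>\<eta> \<le> - \<mu> * real v\<close>, so that the
    factor in front of c on the right is at least 1.\<close>
  define K where "K = nat \<lceil>\<eta> / - \<mu>\<rceil>"
  obtain \<gamma> where \<gamma>: "\<gamma> > 0" "\<And>v. v \<le> K \<Longrightarrow> ennreal \<gamma> \<le> hitting_sum \<mu> \<eta> v"
    using hitting_sum_lower by blast
  \<comment> \<open>The excess of \<open>exp (\<delta> - \<eta>)\<close> over
    \<open>exp (- \<eta>)\<close>, times the lower bound \<gamma> for the hitting sum.\<close>
  define c where "c = (exp \<delta> - 1) * exp (- \<eta>) * \<gamma>"
  have c: "c > 0" using \<gamma>(1) \<delta> by (simp add: c_def)
  show ?thesis
  proof (rule that[OF c])
    fix v y
    let ?h = "hitting_sum \<mu> \<eta>"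
    have tr: "(\<Sum>v'\<le>y. transition P v v' * (ennreal (exp (\<mu> * real v')) * ?h v')) \<le> ennreal (exp (- \<eta>)) * ?h v"
    proof -
      have "transition P v v' * (ennreal (exp (\<mu> * real v')) * ?h v') =
          ennreal (exp (- \<eta>)) * (transition P v v' * ennreal (exp (\<mu> * real v' + \<eta>)) * ?h v')" for v'
      proof -
        have "exp (\<mu> * real v') = exp (- \<eta>) * exp (\<mu> * real v' + \<eta>)" by (simp flip: exp_add)
        then have "ennreal (exp (\<mu> * real v')) = ennreal (exp (- \<eta>)) * ennreal (exp (\<mu> * real v' + \<eta>))"
          by (simp only: ennreal_mult exp_ge_zero)
        then show ?thesis by (simp only: mult.assoc mult.commute mult.left_commute)
      qed
      then have "(\<Sum>v'\<le>y. transition P v v' * (ennreal (exp (\<mu> * real v')) * ?h v'))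
        = ennreal (exp (- \<eta>)) * (\<Sum>v'\<le>y. transition P v v' * ennreal (exp (\<mu> * real v' + \<eta>)) * ?h v')"
        by (simp only: sum_distrib_left)
      also have "\<dots> \<le> ennreal (exp (- \<eta>)) * excursion_sum P \<mu> \<eta> v"
        by (intro mult_left_mono excursion_sum_first_step) auto
      \<comment> \<open>The two sides can differ only at v = 0, where the hitting sum is 1:
        admissibility is used here.\<close>
      also have "\<dots> \<le> ennreal (exp (- \<eta>)) * ?h v"
        using adm by (intro mult_left_mono) (auto simp: hitting_sum_def)
      finally show ?thesis .
    qed
    have "(\<Sum>v'\<le>y. transition P v v' * (ennreal (exp (\<mu> * real v')) * ?h v' + ennreal c))
      = (\<Sum>v'\<le>y. transition P v v' * (ennreal (exp (\<mu> * real v')) * ?h v')) + (\<Sum>v'\<le>y. transition P v v') * ennreal c"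
      by (simp add: distrib_left sum.distrib sum_distrib_right)
    also have "\<dots> \<le> ennreal (exp (- \<eta>)) * ?h v + 1 * ennreal c"
      by (intro add_mono tr mult_right_mono sum_transition_le_1) auto
    also have "\<dots> \<le> ennreal (exp (\<delta> - \<eta>)) * ?h v + ennreal (exp (\<delta> - \<eta> - \<mu> * real v)) * ennreal c"
    proof (cases "v \<le> K")
      case True
      have "exp (\<delta> - \<eta>) = exp (- \<eta>) + (exp \<delta> - 1) * exp (- \<eta>)"
        by (simp add: algebra_simps exp_diff exp_minus field_simps)
      then have "ennreal (exp (\<delta> - \<eta>)) * ?h v = ennreal (exp (- \<eta>)) * ?h v + ennreal ((exp \<delta> - 1) * exp (- \<eta>)) * ?h v"
        using \<delta> by (simp add: ennreal_plus distrib_right)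
      moreover have "ennreal c \<le> ennreal ((exp \<delta> - 1) * exp (- \<eta>)) * ?h v"
      proof -
        have "ennreal c = ennreal ((exp \<delta> - 1) * exp (- \<eta>)) * ennreal \<gamma>"
          using \<gamma>(1) \<delta> unfolding c_def by (intro ennreal_mult) auto
        then show ?thesis using \<gamma>(2)[OF True] by (auto intro: mult_left_mono)
      qed
      ultimately have "ennreal (exp (- \<eta>)) * ?h v + 1 * ennreal c \<le> ennreal (exp (\<delta> - \<eta>)) * ?h v"
        by (simp add: add_left_mono)
      then show ?thesis by (rule order_trans) simp
    next
      case False
      then have "\<eta> / - \<mu> < real v" unfolding K_def by linarith
      then have "\<eta> \<le> - \<mu> * real v" using \<mu> by (simp add: field_simps)
      then have "1 \<le> exp (\<delta> - \<eta> - \<mu> * real v)" using \<delta> by simp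
      then have "1 \<le> ennreal (exp (\<delta> - \<eta> - \<mu> * real v))" by simp
      moreover have "exp (- \<eta>) \<le> exp (\<delta> - \<eta>)" using \<delta> by simp
      ultimately show ?thesis
        by (intro add_mono mult_right_mono ennreal_leI) auto
    qed
    also have "\<dots> = ennreal (exp (\<delta> - \<eta> - \<mu> * real v)) * (ennreal (exp (\<mu> * real v)) * ?h v + ennreal c)"
    proof -
      have "exp (\<delta> - \<eta>) = exp (\<delta> - \<eta> - \<mu> * real v) * exp (\<mu> * real v)" by (simp flip: exp_add)
      then have "ennreal (exp (\<delta> - \<eta>)) = ennreal (exp (\<delta> - \<eta> - \<mu> * real v)) * ennreal (exp (\<mu> * real v))"
        by (simp only: ennreal_mult exp_ge_zero)
      then show ?thesis by (simp add: distrib_left mult.assoc)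
    qed
    finally show "(\<Sum>v'\<le>y. transition P v v' * (ennreal (exp (\<mu> * real v')) * ?h v' + ennreal c)) \<le> \<dots>" .
  qed
qed

lemma sum_paths_Suc:
  "(\<Sum>l\<in>{l. length l = Suc m \<and> sum_list l \<le> y}. path_prob P v l)
    = (\<Sum>v'\<le>y. transition P v v' * (\<Sum>l\<in>{l. length l = m \<and> sum_list l \<le> y - v'}. path_prob P v' l))"
proof -
  have "(\<Sum>v'\<le>y. transition P v v' * (\<Sum>l\<in>{l. length l = m \<and> sum_list l \<le> y - v'}. path_prob P v' l))
     = (\<Sum>v'\<le>y. \<Sum>l\<in>{l. length l = m \<and> sum_list l \<le> y - v'}. path_prob P v (v' # l))"
    by (simp add: sum_distrib_left)
  also have "\<dots> = (\<Sum>(v', l)\<in>Sigma {..y} (\<lambda>v'. {l. length l = m \<and> sum_list l \<le> y - v'}). path_prob P v (v' # l))"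
    by (intro sum.Sigma) (auto intro: finite_bounded_lists)
  also have "\<dots> = (\<Sum>l\<in>{l. length l = Suc m \<and> sum_list l \<le> y}. path_prob P v l)"
    by (rule sum.reindex_bij_witness[of _ "\<lambda>l. (hd l, tl l)" "\<lambda>(v', l). v' # l"]) (auto simp: length_Suc_conv)
  finally show ?thesis by simp
qed

text \<open>The superharmonic inequality is iterated m times. The summand c keeps the function at
  the final height at least c, and \<open>\<mu> < 0\<close> turns the restriction on the area into
  the factor \<open>exp (- \<mu> * real y)\<close>.\<close>

lemma paths_below_bound:
  assumes \<mu>: "\<mu> < 0" and adm: "excursion_sum P \<mu> \<eta> 0 \<le> 1" and \<delta>: "\<delta> > 0"
  obtains K where "K > 0" "\<And>m y. (\<Sum>l\<in>{l. length l = m \<and> sum_list l \<le> y}. path_prob P 0 l)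
      \<le> ennreal (K * exp (- \<mu> * real y + (\<delta> - \<eta>) * real m))"
proof -
  obtain c where c: "c > 0" and step:
    "\<And>v y. (\<Sum>v'\<le>y. transition P v v' * (ennreal (exp (\<mu> * real v')) * hitting_sum \<mu> \<eta> v' + ennreal c))
      \<le> ennreal (exp (\<delta> - \<eta> - \<mu> * real v)) * (ennreal (exp (\<mu> * real v)) * hitting_sum \<mu> \<eta> v + ennreal c)"
    using superharmonic_bound[OF assms] by blast
  define H where "H v = ennreal (exp (\<mu> * real v)) * hitting_sum \<mu> \<eta> v + ennreal c" for v
  let ?R = "\<lambda>m v y. (\<Sum>l\<in>{l. length l = m \<and> sum_list l \<le> y}. path_prob P v l)"
  \<comment> \<open>The exponent contains y + v because a step to v' lowers the remaining area to y
    - v' while the height becomes v', so that the sum is y again. The part belonging to v is paid by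
    the superharmonic inequality.\<close>
  have claim: "ennreal c * ?R m v y \<le> ennreal (exp (- \<mu> * (real y + real v) + (\<delta> - \<eta>) * real m)) * H v" for m v y
  proof (induction m arbitrary: v y)
    case 0
    have "{l. length l = 0 \<and> sum_list l \<le> y} = {[]}" by auto
    then have "ennreal c * ?R 0 v y = 1 * ennreal c" by simp
    also have "\<dots> \<le> ennreal (exp (- \<mu> * (real y + real v) + (\<delta> - \<eta>) * real 0)) * H v"
      using \<mu> by (intro mult_mono) (auto simp: H_def mult_nonpos_nonneg)
    finally show ?case .
  next
    case (Suc m)
    have "ennreal c * ?R (Suc m) v y = (\<Sum>v'\<le>y. transition P v v' * (ennreal c * ?R m v' (y - v')))"
      unfolding sum_paths_Suc by (simp add: sum_distrib_left ac_simps)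
    also have "\<dots> \<le> (\<Sum>v'\<le>y. transition P v v' * (ennreal (exp (- \<mu> * real y + (\<delta> - \<eta>) * real m)) * H v'))"
    proof (intro sum_mono mult_left_mono)
      fix v' assume "v' \<in> {..y}"
      then have "real (y - v') + real v' = real y" by simp
      then show "ennreal c * ?R m v' (y - v') \<le> ennreal (exp (- \<mu> * real y + (\<delta> - \<eta>) * real m)) * H v'"
        using Suc[of v' "y - v'"] by simp
    qed auto
    also have "\<dots> = ennreal (exp (- \<mu> * real y + (\<delta> - \<eta>) * real m)) * (\<Sum>v'\<le>y. transition P v v' * H v')"
      unfolding sum_distrib_left by (intro sum.cong refl mult.left_commute)
    also have "\<dots> \<le> ennreal (exp (- \<mu> * real y + (\<delta> - \<eta>) * real m)) * (ennreal (exp (\<delta> - \<eta> - \<mu> * real v)) * H v)"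
      using step unfolding H_def by (intro mult_left_mono) auto
    also have "\<dots> = ennreal (exp (- \<mu> * (real y + real v) + (\<delta> - \<eta>) * real (Suc m))) * H v"
    proof -
      have "exp (- \<mu> * (real y + real v) + (\<delta> - \<eta>) * real (Suc m)) = exp (- \<mu> * real y + (\<delta> - \<eta>) * real m) * exp (\<delta> - \<eta> - \<mu> * real v)"
        by (simp add: algebra_simps flip: exp_add)
      then show ?thesis by (simp only: ennreal_mult exp_ge_zero mult.assoc)
    qed
    finally show ?case .
  qed
  show ?thesis
  proof (rule that)
    \<comment> \<open>At height 0 the function equals 1 + c, and c is its general lower
      bound.\<close>
    show "(1 + c) / c > 0" using c by simp
    fix m y
    have "?R m 0 y = ennreal (1 / c) * (ennreal c * ?R m 0 y)"
      using c by (simp add: ennreal_mult[symmetric] flip: mult.assoc)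
    also have "\<dots> \<le> ennreal (1 / c) * (ennreal (exp (- \<mu> * real y + (\<delta> - \<eta>) * real m)) * H 0)"
      using claim[where m = m and v = 0 and y = y] by (intro mult_left_mono) simp_all
    also have "H 0 = ennreal (1 + c)"
      using c by (simp add: H_def hitting_sum_def ennreal_plus)
    also have "ennreal (1 / c) * (ennreal (exp (- \<mu> * real y + (\<delta> - \<eta>) * real m)) * ennreal (1 + c)) = ennreal ((1 + c) / c * exp (- \<mu> * real y + (\<delta> - \<eta>) * real m))"
    proof -
      have "(1 + c) / c * exp (- \<mu> * real y + (\<delta> - \<eta>) * real m) = 1 / c * (exp (- \<mu> * real y + (\<delta> - \<eta>) * real m) * (1 + c))"
        by simp
      moreover have "0 \<le> 1 / c" "0 \<le> 1 + c" using c by auto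
      ultimately show ?thesis by (simp only: ennreal_mult exp_ge_zero mult_nonneg_nonneg)
    qed
    finally show "?R m 0 y \<le> ennreal ((1 + c) / c * exp (- \<mu> * real y + (\<delta> - \<eta>) * real m))" .
  qed
qed

lemma upper_tail_bound:
  assumes x: "0 < x" "x \<le> 1" and \<mu>: "\<mu> < 0" and adm: "excursion_sum P \<mu> \<eta> 0 \<le> 1" and \<delta>: "\<delta> > 0"
  obtains K where "K > 0" "\<And>n. n > 0 \<Longrightarrow> averaged_prob P {X. real_of_int (X n) / real n \<ge> x}
      \<le> ennreal (K * exp (real n * (- (\<mu> * (1 - x) / 2 + \<eta> * x) + \<delta>)))"
proof -
  obtain K where K: "K > 0" and b: "\<And>m y. (\<Sum>l\<in>{l. length l = m \<and> sum_list l \<le> y}. path_prob P 0 l)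
      \<le> ennreal (K * exp (- \<mu> * real y + (\<delta> - \<eta>) * real m))"
    using paths_below_bound[OF \<mu> adm \<delta>] by blast
  \<comment> \<open>The extra factor pays for rounding \<open>x * real n\<close> up to the integer
    m, an error of at most one.\<close>
  define K' where "K' = K * exp \<bar>\<mu> / 2 + \<delta> - \<eta>\<bar>"
  show ?thesis
  proof (rule that)
    show "K' > 0" using K by (simp add: K'_def)
    fix n :: nat assume n: "n > 0"
    define m where "m = nat \<lceil>x * real n\<rceil>"
    have m: "m > 0" using x n by (simp add: m_def)
    have "0 \<le> x * real n" using x by simp
    then have mr: "real m \<ge> x * real n" "real m < x * real n + 1" unfolding m_def by linarith+
    have int_m: "int m = \<lceil>x * real n\<rceil>" unfolding m_def using \<open>0 \<le> x * real n\<close> by linarith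
    have "x * real n \<le> real n" using x n by simp
    then have mn: "m \<le> n" unfolding m_def by linarith
    have "{X. real_of_int (X n) / real n \<ge> x} = {X. X n \<in> {int m..}}"
    proof (intro Collect_cong)
      fix X :: "nat \<Rightarrow> int"
      have "x \<le> real_of_int (X n) / real n \<longleftrightarrow> x * real n \<le> real_of_int (X n)"
        using n by (simp add: field_simps)
      also have "\<dots> \<longleftrightarrow> int m \<le> X n" unfolding int_m by (rule ceiling_le_iff[symmetric])
      finally show "x \<le> real_of_int (X n) / real n \<longleftrightarrow> X n \<in> {int m..}" by simp
    qed
    then have "averaged_prob P {X. real_of_int (X n) / real n \<ge> x} \<le> (\<Sum>l\<in>{l. length l = m \<and> sum_list l \<le> (n - m) div 2}. path_prob P 0 l)"
      using averaged_prob_le_paths[OF m] by simp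
    also have "\<dots> \<le> ennreal (K * exp (- \<mu> * real ((n - m) div 2) + (\<delta> - \<eta>) * real m))" by (rule b)
    also have "\<dots> \<le> ennreal (K' * exp (real n * (- (\<mu> * (1 - x) / 2 + \<eta> * x) + \<delta>)))"
    proof (rule ennreal_leI)
      have "2 * ((n - m) div 2) + m \<le> n" using mn by simp
      from of_nat_mono[OF this, where 'a = real] have "real ((n - m) div 2) \<le> (real n - real m) / 2" by simp
      then have "- \<mu> * real ((n - m) div 2) + (\<delta> - \<eta>) * real m \<le> - \<mu> * ((real n - real m) / 2) + (\<delta> - \<eta>) * real m"
        using \<mu> by (intro add_right_mono mult_left_mono) auto
      also have "\<dots> = (\<mu> / 2 + \<delta> - \<eta>) * (real m - x * real n) + real n * (- (\<mu> * (1 - x) / 2 + \<eta> * x) + \<delta> * x)"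
        by (simp add: field_simps)
      also have "\<dots> \<le> \<bar>\<mu> / 2 + \<delta> - \<eta>\<bar> * 1 + real n * (- (\<mu> * (1 - x) / 2 + \<eta> * x) + \<delta>)"
        using mr x \<delta> by (intro add_mono mult_mono mult_left_mono) auto
      finally have "- \<mu> * real ((n - m) div 2) + (\<delta> - \<eta>) * real m \<le> \<bar>\<mu> / 2 + \<delta> - \<eta>\<bar> + real n * (- (\<mu> * (1 - x) / 2 + \<eta> * x) + \<delta>)"
        by simp
      then have "exp (- \<mu> * real ((n - m) div 2) + (\<delta> - \<eta>) * real m) \<le> exp \<bar>\<mu> / 2 + \<delta> - \<eta>\<bar> * exp (real n * (- (\<mu> * (1 - x) / 2 + \<eta> * x) + \<delta>))"
        by (simp flip: exp_add)
      then show "K * exp (- \<mu> * real ((n - m) div 2) + (\<delta> - \<eta>) * real m) \<le> K' * exp (real n * (- (\<mu> * (1 - x) / 2 + \<eta> * x) + \<delta>))"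
        using K unfolding K'_def by (subst mult.assoc) (intro mult_left_mono, auto)
    qed
    finally show "averaged_prob P {X. real_of_int (X n) / real n \<ge> x} \<le> ennreal (K' * exp (real n * (- (\<mu> * (1 - x) / 2 + \<eta> * x) + \<delta>)))" .
  qed
qed

end

section \<open>Lower bound\<close>

text \<open>The elements of A with code below i form finite sets that exhaust A, and monotone
  convergence applies.\<close>

lemma nn_integral_count_space_less_finite_sum:
  fixes f :: "'a :: countable \<Rightarrow> ennreal"
  assumes "c < (\<integral>\<^sup>+l. f l \<partial>count_space A)"
  obtains F where "finite F" "F \<subseteq> A" "c < sum f F"
proof -
  define F where "F i = {l \<in> A. to_nat l < i}" for i
  have F: "finite (F i)" "F i \<subseteq> A" for i
  proof -
    have "finite (to_nat -` {..<i} :: 'a set)" by (intro finite_vimageI) auto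
    then show "finite (F i)" by (rule rev_finite_subset) (auto simp: F_def)
  qed (auto simp: F_def)
  have "(\<integral>\<^sup>+l. f l \<partial>count_space A) = (\<integral>\<^sup>+l. (SUP i. f l * indicator (F i) l) \<partial>count_space A)"
  proof (rule nn_integral_cong)
    fix l assume "l \<in> space (count_space A)"
    then have l: "l \<in> F (Suc (to_nat l))" by (simp add: F_def)
    show "f l = (SUP i. f l * indicator (F i) l)"
    proof (rule antisym)
      show "f l \<le> (SUP i. f l * indicator (F i) l)"
        using l by (intro SUP_upper2[of "Suc (to_nat l)"]) auto
      show "(SUP i. f l * indicator (F i) l) \<le> f l"
        by (intro SUP_least) (auto simp: indicator_def)
    qed
  qed
  also have "\<dots> = (SUP i. \<integral>\<^sup>+l. f l * indicator (F i) l \<partial>count_space A)"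
    by (intro nn_integral_monotone_convergence_SUP)
      (auto simp: incseq_def le_fun_def F_def indicator_def)
  also have "\<dots> = (SUP i. sum f (F i))"
  proof (intro SUP_cong refl)
    fix i
    have "(\<integral>\<^sup>+l. f l * indicator (F i) l \<partial>count_space A) = (\<Sum>l\<in>F i. f l * indicator (F i) l)"
      using F by (intro nn_integral_count_space') auto
    also have "\<dots> = sum f (F i)" by (intro sum.cong) auto
    finally show "(\<integral>\<^sup>+l. f l * indicator (F i) l \<partial>count_space A) = sum f (F i)" .
  qed
  finally have "c < (SUP i. sum f (F i))" using assms by simp
  then obtain i where "c < sum f (F i)" by (auto simp: less_SUP_iff)
  with F show ?thesis using that by blast
qed

text \<open>The first 0 marks the end of the leading excursion, so that concatenations of excursions
  decompose uniquely.\<close>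

lemma excursion_takeWhile:
  assumes "a \<in> excursions"
  shows "a = takeWhile (\<lambda>v. v \<noteq> 0) (a @ b) @ [0]"
proof -
  have a: "a = butlast a @ [0]" "0 \<notin> set (butlast a)"
    using assms append_butlast_last_id[of a] by (auto simp: excursions_def)
  have "takeWhile (\<lambda>v. v \<noteq> 0) (butlast a @ (0 # b)) = butlast a"
    using a(2) by (subst takeWhile_append2) (auto intro!: gr0I)
  then show ?thesis using a(1) by (metis append.assoc append_Cons append_Nil)
qed

lemma excursion_append_inj: "inj_on (\<lambda>(a, b). a @ b) (excursions \<times> UNIV)"
proof (rule inj_onI, clarify)
  fix a b a' b' :: "nat list"
  assume "a \<in> excursions" "a' \<in> excursions" and eq: "a @ b = a' @ b'"
  then have "a = a'" using excursion_takeWhile[of a b] excursion_takeWhile[of a' b'] by metis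
  with eq show "a = a' \<and> b = b'" by simp
qed

lemma tilted_append:
  "last (0 # a) = 0 \<Longrightarrow> tilted P \<mu> \<eta> 0 (a @ b) = tilted P \<mu> \<eta> 0 a * tilted P \<mu> \<eta> 0 b"
proof -
  assume l: "last (0 # a) = 0"
  have "exp (\<mu> * real (sum_list (a @ b)) + \<eta> * real (length (a @ b))) =
    exp (\<mu> * real (sum_list a) + \<eta> * real (length a)) * exp (\<mu> * real (sum_list b) + \<eta> * real (length b))"
    by (simp add: algebra_simps flip: exp_add)
  then have "ennreal (exp (\<mu> * real (sum_list (a @ b)) + \<eta> * real (length (a @ b)))) =
    ennreal (exp (\<mu> * real (sum_list a) + \<eta> * real (length a))) * ennreal (exp (\<mu> * real (sum_list b) + \<eta> * real (length b)))"
    by (simp only: ennreal_mult exp_ge_zero)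
  then show ?thesis unfolding tilted_def path_prob_append l
    by (simp only: mult.assoc mult.commute mult.left_commute)
qed

section \<open>Return paths and their subadditive cost\<close>

text \<open>Written with \<open>0 # l\<close> so that the empty list counts as a return path. It
  gives weight 1 to length 0 and area 0, which starts the induction over powers.\<close>

definition return_paths :: "nat \<Rightarrow> nat \<Rightarrow> nat list set" where
  "return_paths s w = {l. length l = s \<and> sum_list l = w \<and> last (0 # l) = 0}"

definition return_weight :: "env measure \<Rightarrow> nat \<Rightarrow> nat \<Rightarrow> ennreal" where
  "return_weight P s w = (\<Sum>l\<in>return_paths s w. path_prob P 0 l)"

lemma finite_return_paths: "finite (return_paths s w)"
proof (rule finite_subset)
  show "return_paths s w \<subseteq> {l. set l \<subseteq> {..w} \<and> length l = s}"
    using member_le_sum_list by (auto simp: return_paths_def)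
qed (simp add: finite_lists_length_eq)

lemma return_weight_0: "return_weight P 0 0 = 1"
proof -
  have "return_paths 0 0 = {[]}" by (auto simp: return_paths_def)
  then show ?thesis by (simp add: return_weight_def)
qed

text \<open>The chain restarts at 0, so weights multiply under concatenation; the fixed length of
  the first piece makes concatenation injective.\<close>

lemma return_weight_superadditive:
  "return_weight P s w * return_weight P s' w' \<le> return_weight P (s + s') (w + w')"
proof -
  let ?I = "return_paths s w \<times> return_paths s' w'"
  let ?f = "\<lambda>(a, b). a @ b"
  have app: "a @ b \<in> return_paths (s + s') (w + w')" if "a \<in> return_paths s w" "b \<in> return_paths s' w'" for a b
    using that by (cases "b = []") (simp_all add: return_paths_def)
  have inj: "inj_on ?f ?I"
  proof (rule inj_onI, clarify)
    fix a b a' b' assume "a \<in> return_paths s w" "a' \<in> return_paths s w" "a @ b = a' @ b'"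
    then show "a = a' \<and> b = b'" by (simp add: return_paths_def append_eq_append_conv)
  qed
  have sub: "?f ` ?I \<subseteq> return_paths (s + s') (w + w')"
    using app by (intro image_subsetI) (simp add: case_prod_unfold mem_Times_iff)
  have "return_weight P s w * return_weight P s' w' = (\<Sum>(a, b)\<in>?I. path_prob P 0 a * path_prob P 0 b)"
    by (simp add: return_weight_def sum_product sum.cartesian_product)
  also have "\<dots> = (\<Sum>x\<in>?I. path_prob P 0 (?f x))"
    by (intro sum.cong refl) (auto simp: path_prob_append return_paths_def)
  also have "\<dots> = (\<Sum>l\<in>?f ` ?I. path_prob P 0 l)"
    by (simp add: sum.reindex[OF inj])
  also have "\<dots> \<le> return_weight P (s + s') (w + w')"
    unfolding return_weight_def by (intro sum_mono2 finite_return_paths sub) auto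
  finally show ?thesis .
qed

lemma return_weight_power: "return_weight P s w ^ k \<le> return_weight P (k * s) (k * w)"
proof (induction k)
  case (Suc k)
  have "return_weight P s w ^ Suc k \<le> return_weight P s w * return_weight P (k * s) (k * w)"
    using Suc by (simp add: mult_left_mono)
  also have "\<dots> \<le> return_weight P (Suc k * s) (Suc k * w)"
    using return_weight_superadditive[of P s w "k * s" "k * w"] by simp
  finally show ?case .
qed (simp add: return_weight_0)

text \<open>The \<open>k\<close>-th power of a finite part of the sum is a sum over concatenations of \<open>k\<close> excursions. These are
  distinct return paths, so by the hypothesis the power grows at most polynomially in \<open>k\<close>.\<close>

lemma excursion_sum_le_1:
  assumes ret: "\<And>s w. return_weight P s w \<le> ennreal (exp (- (\<eta> * real s + \<mu> * real w)))"
  shows "excursion_sum P \<mu> \<eta> 0 \<le> 1"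
proof (rule ccontr)
  let ?t = "tilted P \<mu> \<eta> 0"
  assume "\<not> excursion_sum P \<mu> \<eta> 0 \<le> 1"
  then have "1 < (\<integral>\<^sup>+l. ?t l \<partial>count_space excursions)" by (simp add: excursion_sum_def not_le)
  then obtain F where F: "finite F" "F \<subseteq> excursions" "1 < sum ?t F"
    using nn_integral_count_space_less_finite_sum by blast
  obtain y where y: "1 < y" "y < sum ?t F" using dense[OF F(3)] by blast
  define \<gamma> where "\<gamma> = enn2real y"
  have y_fin: "y < top" using y(2) less_top_ennreal by (metis order_less_trans top.not_eq_extremum)
  then have y\<gamma>: "y = ennreal \<gamma>" by (simp add: \<gamma>_def)
  then have \<gamma>: "\<gamma> > 1" using y(1) by (metis ennreal_1 ennreal_less_iff zero_le_one)
  define B where "B = Max (insert 0 (length ` F \<union> sum_list ` F))"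
  have B: "length a \<le> B" "sum_list a \<le> B" if "a \<in> F" for a
    unfolding B_def using that F(1) by (auto intro!: Max_ge)
  \<comment> \<open>\<open>C k\<close> is the set of concatenations of k excursions taken from
    F.\<close>
  define C where "C = rec_nat {[]} (\<lambda>_ D. (\<lambda>(a, b). a @ b) ` (F \<times> D))"
  have C0: "C 0 = {[]}" and CS: "C (Suc k) = (\<lambda>(a, b). a @ b) ` (F \<times> C k)" for k
    by (simp_all add: C_def)
  have exc_last: "last (0 # a) = 0" if "a \<in> F" for a
    using F(2) that by (auto simp: excursions_def)
  have Cfin: "finite (C k)" for k by (induction k) (auto simp: C0 CS F(1))
  have Cprop: "length l \<le> k * B \<and> sum_list l \<le> k * B \<and> last (0 # l) = 0" if "l \<in> C k" for k l
    using that
  proof (induction k arbitrary: l)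
    case (Suc k)
    then obtain a b where ab: "a \<in> F" "b \<in> C k" "l = a @ b" by (auto simp: CS)
    with Suc.IH[OF ab(2)] B[OF ab(1)] exc_last[OF ab(1)] show ?case by (cases "b = []") auto
  qed (simp add: C0)
  have Csum: "sum ?t (C k) = sum ?t F ^ k" for k
  proof (induction k)
    case 0
    then show ?case by (simp add: C0 tilted_def)
  next
    case (Suc k)
    have inj: "inj_on (\<lambda>(a, b). a @ b) (F \<times> C k)"
      by (rule inj_on_subset[OF excursion_append_inj]) (use F in auto)
    have "sum ?t (C (Suc k)) = (\<Sum>(a, b)\<in>F \<times> C k. ?t (a @ b))"
      unfolding CS by (subst sum.reindex[OF inj]) (simp add: comp_def case_prod_unfold)
    also have "\<dots> = (\<Sum>(a, b)\<in>F \<times> C k. ?t a * ?t b)"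
      using exc_last by (intro sum.cong refl) (auto simp only: tilted_append split: prod.splits)
    also have "\<dots> = sum ?t F * sum ?t (C k)"
      by (simp add: sum_product sum.cartesian_product)
    finally show ?case using Suc by simp
  qed
  have bound: "sum ?t (C k) \<le> ennreal ((real k * real B + 1) ^ 2)" for k
  proof -
    let ?T = "{..k * B} \<times> {..k * B}"
    \<comment> \<open>Grouping by length and area leaves \<open>(k * B + 1) ^ 2\<close> groups, and
      the hypothesis bounds the tilted weight of each of them by 1.\<close>
    have "sum ?t (C k) = (\<Sum>y\<in>?T. sum ?t {l \<in> C k. (length l, sum_list l) = y})"
      by (rule sum.group[symmetric]) (use Cfin Cprop in auto)
    also have "\<dots> \<le> (\<Sum>y\<in>?T. 1)"
    proof (intro sum_mono, clarify)
      fix s w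
      have "{l \<in> C k. (length l, sum_list l) = (s, w)} \<subseteq> return_paths s w"
        unfolding return_paths_def using Cprop by blast
      then have "sum ?t {l \<in> C k. (length l, sum_list l) = (s, w)} \<le> sum ?t (return_paths s w)"
        by (intro sum_mono2 finite_return_paths) auto
      also have "\<dots> = return_weight P s w * ennreal (exp (\<mu> * real w + \<eta> * real s))"
        unfolding return_weight_def sum_distrib_right
        by (intro sum.cong refl) (auto simp: tilted_def return_paths_def)
      also have "\<dots> \<le> ennreal (exp (- (\<eta> * real s + \<mu> * real w))) * ennreal (exp (\<mu> * real w + \<eta> * real s))"
        by (intro mult_right_mono ret) auto
      also have "\<dots> = ennreal (exp (- (\<eta> * real s + \<mu> * real w)) * exp (\<mu> * real w + \<eta> * real s))"
        by (simp add: ennreal_mult)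
      also have "\<dots> = 1" by (simp flip: exp_add)
      finally show "sum ?t {l \<in> C k. (length l, sum_list l) = (s, w)} \<le> 1" .
    qed
    also have "\<dots> = ennreal (real (card ?T))" by (simp add: ennreal_of_nat_eq_real_of_nat)
    also have "real (card ?T) = (real k * real B + 1) ^ 2"
      by (simp add: power2_eq_square algebra_simps)
    finally show ?thesis .
  qed
  \<comment> \<open>B + 1 replaces B so that the coefficient of k is positive in the growth
    comparison.\<close>
  have le: "\<gamma> ^ k \<le> (real k * (real B + 1) + 1) ^ 2" for k
  proof -
    have "ennreal (\<gamma> ^ k) = y ^ k" using \<gamma> by (simp add: y\<gamma> ennreal_power)
    also have "\<dots> \<le> sum ?t F ^ k" using y(2) by (intro power_mono) auto
    also have "\<dots> \<le> ennreal ((real k * real B + 1) ^ 2)" using bound[of k] by (simp add: Csum)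
    finally have "\<gamma> ^ k \<le> (real k * real B + 1) ^ 2" by (subst (asm) ennreal_le_iff) auto
    also have "\<dots> \<le> (real k * (real B + 1) + 1) ^ 2" by (intro power_mono) (auto simp: algebra_simps)
    finally show ?thesis .
  qed
  have "filterlim (\<lambda>k. \<gamma> ^ k / (real k * (real B + 1) + 1) ^ 2) at_top at_top"
  proof -
    define b where "b = real B + 1"
    have "b > 0" by (simp add: b_def)
    then have "filterlim (\<lambda>k. \<gamma> ^ k / (real k * b + 1) ^ 2) at_top at_top"
      using \<gamma> by real_asymp
    then show ?thesis by (simp add: b_def)
  qed
  then have "eventually (\<lambda>k. \<gamma> ^ k / (real k * (real B + 1) + 1) ^ 2 > 1) at_top"
    by (simp add: filterlim_at_top_dense)
  then obtain k where "\<gamma> ^ k / (real k * (real B + 1) + 1) ^ 2 > 1"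
    by (auto dest: eventually_happens)
  moreover have "(real k * (real B + 1) + 1) ^ 2 > 0" by (intro zero_less_power add_nonneg_pos) auto
  ultimately show False using le[of k] by (simp add: field_simps)
qed

text \<open>The division by \<open>q\<close> makes this additive semigroup stable under positive rational scaling, so that its
  closure is a convex cone.\<close>

definition return_costs :: "env measure \<Rightarrow> (real \<times> real \<times> real) set" where
  "return_costs P = {(real s / real q, real w / real q, c / real q) | s w c q.
     q \<ge> 1 \<and> ennreal (exp (- c)) \<le> return_weight P s w}"

text \<open>To reach the common denominator \<open>q * q'\<close> the first path is repeated q'
  times and the second q times; \<open>return_weight_power\<close> and superadditivity bound the
  weight of the result.\<close>

lemma return_costs_add:
  assumes "a \<in> return_costs P" "b \<in> return_costs P"
  shows "a + b \<in> return_costs P"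
proof -
  obtain s w c q where a: "a = (real s / real q, real w / real q, c / real q)" "q \<ge> 1" "ennreal (exp (- c)) \<le> return_weight P s w"
    using assms(1) unfolding return_costs_def by blast
  obtain s' w' c' q' where b: "b = (real s' / real q', real w' / real q', c' / real q')" "q' \<ge> 1" "ennreal (exp (- c')) \<le> return_weight P s' w'"
    using assms(2) unfolding return_costs_def by blast
  have scale: "ennreal (exp (- (real k * c))) \<le> return_weight P (k * s) (k * w)"
    if "ennreal (exp (- c)) \<le> return_weight P s w" for k s w c
  proof -
    have "ennreal (exp (- (real k * c))) = ennreal (exp (- c)) ^ k"
      by (simp add: ennreal_power exp_of_nat_mult[symmetric])
    also have "\<dots> \<le> return_weight P s w ^ k" by (intro power_mono that) auto
    also have "\<dots> \<le> return_weight P (k * s) (k * w)" by (rule return_weight_power)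
    finally show ?thesis .
  qed
  have "ennreal (exp (- (real q' * c + real q * c'))) = ennreal (exp (- (real q' * c))) * ennreal (exp (- (real q * c')))"
    by (simp add: exp_add[symmetric] flip: ennreal_mult)
  also have "\<dots> \<le> return_weight P (q' * s) (q' * w) * return_weight P (q * s') (q * w')"
    by (intro mult_mono scale a b) auto
  also have "\<dots> \<le> return_weight P (q' * s + q * s') (q' * w + q * w')"
    by (rule return_weight_superadditive)
  finally have "ennreal (exp (- (real q' * c + real q * c'))) \<le> return_weight P (q' * s + q * s') (q' * w + q * w')" .
  moreover have "a + b = (real (q' * s + q * s') / real (q * q'), real (q' * w + q * w') / real (q * q'), (real q' * c + real q * c') / real (q * q'))"
    using a(1,2) b(1,2) by (simp add: field_simps)
  moreover have "q * q' \<ge> 1" using a(2) b(2) by simp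
  ultimately show ?thesis unfolding return_costs_def by blast
qed

lemma return_costs_0: "0 \<in> return_costs P"
  unfolding return_costs_def
  by (rule CollectI, rule exI[of _ 0], rule exI[of _ 0], rule exI[of _ 0], rule exI[of _ 1])
    (simp add: return_weight_0 zero_prod_def)

lemma return_costs_scale:
  assumes "a \<in> return_costs P" "r \<ge> 1"
  shows "(real p / real r) *\<^sub>R a \<in> return_costs P"
proof -
  have p: "real p *\<^sub>R a \<in> return_costs P" for p
  proof (induction p)
    case (Suc p)
    have "real (Suc p) *\<^sub>R a = real p *\<^sub>R a + a" by (simp add: algebra_simps)
    then show ?case using return_costs_add[OF Suc assms(1)] by simp
  qed (simp add: return_costs_0)
  obtain s w c q where a: "real p *\<^sub>R a = (real s / real q, real w / real q, c / real q)" "q \<ge> 1" "ennreal (exp (- c)) \<le> return_weight P s w"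
    using p[of p] unfolding return_costs_def by blast
  have "(real p / real r) *\<^sub>R a = (1 / real r) *\<^sub>R (real p *\<^sub>R a)" by simp
  also have "\<dots> = (real s / real (q * r), real w / real (q * r), c / real (q * r))"
    unfolding a(1) by simp
  finally have "(real p / real r) *\<^sub>R a = (real s / real (q * r), real w / real (q * r), c / real (q * r))" .
  moreover have "q * r \<ge> 1" using a(2) assms(2) by simp
  ultimately show ?thesis using a(3) unfolding return_costs_def by blast
qed

text \<open>Multiples by the rational numbers
  \<open>\<lfloor>t * real (Suc n)\<rfloor> / real (Suc n)\<close> stay in the set, and these
  numbers converge to t.\<close>

lemma closure_return_costs_cone:
  assumes "a \<in> closure (return_costs P)" "b \<in> closure (return_costs P)" "t \<ge> 0"
  shows "a + b \<in> closure (return_costs P)" "t *\<^sub>R a \<in> closure (return_costs P)"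
proof -
  obtain f where f: "\<And>n. f n \<in> return_costs P" "f \<longlonglongrightarrow> a" using assms(1) unfolding closure_sequential by blast
  obtain g where g: "\<And>n. g n \<in> return_costs P" "g \<longlonglongrightarrow> b" using assms(2) unfolding closure_sequential by blast
  show "a + b \<in> closure (return_costs P)"
    unfolding closure_sequential
    using f g by (intro exI[of _ "\<lambda>n. f n + g n"]) (auto intro: return_costs_add tendsto_add)
  define r where "r n = real (nat \<lfloor>t * real (Suc n)\<rfloor>) / real (Suc n)" for n
  have "r \<longlonglongrightarrow> t"
  proof (rule tendsto_sandwich[OF always_eventually always_eventually _ tendsto_const])
    have nn: "0 \<le> t * real (Suc n)" for n using assms(3) by simp
    show "\<forall>n. t - 1 / real (Suc n) \<le> r n"
    proof
      fix n
      have "t * real (Suc n) - 1 \<le> real (nat \<lfloor>t * real (Suc n)\<rfloor>)" using nn[of n] by linarith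
      then have "(t * real (Suc n) - 1) / real (Suc n) \<le> r n" unfolding r_def by (intro divide_right_mono) auto
      then show "t - 1 / real (Suc n) \<le> r n" by (simp add: diff_divide_distrib del: of_nat_Suc)
    qed
    show "\<forall>n. r n \<le> t"
    proof
      fix n
      have "real (nat \<lfloor>t * real (Suc n)\<rfloor>) \<le> t * real (Suc n)" using nn[of n] by linarith
      then have "r n \<le> t * real (Suc n) / real (Suc n)" unfolding r_def by (intro divide_right_mono) auto
      then show "r n \<le> t" by (simp del: of_nat_Suc)
    qed
    show "(\<lambda>n. t - 1 / real (Suc n)) \<longlonglongrightarrow> t"
      using tendsto_diff[OF tendsto_const[of t] LIMSEQ_inverse_real_of_nat] by (simp add: inverse_eq_divide)
  qed
  then have "(\<lambda>n. r n *\<^sub>R f n) \<longlonglongrightarrow> t *\<^sub>R a" by (intro tendsto_scaleR f)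
  moreover have "r n *\<^sub>R f n \<in> return_costs P" for n
    unfolding r_def by (intro return_costs_scale f) auto
  ultimately show "t *\<^sub>R a \<in> closure (return_costs P)"
    unfolding closure_sequential by (intro exI[of _ "\<lambda>n. r n *\<^sub>R f n"] conjI allI)
qed

section \<open>Separation argument and local lower bound\<close>

context cookie_law
begin

text \<open>The witnesses are the return paths \<open>[0]\<close> and \<open>[h, 0]\<close>. They
  determine the signs of the coefficients of a separating hyperplane; arbitrarily large c' reflect
  that a cost may always be increased.\<close>

lemma return_weight_pos:
  obtains c where "\<And>c'. c' \<ge> c \<Longrightarrow> ennreal (exp (- c')) \<le> return_weight P 1 0"
    and "\<And>h. h \<ge> M \<Longrightarrow> \<exists>c. ennreal (exp (- c)) \<le> return_weight P 2 h"
proof -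
  obtain r where r: "r > 0" "\<And>v. ennreal (r * (1 / 2) ^ Suc v) \<le> transition P v 0"
    "\<And>h. h \<ge> M \<Longrightarrow> ennreal (r * (1 / 2) ^ Suc h) \<le> transition P 0 h"
    "\<And>h. h \<ge> 2 * M \<Longrightarrow> h > 0 \<Longrightarrow> ennreal (r * (1 / (3 ^ M * (4 * real h)))) \<le> transition P h h"
    using transition_bounds by blast
  have mem: "path_prob P 0 l \<le> return_weight P s w" if "l \<in> return_paths s w" for l s w
    unfolding return_weight_def using that finite_return_paths by (intro member_le_sum) auto
  show ?thesis
  proof (rule that)
    fix c' :: real assume "c' \<ge> - ln (r / 2)"
    then have "exp (- c') \<le> exp (ln (r / 2))" by simp
    then have "exp (- c') \<le> r * (1 / 2) ^ Suc 0" using r(1) by simp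
    then have "ennreal (exp (- c')) \<le> transition P 0 0" using r(2)[of 0] ennreal_leI order_trans by blast
    also have "\<dots> = path_prob P 0 [0]" by simp
    also have "\<dots> \<le> return_weight P 1 0" by (rule mem) (simp add: return_paths_def)
    finally show "ennreal (exp (- c')) \<le> return_weight P 1 0" .
  next
    fix h assume h: "h \<ge> M"
    define z where "z = r * (1 / 2) ^ Suc h"
    have z: "z > 0" using r(1) by (simp add: z_def)
    have "ennreal (exp (- (- ln (z * z)))) = ennreal z * ennreal z"
      using z by (simp add: ennreal_mult)
    also have "\<dots> \<le> transition P 0 h * transition P h 0"
      unfolding z_def by (intro mult_mono r h) auto
    also have "\<dots> = path_prob P 0 [h, 0]" by simp
    also have "\<dots> \<le> return_weight P 2 h" by (rule mem) (simp add: return_paths_def)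
    finally show "\<exists>c. ennreal (exp (- c)) \<le> return_weight P 2 h" by blast
  qed
qed

text \<open>A separating functional is nonnegative on the cone and negative at the point. Its cost
  coefficient turns out to be positive, and dividing by it makes the other two coefficients, with
  reversed sign, the slopes \<eta> for length and \<mu> for area.\<close>

lemma rate_point_in_closure:
  assumes x: "0 \<le> x" "x \<le> 1" and \<epsilon>: "\<epsilon> > 0"
    and R: "\<And>\<mu> \<eta>. excursion_sum P \<mu> \<eta> 0 \<le> 1 \<Longrightarrow> \<mu> * (1 - x) / 2 + \<eta> * x \<le> R"
  shows "(x, (1 - x) / 2, R + \<epsilon>) \<in> closure (return_costs P)"
proof (rule ccontr)
  let ?Q = "return_costs P"
  let ?z = "(x, (1 - x) / 2, R + \<epsilon>)"
  assume "?z \<notin> closure ?Q"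
  moreover have "convex (closure ?Q)"
    unfolding convex_def using closure_return_costs_cone by blast
  ultimately obtain a b where ab: "inner a ?z < b" "\<And>y. y \<in> closure ?Q \<Longrightarrow> inner a y > b"
    using separating_hyperplane_closed_point[of "closure ?Q" ?z] by blast
  obtain a1 a2 a3 where a: "a = (a1, a2, a3)" by (cases a)
  have "b < inner a 0" by (intro ab(2) subsetD[OF closure_subset] return_costs_0)
  then have b: "b < 0" by simp
  \<comment> \<open>A negative value would fall below b under a large integer multiple, which stays
    in the cone.\<close>
  have nonneg: "0 \<le> a1 * real s + a2 * real w + a3 * c" if "ennreal (exp (- c)) \<le> return_weight P s w" for s w c
  proof (rule ccontr)
    let ?v = "a1 * real s + a2 * real w + a3 * c"
    assume "\<not> 0 \<le> ?v"
    then have neg: "?v < 0" by simp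
    obtain n where n: "real n > b / ?v" using reals_Archimedean2 by blast
    then have "real n * ?v < b" using neg by (simp add: neg_divide_less_eq)
    have "(real s, real w, c) \<in> ?Q"
      unfolding return_costs_def using that
      by (intro CollectI exI[of _ s] exI[of _ w] exI[of _ c] exI[of _ 1]) simp
    from return_costs_scale[OF this, of 1 n] have "real n *\<^sub>R (real s, real w, c) \<in> ?Q" by simp
    then have "inner a (real n *\<^sub>R (real s, real w, c)) > b" by (intro ab(2) subsetD[OF closure_subset])
    then have "real n * ?v > b" by (simp add: a algebra_simps)
    with \<open>real n * ?v < b\<close> show False by simp
  qed
  obtain c0 where c0: "\<And>c'. c' \<ge> c0 \<Longrightarrow> ennreal (exp (- c')) \<le> return_weight P 1 0"
    and up: "\<And>h. h \<ge> M \<Longrightarrow> \<exists>c. ennreal (exp (- c)) \<le> return_weight P 2 h"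
    using return_weight_pos by blast
  have a3: "a3 \<ge> 0"
  proof (rule ccontr)
    assume "\<not> a3 \<ge> 0"
    then have n: "a3 < 0" by simp
    \<comment> \<open>The cost is taken so large that the functional is at most \<open>a3\<close>,
      which is negative.\<close>
    have "0 \<le> a1 + a3 * max c0 (1 - a1 / a3)" using nonneg[OF c0, of "max c0 (1 - a1 / a3)"] by simp
    also have "\<dots> \<le> a1 + a3 * (1 - a1 / a3)" using n by (intro add_left_mono mult_left_mono_neg) auto
    also have "\<dots> = a3" using n by (simp add: field_simps)
    finally show False using n by simp
  qed
  have z: "a1 * x + a2 * (1 - x) / 2 + a3 * (R + \<epsilon>) < 0"
    using ab(1) b by (simp add: a)
  show False
  proof (cases "a3 = 0")
    case True
    \<comment> \<open>The hyperplane is vertical. Both remaining coefficients are then nonnegative,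
      by \<open>[0]\<close> and by \<open>[h, 0]\<close> with h large, so the functional cannot be
      negative at the point.\<close>
    have "a1 \<ge> 0" using nonneg[OF c0, of c0] True by simp
    moreover have "a2 \<ge> 0"
    proof (rule ccontr)
      assume "\<not> a2 \<ge> 0"
      then have n: "a2 < 0" by simp
      obtain h :: nat where h: "real h > 2 * a1 / - a2" using reals_Archimedean2 by blast
      obtain c where "ennreal (exp (- c)) \<le> return_weight P 2 (max h M)" using up by force
      from nonneg[OF this] have "0 \<le> a1 * 2 + a2 * real (max h M)" using True by simp
      also have "\<dots> \<le> a1 * 2 + a2 * real h" using n by (intro add_left_mono mult_left_mono_neg) auto
      finally show False using h n by (simp add: field_simps)
    qed
    ultimately have "0 \<le> a1 * x + a2 * (1 - x) / 2" using x by (intro add_nonneg_nonneg divide_nonneg_pos mult_nonneg_nonneg) auto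
    with z True show False by simp
  next
    case False
    then have a3: "a3 > 0" using a3 by simp
    define \<mu> \<eta> where "\<mu> = - a2 / a3" and "\<eta> = - a1 / a3"
    have a12: "a1 = - (a3 * \<eta>)" "a2 = - (a3 * \<mu>)" using a3 by (simp_all add: \<mu>_def \<eta>_def)
    have "excursion_sum P \<mu> \<eta> 0 \<le> 1"
    proof (rule excursion_sum_le_1, rule ccontr)
      fix s w assume "\<not> return_weight P s w \<le> ennreal (exp (- (\<eta> * real s + \<mu> * real w)))"
      \<comment> \<open>Costs are real numbers, so a real r strictly between the two sides is
        chosen, and \<open>- ln r\<close> serves as cost.\<close>
      then obtain y where y: "ennreal (exp (- (\<eta> * real s + \<mu> * real w))) < y" "y < return_weight P s w"
        using dense by (metis not_le)
      then obtain r where r: "y = ennreal r" "r \<ge> 0" by (cases y) auto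
      have r1: "exp (- (\<eta> * real s + \<mu> * real w)) < r" using y(1) r by (simp add: ennreal_less_iff)
      have r0: "r > 0" using r1 exp_gt_zero[of "- (\<eta> * real s + \<mu> * real w)"] by linarith
      have "ennreal (exp (- (- ln r))) \<le> return_weight P s w" using y(2) r r0 by simp
      from nonneg[OF this] have "0 \<le> a3 * (- (\<eta> * real s + \<mu> * real w) - ln r)"
        unfolding a12 by (simp add: algebra_simps)
      then have "ln r \<le> - (\<eta> * real s + \<mu> * real w)" using a3 by (simp add: zero_le_mult_iff)
      then have "exp (ln r) \<le> exp (- (\<eta> * real s + \<mu> * real w))" by (subst exp_le_cancel_iff)
      then have "r \<le> exp (- (\<eta> * real s + \<mu> * real w))" using r0 by simp
      with r1 show False by simp
    qed
    from R[OF this] have "0 \<le> a3 * (R - (\<mu> * (1 - x) / 2 + \<eta> * x))" using a3 by simp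
    also have "\<dots> = a1 * x + a2 * (1 - x) / 2 + a3 * R"
      unfolding a12 by (simp add: field_simps)
    finally show False using z a3 \<epsilon> mult_pos_pos[OF a3 \<epsilon>] by (simp add: distrib_left)
  qed
qed

text \<open>A return path whose rescaled triple lies within d of the rate point is repeated
  \<open>n div q\<close> times. Approximation, rounding and the discrepancy between the hitting time
  and n move the walk by less than \<open>real n * e\<close>.\<close>

lemma local_lower_bound:
  assumes x: "0 \<le> x" "x \<le> 1" and e: "e > 0"
    and R: "\<And>\<mu> \<eta>. excursion_sum P \<mu> \<eta> 0 \<le> 1 \<Longrightarrow> \<mu> * (1 - x) / 2 + \<eta> * x \<le> R"
    and S: "\<And>y. \<bar>y - x\<bar> < e \<Longrightarrow> \<bar>y\<bar> \<le> 1 \<Longrightarrow> y \<in> S"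
  obtains K where "K > 0" "eventually (\<lambda>n. ennreal (K * exp (- (R + e) * real n)) \<le> averaged_prob P {X. real_of_int (X n) / real n \<in> S}) sequentially"
proof -
  \<comment> \<open>The error in the position is at most \<open>4 * (real n * d)\<close> plus the
    rounding term \<open>2 * real s + 2 * real w\<close>, which is below \<open>real n * d\<close>
    for n at least N.\<close>
  define d where "d = e / 5"
  have d: "d > 0" using e by (simp add: d_def)
  have "(x, (1 - x) / 2, R + d) \<in> closure (return_costs P)"
    using rate_point_in_closure[OF x d R] .
  then obtain y where y: "y \<in> return_costs P" "dist y (x, (1 - x) / 2, R + d) < d"
    using d unfolding closure_approachable by blast
  obtain s w c q where yq: "y = (real s / real q, real w / real q, c / real q)" "q \<ge> 1" "ennreal (exp (- c)) \<le> return_weight P s w"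
    using y(1) unfolding return_costs_def by blast
  have near: "\<bar>real s / real q - x\<bar> < d" "\<bar>real w / real q - (1 - x) / 2\<bar> < d" "\<bar>c / real q - (R + d)\<bar> < d"
  proof -
    let ?z = "(x, (1 - x) / 2, R + d)"
    have "dist (fst y) (fst ?z) < d" "dist (snd y) (snd ?z) < d"
      using dist_fst_le[of y ?z] dist_snd_le[of y ?z] y(2) by linarith+
    moreover from this(2) have "dist (fst (snd y)) (fst (snd ?z)) < d" "dist (snd (snd y)) (snd (snd ?z)) < d"
      using dist_fst_le[of "snd y" "snd ?z"] dist_snd_le[of "snd y" "snd ?z"] by linarith+
    ultimately show "\<bar>real s / real q - x\<bar> < d" "\<bar>real w / real q - (1 - x) / 2\<bar> < d" "\<bar>c / real q - (R + d)\<bar> < d"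
      by (auto simp: yq dist_real_def)
  qed
  define N where "N = nat \<lceil>(2 * real s + 2 * real w) / d\<rceil> + 1"
  show ?thesis
  proof (rule that)
    show "exp (- \<bar>c\<bar>) > 0" by simp
    show "eventually (\<lambda>n. ennreal (exp (- \<bar>c\<bar>) * exp (- (R + e) * real n)) \<le> averaged_prob P {X. real_of_int (X n) / real n \<in> S}) sequentially"
      using eventually_ge_at_top[of N]
    proof eventually_elim
      case (elim n)
      have n: "n > 0" using elim by (simp add: N_def)
      have "(2 * real s + 2 * real w) / d < real n" using elim unfolding N_def by linarith
      then have nd: "2 * real s + 2 * real w < real n * d" using d by (simp add: field_simps)
      define k where "k = n div q"
      have kq: "k * q \<le> n" "n < (k + 1) * q"
        unfolding k_def using yq(2) dividend_less_div_times[of q n] by (auto simp: algebra_simps)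
      have k1: "real k \<le> real n / real q" using of_nat_mono[OF kq(1), where 'a = real] yq(2) by (simp add: field_simps)
      have "real n < real ((k + 1) * q)" using kq(2) of_nat_less_iff by blast
      then have k2: "real n / real q - real k < 1" using yq(2) by (simp add: field_simps)
      have kn: "\<bar>real k - real n / real q\<bar> \<le> 1" using k1 k2 by linarith
      have kv: "\<bar>real k * v - real n * (v / real q)\<bar> \<le> \<bar>v\<bar>" for v
      proof -
        have "real k * v - real n * (v / real q) = (real k - real n / real q) * v" by (simp add: algebra_simps)
        then show ?thesis using mult_right_mono[OF kn, of "\<bar>v\<bar>"] by (simp add: abs_mult)
      qed
      have m1: "\<bar>real k * real s - real n * x\<bar> \<le> real s + real n * d"
      proof -
        have "\<bar>real n * (real s / real q) - real n * x\<bar> = real n * \<bar>real s / real q - x\<bar>"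
          unfolding right_diff_distrib[symmetric] abs_mult by simp
        also have "\<dots> \<le> real n * d" using near(1) by (intro mult_left_mono) auto
        finally show ?thesis using kv[of "real s"] by linarith
      qed
      have m2: "\<bar>real k * real w - real n * ((1 - x) / 2)\<bar> \<le> real w + real n * d"
      proof -
        have "\<bar>real n * (real w / real q) - real n * ((1 - x) / 2)\<bar> = real n * \<bar>real w / real q - (1 - x) / 2\<bar>"
          unfolding right_diff_distrib[symmetric] abs_mult by simp
        also have "\<dots> \<le> real n * d" using near(2) by (intro mult_left_mono) auto
        finally show ?thesis using kv[of "real w"] by linarith
      qed
      \<comment> \<open>The factor \<open>exp (- \<bar>c\<bar>)\<close> compensates for replacing n
        / q by its integer part, and \<open>c / real q\<close> exceeds R by less than
        \<open>2 * d\<close>.\<close>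
      have cost: "ennreal (exp (- \<bar>c\<bar>) * exp (- (R + e) * real n)) \<le> return_weight P (k * s) (k * w)"
      proof -
        have "c / real q \<le> R + e" using near(3) e unfolding d_def by linarith
        have "real k * c \<le> \<bar>c\<bar> + real n * (c / real q)" using kv[of c] by linarith
        also have "\<dots> \<le> \<bar>c\<bar> + real n * (R + e)" by (intro add_left_mono mult_left_mono) (fact, simp)
        finally have "exp (- \<bar>c\<bar>) * exp (- (R + e) * real n) \<le> exp (- c) ^ k"
          by (simp add: algebra_simps exp_add[symmetric] exp_of_nat_mult[symmetric])
        then have "ennreal (exp (- \<bar>c\<bar>) * exp (- (R + e) * real n)) \<le> ennreal (exp (- c)) ^ k"
          by (simp add: ennreal_power ennreal_leI)
        also have "\<dots> \<le> return_weight P s w ^ k" by (intro power_mono yq) auto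
        also have "\<dots> \<le> return_weight P (k * s) (k * w)" by (rule return_weight_power)
        finally show ?thesis .
      qed
      also have "\<dots> \<le> averaged_prob P {X. X n \<in> {v. real_of_int v / real n \<in> S}}"
        unfolding return_weight_def
      proof (rule averaged_prob_ge_paths[where m = "k * s" and w = "k * w", OF finite_return_paths])
        fix v :: int
        assume v: "\<bar>v - int (k * s)\<bar> \<le> \<bar>int n - int (k * s + 2 * (k * w))\<bar>" "\<bar>v\<bar> \<le> int n"
        have "real_of_int \<bar>v - int (k * s)\<bar> \<le> real_of_int \<bar>int n - int (k * s + 2 * (k * w))\<bar>"
          using v(1) by (simp only: of_int_le_iff)
        then have v': "\<bar>real_of_int v - real k * real s\<bar> \<le> \<bar>real n - (real k * real s + 2 * (real k * real w))\<bar>" by simp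
        \<comment> \<open>The distance between n and the hitting time, split by writing n as n x
          plus twice n (1 - x) / 2.\<close>
        have "\<bar>real n - (real k * real s + 2 * (real k * real w))\<bar> \<le> real s + 2 * real w + 3 * (real n * d)"
        proof -
          have "real n - (real k * real s + 2 * (real k * real w)) = - (real k * real s - real n * x) - 2 * (real k * real w - real n * ((1 - x) / 2))"
            by (simp add: field_simps)
          moreover have "\<bar>- a - 2 * b\<bar> \<le> \<bar>a\<bar> + 2 * \<bar>b\<bar>" for a b :: real by linarith
          ultimately have "\<bar>real n - (real k * real s + 2 * (real k * real w))\<bar>
            \<le> \<bar>real k * real s - real n * x\<bar> + 2 * \<bar>real k * real w - real n * ((1 - x) / 2)\<bar>" by (simp only:)
          also have "\<dots> \<le> (real s + real n * d) + 2 * (real w + real n * d)"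
            using m1 m2 by (intro add_mono mult_left_mono) auto
          also have "\<dots> = real s + 2 * real w + 3 * (real n * d)" by (simp add: algebra_simps)
          finally show ?thesis .
        qed
        note dist_le = order_trans[OF v' this]
        have "\<bar>real_of_int v - real n * x\<bar> \<le> \<bar>real_of_int v - real k * real s\<bar> + \<bar>real k * real s - real n * x\<bar>"
          by (rule order_trans[OF _ abs_triangle_ineq]) simp
        also have "\<dots> \<le> (real s + 2 * real w + 3 * (real n * d)) + (real s + real n * d)"
          by (intro add_mono dist_le m1)
        also have "\<dots> = 2 * real s + 2 * real w + 4 * (real n * d)" by simp
        finally have "\<bar>real_of_int v - real n * x\<bar> \<le> 2 * real s + 2 * real w + 4 * (real n * d)" .
        with nd have "\<bar>real_of_int v - real n * x\<bar> < real n * e" by (simp add: d_def)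
        moreover have "real_of_int v - real n * x = real n * (real_of_int v / real n - x)" using n by (simp add: field_simps)
        ultimately have "real n * \<bar>real_of_int v / real n - x\<bar> < real n * e" by (simp add: abs_mult)
        then have "\<bar>real_of_int v / real n - x\<bar> < e" using n by simp
        moreover have "\<bar>real_of_int v / real n\<bar> \<le> 1"
        proof -
          have "\<bar>real_of_int v\<bar> \<le> real n" using v(2) by linarith
          then show ?thesis using n by (simp add: abs_divide)
        qed
        ultimately show "v \<in> {v. real_of_int v / real n \<in> S}" using S by simp
      qed (auto simp: return_paths_def)
      finally show ?case by simp
    qed
  qed
qed

end

section \<open>Rate function, reflection and the large deviation principle\<close>

lemma elog_mono: "p \<le> q \<Longrightarrow> elog p \<le> elog q"
  by (cases p; cases q) (auto simp: elog_def ennreal_eq_0_iff top_unique)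

lemma elog_ennreal: "z > 0 \<Longrightarrow> elog (ennreal z) = ereal (ln z)"
  by (simp add: elog_def)

lemma elog_le_0_iff: "elog p \<le> 0 \<longleftrightarrow> p \<le> 1"
  by (cases p) (auto simp: elog_def ennreal_eq_0_iff top_unique)

lemma scaled_elog_exp:
  assumes "K > 0" "n > 0"
  shows "ereal (1 / real n) * elog (ennreal (K * exp (real n * r))) = ereal (ln K / real n + r)"
  using assms by (simp add: elog_ennreal ln_mult field_simps)

lemma ln_over_n_tendsto: "(\<lambda>n. ereal (ln K / real n + r)) \<longlonglongrightarrow> ereal r"
proof -
  have "(\<lambda>n. ln K / real n + r) \<longlonglongrightarrow> 0 + r"
    by (intro tendsto_add tendsto_const lim_const_over_n)
  then show ?thesis by (auto intro: tendsto_ereal)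
qed

lemma limsup_elog_le:
  assumes "K > 0" "\<And>n. n > 0 \<Longrightarrow> A n \<le> ennreal (K * exp (real n * r))"
  shows "limsup (\<lambda>n. ereal (1 / real n) * elog (A n)) \<le> ereal r"
proof -
  have "limsup (\<lambda>n. ereal (1 / real n) * elog (A n)) \<le> limsup (\<lambda>n. ereal (ln K / real n + r))"
  proof (rule Limsup_mono)
    show "eventually (\<lambda>n. ereal (1 / real n) * elog (A n) \<le> ereal (ln K / real n + r)) sequentially"
      using eventually_gt_at_top[of 0]
    proof eventually_elim
      case (elim n)
      have "ereal (1 / real n) * elog (A n) \<le> ereal (1 / real n) * elog (ennreal (K * exp (real n * r)))"
        using assms(2)[OF elim] by (intro ereal_mult_left_mono elog_mono) auto
      then show ?case by (simp only: scaled_elog_exp[OF assms(1) elim])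
    qed
  qed
  also have "\<dots> = ereal r"
    by (rule lim_imp_Limsup[OF sequentially_bot ln_over_n_tendsto])
  finally show ?thesis .
qed

lemma liminf_elog_ge:
  assumes "K > 0" "eventually (\<lambda>n. ennreal (K * exp (r * real n)) \<le> A n) sequentially"
  shows "ereal r \<le> liminf (\<lambda>n. ereal (1 / real n) * elog (A n))"
proof -
  have "ereal r = liminf (\<lambda>n. ereal (ln K / real n + r))"
    by (rule lim_imp_Liminf[OF sequentially_bot ln_over_n_tendsto, symmetric])
  also have "\<dots> \<le> liminf (\<lambda>n. ereal (1 / real n) * elog (A n))"
  proof (rule Liminf_mono)
    show "eventually (\<lambda>n. ereal (ln K / real n + r) \<le> ereal (1 / real n) * elog (A n)) sequentially"
      using assms(2) eventually_gt_at_top[of 0]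
    proof eventually_elim
      case (elim n)
      have "ereal (1 / real n) * elog (ennreal (K * exp (real n * r))) \<le> ereal (1 / real n) * elog (A n)"
        using elim by (intro ereal_mult_left_mono elog_mono) (auto simp: mult.commute)
      then show ?case by (simp only: scaled_elog_exp[OF assms(1) elim(2)])
    qed
  qed
  finally show ?thesis .
qed

section \<open>The rate function as a supremum over admissible pairs\<close>

context cookie_law
begin

text \<open>Multiplication by x turns \<open>(1 / x - 1) / 2\<close> into
  \<open>(1 - x) / 2\<close>. Comparison with an arbitrary bound L also covers infinite suprema: if
  no \<eta> is admissible for \<mu>, then \<open>Lambda_V\<close> is infinite and the condition is
  vacuous.\<close>

lemma I_X_le_iff:
  assumes x: "x > 0"
  shows "I_X P x \<le> L \<longleftrightarrow> (\<forall>\<mu> \<eta>. excursion_sum P \<mu> \<eta> 0 \<le> 1 \<longrightarrow> ereal (\<mu> * (1 - x) / 2 + \<eta> * x) \<le> L)"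
proof -
  let ?A = "\<lambda>\<mu>. {\<eta>. excursion_sum P \<mu> \<eta> 0 \<le> 1}"
  let ?y = "(1 / x - 1) / 2"
  have LV: "Lambda_V P \<mu> = - (SUP \<eta>\<in>?A \<mu>. ereal \<eta>)" for \<mu>
    by (simp add: Lambda_V_def Lambda_W_sigma_eq elog_le_0_iff)
  have "I_X P x \<le> L \<longleftrightarrow> ereal x * I_V P ?y \<le> L"
    using x by (simp add: I_X_def I_T_def)
  also have "\<dots> \<longleftrightarrow> I_V P ?y \<le> L / ereal x"
    using x by (simp add: ereal_le_divide_pos)
  also have "\<dots> \<longleftrightarrow> (\<forall>\<mu>. ereal (\<mu> * ?y) - Lambda_V P \<mu> \<le> L / ereal x)"
    by (simp add: I_V_def SUP_le_iff)
  also have "\<dots> \<longleftrightarrow> (\<forall>\<mu>. \<forall>\<eta>\<in>?A \<mu>. ereal (\<mu> * (1 - x) / 2 + \<eta> * x) \<le> L)"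
  proof (rule all_cong1)
    fix \<mu>
    have "ereal (\<mu> * ?y) - Lambda_V P \<mu> = (SUP \<eta>\<in>?A \<mu>. ereal \<eta>) + ereal (\<mu> * ?y)"
      unfolding LV minus_ereal_def ereal_uminus_uminus by (rule add.commute)
    then have "ereal (\<mu> * ?y) - Lambda_V P \<mu> \<le> L / ereal x \<longleftrightarrow> (SUP \<eta>\<in>?A \<mu>. ereal \<eta>) \<le> L / ereal x - ereal (\<mu> * ?y)"
      by (subst ereal_le_minus) auto
    also have "\<dots> \<longleftrightarrow> (\<forall>\<eta>\<in>?A \<mu>. ereal \<eta> \<le> L / ereal x - ereal (\<mu> * ?y))"
      by (simp add: SUP_le_iff)
    also have "\<dots> \<longleftrightarrow> (\<forall>\<eta>\<in>?A \<mu>. ereal (\<mu> * (1 - x) / 2 + \<eta> * x) \<le> L)"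
    proof (rule ball_cong[OF refl])
      fix \<eta>
      have "ereal \<eta> \<le> L / ereal x - ereal (\<mu> * ?y) \<longleftrightarrow> ereal (\<eta> + \<mu> * ?y) \<le> L / ereal x"
        by (simp add: ereal_le_minus)
      also have "\<dots> \<longleftrightarrow> ereal x * ereal (\<eta> + \<mu> * ?y) \<le> L"
        using x by (subst ereal_le_divide_pos) auto
      also have "ereal x * ereal (\<eta> + \<mu> * ?y) = ereal (\<mu> * (1 - x) / 2 + \<eta> * x)"
        using x by (simp add: field_simps)
      finally show "ereal \<eta> \<le> L / ereal x - ereal (\<mu> * ?y) \<longleftrightarrow> ereal (\<mu> * (1 - x) / 2 + \<eta> * x) \<le> L" .
    qed
    finally show "ereal (\<mu> * ?y) - Lambda_V P \<mu> \<le> L / ereal x \<longleftrightarrow> (\<forall>\<eta>\<in>?A \<mu>. ereal (\<mu> * (1 - x) / 2 + \<eta> * x) \<le> L)" .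
  qed
  finally show ?thesis by simp
qed

lemma excursion_sum_mono: "\<mu>' \<le> \<mu> \<Longrightarrow> excursion_sum P \<mu>' \<eta> v \<le> excursion_sum P \<mu> \<eta> v"
  unfolding excursion_sum_def tilted_def
  by (intro nn_integral_mono mult_left_mono ennreal_leI) (auto intro: mult_right_mono)

lemma upper_tail:
  assumes x: "0 < x" "x \<le> 1" and r: "ereal (- r) < I_X P x"
  obtains K where "K > 0" "\<And>n. n > 0 \<Longrightarrow> averaged_prob P {X. real_of_int (X n) / real n \<ge> x} \<le> ennreal (K * exp (real n * r))"
proof -
  have "\<not> I_X P x \<le> ereal (- r)" using r by simp
  then obtain \<mu> \<eta> where adm: "excursion_sum P \<mu> \<eta> 0 \<le> 1" and gt: "\<mu> * (1 - x) / 2 + \<eta> * x > - r"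
    unfolding I_X_le_iff[OF x(1)] by auto
  have "\<exists>\<mu>'<0. excursion_sum P \<mu>' \<eta> 0 \<le> 1 \<and> \<mu>' * (1 - x) / 2 + \<eta> * x > - r"
  proof (cases "\<mu> < 0")
    case False
    then have "\<mu> = 0" using excursion_sum_gt_1[of \<mu> \<eta>] adm by (metis linorder_neqE_linordered_idom not_le)
    \<comment> \<open>Minus the gap \<open>\<eta> * x + r\<close>. Because
      \<open>1 - x \<le> 1\<close>, the value drops by at most half of the gap, and lowering \<mu>
      does not increase \<open>excursion_sum\<close>.\<close>
    define \<mu>' where "\<mu>' = - (\<eta> * x + r)"
    have neg: "\<mu>' < 0" using gt \<open>\<mu> = 0\<close> by (simp add: \<mu>'_def)
    have "\<mu>' \<le> \<mu>' * (1 - x)" using neg x by (simp add: mult_le_cancel_left)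
    moreover have "\<eta> * x = - r - \<mu>'" by (simp add: \<mu>'_def)
    ultimately have "\<mu>' * (1 - x) / 2 + \<eta> * x > - r" using neg by linarith
    moreover have "excursion_sum P \<mu>' \<eta> 0 \<le> 1"
      using excursion_sum_mono[of \<mu>' \<mu> \<eta> 0] neg adm \<open>\<mu> = 0\<close> by auto
    ultimately show ?thesis using neg by blast
  qed (use adm gt in blast)
  then obtain \<mu>' where \<mu>': "\<mu>' < 0" "excursion_sum P \<mu>' \<eta> 0 \<le> 1" "\<mu>' * (1 - x) / 2 + \<eta> * x > - r" by blast
  \<comment> \<open>With the whole remaining gap used as slack the exponent becomes exactly
    r.\<close>
  define \<delta> where "\<delta> = \<mu>' * (1 - x) / 2 + \<eta> * x + r"
  have "\<delta> > 0" using \<mu>'(3) by (simp add: \<delta>_def)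
  obtain K where K: "K > 0" "\<And>n. n > 0 \<Longrightarrow> averaged_prob P {X. real_of_int (X n) / real n \<ge> x}
      \<le> ennreal (K * exp (real n * (- (\<mu>' * (1 - x) / 2 + \<eta> * x) + \<delta>)))"
    using upper_tail_bound[OF x \<mu>'(1,2) \<open>\<delta> > 0\<close>] by blast
  show ?thesis
    by (rule that[OF K(1)]) (use K(2) in \<open>simp add: \<delta>_def\<close>)
qed

lemma local_lower:
  assumes x: "0 \<le> x" "x \<le> 1" and e: "e > 0"
    and S: "\<And>y. \<bar>y - x\<bar> < e \<Longrightarrow> \<bar>y\<bar> \<le> 1 \<Longrightarrow> y \<in> S"
  shows "- I_X P x \<le> liminf (\<lambda>n. ereal (1 / real n) * elog (averaged_prob P {X. real_of_int (X n) / real n \<in> S}))"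
    (is "_ \<le> ?L")
proof (rule ccontr)
  assume "\<not> - I_X P x \<le> ?L"
  then have "?L < - I_X P x" by (simp only: not_le)
  from ereal_dense2[OF this] obtain c where c: "?L < ereal c" "ereal c < - I_X P x"
    by blast
  have "I_X P x < ereal (- c)" using c(2) ereal_less_uminus_reorder[of "ereal c"] by simp
  from ereal_dense2[OF this] obtain R where R: "I_X P x < ereal R" "ereal R < ereal (- c)"
    by blast
  \<comment> \<open>Makes R + e' at most -c while the neighbourhood stays within radius e.\<close>
  define e' where "e' = min e (- c - R)"
  have e': "e' > 0" "e' \<le> e" using e R(2) by (auto simp: e'_def)
  have adm: "\<mu> * (1 - x) / 2 + \<eta> * x \<le> R" if "excursion_sum P \<mu> \<eta> 0 \<le> 1" for \<mu> \<eta>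
  proof (cases "x = 0")
    case True
    \<comment> \<open>At 0 the rate is 0 by definition, and the variational bound reduces to
      \<open>\<mu> \<le> 0\<close>, which \<open>excursion_sum_gt_1\<close> provides.\<close>
    then have "R > 0" using R(1) by (simp add: I_X_def)
    moreover have "\<mu> \<le> 0" using excursion_sum_gt_1[of \<mu> \<eta>] that by (metis not_le)
    ultimately show ?thesis using True by simp
  next
    case False
    then have "x > 0" using x by simp
    have "I_X P x \<le> ereal R" using R(1) by simp
    then have "ereal (\<mu> * (1 - x) / 2 + \<eta> * x) \<le> ereal R"
      using I_X_le_iff[OF \<open>x > 0\<close>, of "ereal R"] that by blast
    then show ?thesis by simp
  qed
  obtain K where K: "K > 0" "eventually (\<lambda>n. ennreal (K * exp (- (R + e') * real n)) \<le> averaged_prob P {X. real_of_int (X n) / real n \<in> S}) sequentially"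
    by (rule local_lower_bound[OF x e'(1) adm S]) (use e'(2) in auto)
  have "ereal c \<le> ereal (- (R + e'))" by (simp add: e'_def)
  also have "\<dots> \<le> ?L" by (rule liminf_elog_ge[OF K])
  finally show False using c(1) by simp
qed

end

section \<open>Reflection of the walk and of the environment\<close>

lemma path_weight_cong:
  assumes "\<And>k. k \<le> n \<Longrightarrow> x k = y k"
  shows "path_weight \<omega> x n = path_weight \<omega> y n"
proof -
  have "visits x k = visits y k" if "k \<le> n" for k
    unfolding visits_def using assms that by (intro arg_cong[of _ _ card]) auto
  then show ?thesis
    unfolding path_weight_def using assms by (intro if_cong prod.cong conj_cong all_cong1 imp_cong) auto
qed

text \<open>\<open>mirror_env\<close> exchanges left and right steps without moving the sites, so it has to be combined with
  the reflection of the sites.\<close>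

lemma path_weight_reflect:
  "path_weight (mirror_env \<omega>) (\<lambda>k. - x k) n = path_weight (\<lambda>i. \<omega> (- i)) x n"
proof -
  have v: "visits (\<lambda>k. - x k) k = visits x k" for k by (simp add: visits_def)
  have p: "pmf (bernoulli_pmf (1 - p)) (\<not> b) = pmf (bernoulli_pmf p) b" for p b
    by (auto simp: pmf_bernoulli_clamp min_def max_def)
  have nn: "(\<forall>k<n. - x (Suc k) = - x k + 1 \<or> - x (Suc k) = - x k - 1) \<longleftrightarrow> (\<forall>k<n. x (Suc k) = x k + 1 \<or> x (Suc k) = x k - 1)"
    by (intro all_cong1 imp_cong refl) auto
  have "(\<Prod>k<n. ennreal (pmf (bernoulli_pmf (mirror_env \<omega> (- x k) (visits x k))) (- x (Suc k) = - x k + 1)))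
    = (\<Prod>k<n. ennreal (pmf (bernoulli_pmf (\<omega> (- x k) (visits x k))) (x (Suc k) = x k + 1)))"
    if "\<forall>k<n. x (Suc k) = x k + 1 \<or> x (Suc k) = x k - 1"
  proof (intro prod.cong refl)
    fix k assume "k \<in> {..<n}"
    then have "x (Suc k) = x k + 1 \<or> x (Suc k) = x k - 1" using that by auto
    then have "(- x (Suc k) = - x k + 1) = (\<not> (x (Suc k) = x k + 1))" by auto
    moreover have "mirror_env \<omega> (- x k) (visits x k) = 1 - \<omega> (- x k) (visits x k)"
      using visits_pos[of x k] by (simp add: mirror_env_def)
    ultimately show "ennreal (pmf (bernoulli_pmf (mirror_env \<omega> (- x k) (visits x k))) (- x (Suc k) = - x k + 1))
      = ennreal (pmf (bernoulli_pmf (\<omega> (- x k) (visits x k))) (x (Suc k) = x k + 1))"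
      by (simp only: p)
  qed
  then show ?thesis
    unfolding path_weight_def v nn neg_equal_0_iff_equal
    by (cases "\<forall>k<n. x (Suc k) = x k + 1 \<or> x (Suc k) = x k - 1") (simp_all only: simp_thms if_False)
qed

lemma quenched_law_reflect:
  "emeasure (quenched_law (mirror_env \<omega>)) {X. X n \<in> uminus ` S} = emeasure (quenched_law (\<lambda>i. \<omega> (- i))) {X. X n \<in> S}"
proof -
  let ?I = "\<lambda>S. {l. length l = Suc n \<and> l ! n \<in> S}"
  have bij: "bij_betw (map uminus) (?I S) (?I (uminus ` S))"
    by (rule bij_betw_byWitness[where f' = "map uminus"]) (auto simp: comp_def image_iff)
  have "emeasure (quenched_law (mirror_env \<omega>)) {X. X n \<in> uminus ` S}
    = (\<integral>\<^sup>+l. path_weight (mirror_env \<omega>) (\<lambda>k. map uminus l ! k) n \<partial>count_space (?I S))"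
    unfolding quenched_law_sum by (rule nn_integral_bij_count_space[OF bij, symmetric])
  also have "\<dots> = (\<integral>\<^sup>+l. path_weight (\<lambda>i. \<omega> (- i)) (\<lambda>k. l ! k) n \<partial>count_space (?I S))"
  proof (intro nn_integral_cong)
    fix l assume "l \<in> space (count_space (?I S))"
    then have len: "length l = Suc n" by simp
    have "path_weight (mirror_env \<omega>) (\<lambda>k. map uminus l ! k) n = path_weight (mirror_env \<omega>) (\<lambda>k. - (l ! k)) n"
      using len by (intro path_weight_cong) simp
    then show "path_weight (mirror_env \<omega>) (\<lambda>k. map uminus l ! k) n = path_weight (\<lambda>i. \<omega> (- i)) (\<lambda>k. l ! k) n"
      by (simp only: path_weight_reflect)
  qed
  also have "\<dots> = emeasure (quenched_law (\<lambda>i. \<omega> (- i))) {X. X n \<in> S}"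
    by (rule quenched_law_sum[symmetric])
  finally show ?thesis .
qed

lemma measurable_cookie_env: "j \<in> {1..} \<Longrightarrow> (\<lambda>\<omega>. \<omega> i j) \<in> borel_measurable env_space"
  by (rule measurable_compose[OF measurable_stack measurable_cookie])

text \<open>The probability is a countable sum of path weights, each a finite product of functions
  of single cookies; the sum is treated as an integral with the environment as parameter.\<close>

lemma measurable_quenched_law: "(\<lambda>\<omega>. emeasure (quenched_law \<omega>) {X. X n \<in> S}) \<in> borel_measurable env_space"
proof -
  let ?I = "{l :: int list. length l = Suc n \<and> l ! n \<in> S}"
  interpret sigma_finite_measure "count_space ?I"
    by (rule sigma_finite_measure_count_space_countable) (rule countableI_type)
  have w: "(\<lambda>\<omega>. path_weight \<omega> x n) \<in> borel_measurable env_space" for x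
  proof -
    have "(\<lambda>\<omega>. \<Prod>k<n. ennreal (pmf (bernoulli_pmf (\<omega> (x k) (visits x k))) (x (Suc k) = x k + 1))) \<in> borel_measurable env_space"
    proof (intro borel_measurable_prod_ennreal)
      fix k
      have "visits x k \<in> {1..}" using visits_pos by simp
      from measurable_cookie_env[OF this, of "x k"]
      show "(\<lambda>\<omega>. ennreal (pmf (bernoulli_pmf (\<omega> (x k) (visits x k))) (x (Suc k) = x k + 1))) \<in> borel_measurable env_space"
        unfolding pmf_bernoulli_clamp by measurable
    qed
    then show ?thesis unfolding path_weight_def by (cases "x 0 = 0 \<and> (\<forall>k<n. x (Suc k) = x k + 1 \<or> x (Suc k) = x k - 1)") auto
  qed
  have "(\<lambda>(l, \<omega>). path_weight \<omega> (\<lambda>k. l ! k) n) \<in> borel_measurable (count_space ?I \<Otimes>\<^sub>M env_space)"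
    using w by (intro measurable_pair_measure_countable1 countableI_type) auto
  then have "(\<lambda>(\<omega>, l). path_weight \<omega> (\<lambda>k. l ! k) n) \<in> borel_measurable (env_space \<Otimes>\<^sub>M count_space ?I)"
    by (subst measurable_pair_swap_iff) simp
  then show ?thesis
    unfolding quenched_law_sum by (intro borel_measurable_nn_integral) simp
qed

definition flip_stack :: "(nat \<Rightarrow> real) \<Rightarrow> nat \<Rightarrow> real" where
  "flip_stack c = (\<lambda>j\<in>{1..}. 1 - c j)"

lemma mirror_env_eq: "mirror_env \<omega> = (\<lambda>i. flip_stack (\<omega> i))"
  by (simp add: mirror_env_def flip_stack_def)

lemma measurable_flip_stack: "flip_stack \<in> measurable cookie_space cookie_space"
proof -
  have "(\<lambda>c. \<lambda>j\<in>{1..}. 1 - c j) \<in> measurable cookie_space (PiM {1..} (\<lambda>_. restrict_space borel {0..1}))"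
  proof (rule measurable_restrict)
    fix j :: nat assume j: "j \<in> {1..}"
    show "(\<lambda>c. 1 - c j) \<in> measurable cookie_space (restrict_space borel {0..1})"
    proof (rule measurable_restrict_space2)
      show "(\<lambda>c. 1 - c j) \<in> space cookie_space \<rightarrow> {0..1}"
        using j by (auto simp: cookie_space_def space_PiM space_restrict_space PiE_iff)
      show "(\<lambda>c. 1 - c j) \<in> borel_measurable cookie_space"
        using measurable_cookie[OF j] by measurable
    qed
  qed
  then show ?thesis unfolding flip_stack_def[abs_def] cookie_space_def .
qed

lemma measurable_mirror_env: "mirror_env \<in> measurable env_space env_space"
proof -
  have "(\<lambda>\<omega> i. flip_stack (\<omega> i)) \<in> measurable env_space (PiM UNIV (\<lambda>_. cookie_space))"
    by (rule measurable_abs_UNIV) (rule measurable_compose[OF measurable_stack measurable_flip_stack])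
  then show ?thesis unfolding mirror_env_eq[abs_def] env_space_def .
qed

lemma (in prob_space) indep_vars_reindex:
  assumes "indep_vars N X (g ` I)" "inj_on g I"
  shows "indep_vars (\<lambda>i. N (g i)) (\<lambda>i. X (g i)) I"
proof -
  have "indep_sets F (g ` I) \<Longrightarrow> indep_sets (\<lambda>i. F (g i)) I" for F
  proof (rule indep_setsI)
    fix A J assume F: "indep_sets F (g ` I)" and J: "J \<noteq> {}" "J \<subseteq> I" "finite J" "\<forall>j\<in>J. A j \<in> F (g j)"
    have inj: "inj_on g J" using assms(2) J(2) by (rule inj_on_subset)
    let ?h = "the_inv_into J g"
    have h: "?h (g j) = j" if "j \<in> J" for j using that inj by (simp add: the_inv_into_f_f)
    have "prob (\<Inter>i\<in>g ` J. A (?h i)) = (\<Prod>i\<in>g ` J. prob (A (?h i)))"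
      using J h by (intro indep_setsD[OF F]) auto
    then show "prob (\<Inter>j\<in>J. A j) = (\<Prod>j\<in>J. prob (A j))"
      using h by (simp add: prod.reindex[OF inj])
  qed (auto simp: indep_sets_def)
  then show ?thesis
    using assms(1) unfolding indep_vars_def by auto
qed

text \<open>An environment is a function on all integers, so the joint law of its stacks is P
  itself, and independence makes it a product of identical factors.\<close>

lemma law_eq_PiM:
  fixes P :: "env measure"
  assumes "prob_space P" "sets P = sets env_space"
    and indep: "prob_space.indep_vars P (\<lambda>_. cookie_space) (\<lambda>(i::int) \<omega>. \<omega> i) UNIV"
    and ident: "\<And>i. distr P cookie_space (\<lambda>\<omega>. \<omega> i) = distr P cookie_space (\<lambda>\<omega>. \<omega> 0)"
  shows "P = PiM UNIV (\<lambda>_. distr P cookie_space (\<lambda>\<omega>. \<omega> 0))"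
proof -
  interpret prob_space P by fact
  have rv: "random_variable cookie_space (\<lambda>\<omega>. \<omega> i)" for i
    unfolding measurable_cong_sets[OF assms(2) refl] by (rule measurable_stack)
  have "distr P (PiM UNIV (\<lambda>_. cookie_space)) (\<lambda>\<omega>. \<lambda>i\<in>UNIV. \<omega> i) = PiM UNIV (\<lambda>i. distr P cookie_space (\<lambda>\<omega>. \<omega> i))"
    using indep indep_vars_iff_distr_eq_PiM[where I = UNIV and X = "\<lambda>i \<omega>. \<omega> i" and M' = "\<lambda>_. cookie_space"] rv by simp
  moreover have "distr P (PiM UNIV (\<lambda>_. cookie_space)) (\<lambda>\<omega>. \<lambda>i\<in>UNIV. \<omega> i) = P"
    using assms(2) by (simp add: env_space_def distr_id2 restrict_UNIV)
  moreover have "(\<lambda>i. distr P cookie_space (\<lambda>\<omega>. \<omega> i)) = (\<lambda>_. distr P cookie_space (\<lambda>\<omega>. \<omega> 0))"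
    by (rule ext) (rule ident)
  ultimately show ?thesis by metis
qed

text \<open>A product of identical factors is invariant under the injective reindexing of i by -
  i.\<close>

lemma distr_reflect_sites:
  fixes P :: "env measure"
  assumes "prob_space P" "sets P = sets env_space"
    and "prob_space.indep_vars P (\<lambda>_. cookie_space) (\<lambda>(i::int) \<omega>. \<omega> i) UNIV"
    and "\<And>i. distr P cookie_space (\<lambda>\<omega>. \<omega> i) = distr P cookie_space (\<lambda>\<omega>. \<omega> 0)"
  shows "distr P P (\<lambda>\<omega> i. \<omega> (- i)) = P"
proof -
  interpret prob_space P by fact
  let ?\<nu> = "distr P cookie_space (\<lambda>\<omega>. \<omega> 0)"
  have "prob_space ?\<nu>"
    by (rule prob_space_distr, unfold measurable_cong_sets[OF assms(2) refl], rule measurable_stack)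
  then have "distr (PiM UNIV (\<lambda>_. ?\<nu>)) (PiM UNIV (\<lambda>_. ?\<nu>)) (\<lambda>\<omega>. \<lambda>i\<in>UNIV. \<omega> (- i)) = PiM UNIV (\<lambda>_ :: int. ?\<nu>)"
    by (intro distr_PiM_reindex) (auto intro: injI)
  then have "distr P P (\<lambda>\<omega>. \<lambda>i\<in>UNIV. \<omega> (- i)) = P"
    unfolding law_eq_PiM[OF assms, symmetric] .
  then show ?thesis by (simp only: restrict_UNIV)
qed

text \<open>By \<open>quenched_law_reflect\<close> a negated walk in the mirrored environment
  behaves like a walk in the environment with reflected sites, whose law is again P.\<close>

lemma averaged_prob_mirror:
  fixes P :: "env measure"
  assumes "prob_space P" and sets: "sets P = sets env_space"
    and "prob_space.indep_vars P (\<lambda>_. cookie_space) (\<lambda>(i::int) \<omega>. \<omega> i) UNIV"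
    and "\<And>i. distr P cookie_space (\<lambda>\<omega>. \<omega> i) = distr P cookie_space (\<lambda>\<omega>. \<omega> 0)"
  shows "averaged_prob (mirror_law P) {X. X n \<in> uminus ` S} = averaged_prob P {X. X n \<in> S}"
proof -
  let ?q = "\<lambda>\<omega>. emeasure (quenched_law \<omega>) {X. X n \<in> S}"
  have mm: "mirror_env \<in> measurable P env_space"
    unfolding measurable_cong_sets[OF sets refl] by (rule measurable_mirror_env)
  have rm: "(\<lambda>\<omega> i. \<omega> (- i)) \<in> measurable P P"
    unfolding measurable_cong_sets[OF sets sets] unfolding env_space_def
    by (rule measurable_abs_UNIV) (rule measurable_component_singleton, simp)
  have "averaged_prob (mirror_law P) {X. X n \<in> uminus ` S}
     = (\<integral>\<^sup>+\<omega>. emeasure (quenched_law (mirror_env \<omega>)) {X. X n \<in> uminus ` S} \<partial>P)"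
    unfolding averaged_prob_def mirror_law_def
    by (rule nn_integral_distr[OF mm]) (simp add: measurable_quenched_law)
  also have "\<dots> = (\<integral>\<^sup>+\<omega>. ?q (\<lambda>i. \<omega> (- i)) \<partial>P)"
    by (simp only: quenched_law_reflect)
  also have "\<dots> = (\<integral>\<^sup>+\<omega>. ?q \<omega> \<partial>distr P P (\<lambda>\<omega> i. \<omega> (- i)))"
    by (rule nn_integral_distr[OF rm, symmetric])
      (simp add: measurable_cong_sets[OF sets refl] measurable_quenched_law)
  also have "\<dots> = averaged_prob P {X. X n \<in> S}"
    unfolding distr_reflect_sites[OF assms] averaged_prob_def ..
  finally show ?thesis .
qed

lemma iid_nn_integral_prod:
  fixes P :: "env measure" and g :: "nat \<Rightarrow> int" and f :: "nat \<Rightarrow> (nat \<Rightarrow> real) \<Rightarrow> ennreal"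
  assumes "prob_space P" and sets: "sets P = sets env_space"
    and indep: "prob_space.indep_vars P (\<lambda>_. cookie_space) (\<lambda>(i::int) \<omega>. \<omega> i) UNIV"
    and ident: "\<And>i. distr P cookie_space (\<lambda>\<omega>. \<omega> i) = distr P cookie_space (\<lambda>\<omega>. \<omega> 0)"
    and g: "inj_on g {..<n}" and f: "\<And>k. k < n \<Longrightarrow> f k \<in> borel_measurable cookie_space"
  shows "(\<integral>\<^sup>+\<omega>. (\<Prod>k<n. f k (\<omega> (g k))) \<partial>P) = (\<Prod>k<n. \<integral>\<^sup>+\<omega>. f k (\<omega> 0) \<partial>P)"
proof -
  interpret prob_space P by fact
  have rv: "random_variable cookie_space (\<lambda>\<omega>. \<omega> i)" for i
    unfolding measurable_cong_sets[OF sets refl] by (rule measurable_stack)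
  have "indep_vars (\<lambda>_. cookie_space) (\<lambda>i \<omega>. \<omega> i) (g ` {..<n})"
    using indep by (rule indep_vars_subset) simp
  from indep_vars_reindex[OF this g] have "indep_vars (\<lambda>_. cookie_space) (\<lambda>k \<omega>. \<omega> (g k)) {..<n}" .
  from indep_vars_compose2[OF this, of f "\<lambda>_. borel"] f
  have "indep_vars (\<lambda>_. borel) (\<lambda>k \<omega>. f k (\<omega> (g k))) {..<n}" by simp
  then have "(\<integral>\<^sup>+\<omega>. (\<Prod>k<n. f k (\<omega> (g k))) \<partial>P) = (\<Prod>k<n. \<integral>\<^sup>+\<omega>. f k (\<omega> (g k)) \<partial>P)"
    by (intro indep_vars_nn_integral) auto
  also have "\<dots> = (\<Prod>k<n. \<integral>\<^sup>+\<omega>. f k (\<omega> 0) \<partial>P)"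
  proof (intro prod.cong refl)
    fix k assume "k \<in> {..<n}"
    then have m: "f k \<in> borel_measurable cookie_space" using f by simp
    have eq: "(\<integral>\<^sup>+\<omega>. f k (\<omega> i) \<partial>P) = (\<integral>\<^sup>+c. f k c \<partial>distr P cookie_space (\<lambda>\<omega>. \<omega> i))" for i
      using m by (intro nn_integral_distr[symmetric] rv) simp
    show "(\<integral>\<^sup>+\<omega>. f k (\<omega> (g k)) \<partial>P) = (\<integral>\<^sup>+\<omega>. f k (\<omega> 0) \<partial>P)"
      unfolding eq[of "g k"] eq[of 0] ident[of "g k"] ..
  qed
  finally show ?thesis .
qed

lemma nn_integral_pos_of_integral_pos:
  assumes [measurable]: "f \<in> borel_measurable M" and "AE x in M. 0 \<le> f x" "(\<integral>x. f x \<partial>M) > (0::real)"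
  shows "(\<integral>\<^sup>+x. ennreal (f x) \<partial>M) > 0"
proof (rule ccontr)
  assume "\<not> ?thesis"
  then have "(\<integral>\<^sup>+x. ennreal (f x) \<partial>M) = 0" by simp
  then have "AE x in M. ennreal (f x) = 0" by (subst (asm) nn_integral_0_iff_AE) auto
  with assms(2) have "AE x in M. f x = 0" by eventually_elim (auto simp: ennreal_eq_0_iff)
  then have "(\<integral>x. f x \<partial>M) = 0" by (rule integral_eq_zero_AE)
  with assms(3) show False by simp
qed

text \<open>Mirroring exchanges the two conditions of (A3), fixes the value 1/2 and acts on every
  stack separately through \<open>flip_stack\<close>, so that factorization over distinct sites
  survives.\<close>

lemma cookie_law_of_assms:
  fixes P :: "env measure" and M :: nat
  assumes P: "prob_space P" "sets P = sets env_space"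
    and A1: "AE \<omega> in P. \<forall>i. \<forall>j>M. \<omega> i j = 1 / 2"
    and A2: "prob_space.indep_vars P (\<lambda>_. cookie_space) (\<lambda>(i::int) \<omega>. \<omega> i) UNIV"
      "\<And>i. distr P cookie_space (\<lambda>\<omega>. \<omega> i) = distr P cookie_space (\<lambda>\<omega>. \<omega> 0)"
    and A3: "(\<integral>\<omega>. (\<Prod>j=1..M. \<omega> 0 j) \<partial>P) > 0" "(\<integral>\<omega>. (\<Prod>j=1..M. 1 - \<omega> 0 j) \<partial>P) > 0"
  shows "cookie_law P M" "cookie_law (mirror_law P) M"
proof -
  have m01: "AE \<omega> in P. \<forall>j\<ge>1. 0 \<le> \<omega> 0 j \<and> \<omega> 0 j \<le> 1"
    using AE_space sets_eq_imp_space_eq[OF P(2)] space_env_01 by (auto elim!: eventually_mono)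
  have [measurable]: "(\<lambda>\<omega>. \<omega> 0 j) \<in> borel_measurable P" if "j \<in> {1..M}" for j
    unfolding measurable_cong_sets[OF P(2) refl] using that by (intro measurable_cookie_env) auto
  have pos: "(\<integral>\<^sup>+\<omega>. (\<Prod>j=1..M. ennreal (f (\<omega> 0 j))) \<partial>P) > 0"
    if f: "(\<integral>\<omega>. (\<Prod>j=1..M. f (\<omega> 0 j)) \<partial>P) > 0" "\<And>x. 0 \<le> x \<Longrightarrow> x \<le> 1 \<Longrightarrow> 0 \<le> f x" "f \<in> borel_measurable borel" for f :: "real \<Rightarrow> real"
  proof -
    note f(3)[measurable]
    have "(\<integral>\<^sup>+\<omega>. ennreal (\<Prod>j=1..M. f (\<omega> 0 j)) \<partial>P) > 0"
    proof (rule nn_integral_pos_of_integral_pos[OF _ _ f(1)])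
      show "(\<lambda>\<omega>. \<Prod>j=1..M. f (\<omega> 0 j)) \<in> borel_measurable P" by measurable
      show "AE \<omega> in P. 0 \<le> (\<Prod>j=1..M. f (\<omega> 0 j))"
        using m01 by eventually_elim (auto intro!: prod_nonneg f(2))
    qed
    also have "(\<integral>\<^sup>+\<omega>. ennreal (\<Prod>j=1..M. f (\<omega> 0 j)) \<partial>P) = (\<integral>\<^sup>+\<omega>. (\<Prod>j=1..M. ennreal (f (\<omega> 0 j))) \<partial>P)"
      using m01 by (intro nn_integral_cong_AE, eventually_elim) (auto intro!: prod_ennreal[symmetric] f(2))
    finally show ?thesis .
  qed
  have s: "(\<integral>\<^sup>+\<omega>. (\<Prod>j=1..M. ennreal (\<omega> 0 j)) \<partial>P) > 0"
    using pos[of "\<lambda>x. x"] A3(1) by simp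
  have t: "(\<integral>\<^sup>+\<omega>. (\<Prod>j=1..M. ennreal (1 - \<omega> 0 j)) \<partial>P) > 0"
    using pos[of "\<lambda>x. 1 - x"] A3(2) by simp
  note iid = iid_nn_integral_prod[OF P A2]
  show "cookie_law P M"
    by (rule cookie_law.intro[OF P A1 iid s t])
  have mm: "mirror_env \<in> measurable P env_space"
    unfolding measurable_cong_sets[OF P(2) refl] by (rule measurable_mirror_env)
  have flip: "(\<Prod>j=1..M. ennreal (flip_stack c j)) = (\<Prod>j=1..M. ennreal (1 - c j))"
    "(\<Prod>j=1..M. ennreal (1 - flip_stack c j)) = (\<Prod>j=1..M. ennreal (c j))" for c
    by (auto simp: flip_stack_def intro!: prod.cong)
  have int: "(\<integral>\<^sup>+\<omega>. h (\<omega> i) \<partial>mirror_law P) = (\<integral>\<^sup>+\<omega>. h (flip_stack (\<omega> i)) \<partial>P)"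
    if "h \<in> borel_measurable cookie_space" for h :: "_ \<Rightarrow> ennreal" and i
    unfolding mirror_law_def using measurable_compose[OF measurable_stack that]
    by (subst nn_integral_distr[OF mm]) (simp_all add: mirror_env_eq)
  show "cookie_law (mirror_law P) M"
  proof (rule cookie_law.intro)
    show "prob_space (mirror_law P)"
      unfolding mirror_law_def by (rule prob_space.prob_space_distr[OF P(1) mm])
    show "sets (mirror_law P) = sets env_space" by (simp add: mirror_law_def)
    show "AE \<omega> in mirror_law P. \<forall>i. \<forall>j>M. \<omega> i j = 1 / 2"
    proof -
      have [measurable]: "(\<lambda>\<omega>. \<omega> i (Suc j)) \<in> borel_measurable env_space" for i j
        by (rule measurable_cookie_env) simp
      \<comment> \<open>Written with \<open>Suc j\<close> so that every position mentioned is a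
        genuine coordinate of the stack, as measurability requires.\<close>
      have "AE \<omega> in mirror_law P. \<forall>i j. Suc j > M \<longrightarrow> \<omega> i (Suc j) = 1 / 2"
        unfolding mirror_law_def
      proof (subst AE_distr_iff[OF mm])
        show "AE \<omega> in P. \<forall>i j. M < Suc j \<longrightarrow> mirror_env \<omega> i (Suc j) = 1 / 2"
          using A1 by eventually_elim (auto simp: mirror_env_def)
      qed measurable
      then show ?thesis
        by eventually_elim (metis Suc_pred gr_implies_not0 neq0_conv)
    qed
    show "0 < (\<integral>\<^sup>+\<omega>. (\<Prod>j=1..M. ennreal (\<omega> 0 j)) \<partial>mirror_law P)"
    proof -
      have "(\<lambda>c. \<Prod>j=1..M. ennreal (c j)) \<in> borel_measurable cookie_space"
        by (intro borel_measurable_prod_ennreal measurable_compose[OF measurable_cookie measurable_ennreal]) auto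
      from int[OF this, of 0] show ?thesis using t by (simp only: flip)
    qed
    show "0 < (\<integral>\<^sup>+\<omega>. (\<Prod>j=1..M. ennreal (1 - \<omega> 0 j)) \<partial>mirror_law P)"
    proof -
      have "(\<lambda>c. \<Prod>j=1..M. ennreal (1 - c j)) \<in> borel_measurable cookie_space"
        by (intro borel_measurable_prod_ennreal measurable_compose[OF borel_measurable_diff[OF borel_measurable_const measurable_cookie] measurable_ennreal]) auto
      from int[OF this, of 0] show ?thesis using s by (simp only: flip)
    qed
    fix g :: "nat \<Rightarrow> int" and f :: "nat \<Rightarrow> (nat \<Rightarrow> real) \<Rightarrow> ennreal" and n
    assume g: "inj_on g {..<n}" and f: "\<And>k. k < n \<Longrightarrow> f k \<in> borel_measurable cookie_space"
    have "(\<lambda>\<omega>. \<Prod>k<n. f k (\<omega> (g k))) \<in> borel_measurable env_space"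
      using f by (intro borel_measurable_prod_ennreal measurable_compose[OF measurable_stack]) auto
    then have "(\<integral>\<^sup>+\<omega>. (\<Prod>k<n. f k (\<omega> (g k))) \<partial>mirror_law P) = (\<integral>\<^sup>+\<omega>. (\<Prod>k<n. f k (flip_stack (\<omega> (g k)))) \<partial>P)"
      unfolding mirror_law_def by (subst nn_integral_distr[OF mm]) (simp_all add: mirror_env_eq)
    also have "\<dots> = (\<Prod>k<n. \<integral>\<^sup>+\<omega>. f k (flip_stack (\<omega> 0)) \<partial>P)"
      using f by (intro iid[OF g, where f = "\<lambda>k c. f k (flip_stack c)"] measurable_compose[OF measurable_flip_stack]) auto
    also have "\<dots> = (\<Prod>k<n. \<integral>\<^sup>+\<omega>. f k (\<omega> 0) \<partial>mirror_law P)"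
      using f by (intro prod.cong refl int[symmetric]) auto
    finally show "(\<integral>\<^sup>+\<omega>. (\<Prod>k<n. f k (\<omega> (g k))) \<partial>mirror_law P) = (\<Prod>k<n. \<integral>\<^sup>+\<omega>. f k (\<omega> 0) \<partial>mirror_law P)" .
  qed
qed

section \<open>Closed sets and the large deviation principle\<close>

context cookie_law
begin

lemma measurable_quenched_P: "(\<lambda>\<omega>. emeasure (quenched_law \<omega>) {X. X n \<in> S}) \<in> borel_measurable P"
  unfolding measurable_cong_sets[OF sets_P refl] by (rule measurable_quenched_law)

lemma sets_quenched_coordinate: "{X. X n \<in> S} \<in> sets (quenched_law \<omega>)"
  using emeasure_path_decomp(1)[where f = "\<lambda>X. X", OF sets_quenched_path, of \<omega> n S]
  by (simp add: space_quenched_law)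

lemma averaged_prob_mono:
  "S \<subseteq> T \<Longrightarrow> averaged_prob P {X. X n \<in> S} \<le> averaged_prob P {X. X n \<in> T}"
  unfolding averaged_prob_def
  by (intro nn_integral_mono emeasure_mono sets_quenched_coordinate) auto

lemma averaged_prob_Un_le:
  "averaged_prob P {X. X n \<in> S \<union> T} \<le> averaged_prob P {X. X n \<in> S} + averaged_prob P {X. X n \<in> T}"
proof -
  have eq: "{X. X n \<in> S \<union> T} = {X. X n \<in> S} \<union> {X :: nat \<Rightarrow> int. X n \<in> T}" by auto
  have "averaged_prob P {X. X n \<in> S \<union> T}
    \<le> (\<integral>\<^sup>+\<omega>. emeasure (quenched_law \<omega>) {X. X n \<in> S} + emeasure (quenched_law \<omega>) {X. X n \<in> T} \<partial>P)"
    unfolding averaged_prob_def eq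
    by (intro nn_integral_mono emeasure_subadditive sets_quenched_coordinate)
  also have "\<dots> = averaged_prob P {X. X n \<in> S} + averaged_prob P {X. X n \<in> T}"
    unfolding averaged_prob_def by (intro nn_integral_add measurable_quenched_P)
  finally show ?thesis .
qed

lemma averaged_prob_le_1: "averaged_prob P A \<le> 1"
proof -
  have "averaged_prob P A \<le> (\<integral>\<^sup>+\<omega>. 1 \<partial>P)"
    unfolding averaged_prob_def
    by (intro nn_integral_mono prob_space.emeasure_le_1 prob_space_quenched_law)
  also have "\<dots> = 1" using prob_space.emeasure_space_1[OF prob_space_P] by simp
  finally show ?thesis .
qed

text \<open>The positive part of F has a least element \<open>b > 0\<close>, since F is closed and
  omits 0. It therefore lies in the half-line starting at b, and one tail estimate at b covers
  it.\<close>

lemma closed_positive_part: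
  assumes F: "closed F" "F \<subseteq> {-1..1}" "0 \<notin> F"
    and r: "\<And>x. x \<in> F \<Longrightarrow> x > 0 \<Longrightarrow> ereal (- r) < I_X P x"
  shows "\<exists>K>0. \<forall>n>0. averaged_prob P {X. real_of_int (X n) / real n \<in> F \<inter> {0<..}} \<le> ennreal (K * exp (real n * r))"
proof (cases "F \<inter> {0..} = {}")
  case True
  then have "F \<inter> {0<..} = {}" by auto
  then show ?thesis by (intro exI[of _ 1]) (simp add: averaged_prob_def)
next
  case False
  \<comment> \<open>The closed half-line \<open>{0..}\<close> is used so that the infimum is
    attained; that it differs from 0 follows afterwards.\<close>
  define b where "b = Inf (F \<inter> {0..})"
  have bdd: "bdd_below (F \<inter> {0..})" by (rule bdd_belowI[of _ 0]) auto
  have "b \<in> F \<inter> {0..}"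
    unfolding b_def using False F(1) bdd by (intro closed_contains_Inf closed_Int) auto
  then have b: "b \<in> F" "0 < b" "b \<le> 1" using F(2,3) by (auto simp: less_le)
  obtain K where K: "K > 0" "\<And>n. n > 0 \<Longrightarrow> averaged_prob P {X. real_of_int (X n) / real n \<ge> b} \<le> ennreal (K * exp (real n * r))"
    using upper_tail[OF b(2,3) r[OF b(1,2)]] by blast
  show ?thesis
  proof (intro exI[of _ K] conjI allI impI K(1))
    fix n :: nat assume n: "n > 0"
    have "{v. real_of_int v / real n \<in> F \<inter> {0<..}} \<subseteq> {v. real_of_int v / real n \<ge> b}"
      unfolding b_def using bdd by (auto intro!: cInf_lower)
    from averaged_prob_mono[OF this, of n]
    have "averaged_prob P {X. real_of_int (X n) / real n \<in> F \<inter> {0<..}} \<le> averaged_prob P {X. real_of_int (X n) / real n \<ge> b}"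
      by simp
    also have "\<dots> \<le> ennreal (K * exp (real n * r))" by (rule K(2)[OF n])
    finally show "averaged_prob P {X. real_of_int (X n) / real n \<in> F \<inter> {0<..}} \<le> ennreal (K * exp (real n * r))" .
  qed
qed

end

theorem theorem1p1:
  fixes P :: "env measure" and M :: nat
  assumes "prob_space P" and "sets P = sets env_space"
    and A1: "AE \<omega> in P. \<forall>i. \<forall>j>M. \<omega> i j = 1 / 2"
    and A2_indep: "prob_space.indep_vars P (\<lambda>_. cookie_space) (\<lambda>(i::int) \<omega>. \<omega> i) UNIV"
    and A2_ident: "\<And>i. distr P cookie_space (\<lambda>\<omega>. \<omega> i) = distr P cookie_space (\<lambda>\<omega>. \<omega> 0)"
    and A3: "(\<integral>\<omega>. (\<Prod>j=1..M. \<omega> 0 j) \<partial>P) > 0" "(\<integral>\<omega>. (\<Prod>j=1..M. 1 - \<omega> 0 j) \<partial>P) > 0"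
  shows "(\<forall>G. openin (top_of_set {-1..1::real}) G \<longrightarrow>
            liminf (\<lambda>n. ereal (1 / real n) * elog (averaged_prob P {X. real_of_int (X n) / real n \<in> G}))
              \<ge> - (INF x\<in>G. I_X P x)) \<and>
         (\<forall>F. closedin (top_of_set {-1..1::real}) F \<longrightarrow>
            limsup (\<lambda>n. ereal (1 / real n) * elog (averaged_prob P {X. real_of_int (X n) / real n \<in> F}))
              \<le> - (INF x\<in>F. I_X P x))"
proof -
  let ?Q = "mirror_law P"
  let ?E = "\<lambda>S n. {X :: nat \<Rightarrow> int. real_of_int (X n) / real n \<in> S}"
  interpret P: cookie_law P M
    by (rule cookie_law_of_assms(1)[OF assms])
  interpret Q: cookie_law ?Q M
    by (rule cookie_law_of_assms(2)[OF assms])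
  have mirror: "averaged_prob ?Q (?E (uminus ` S) n) = averaged_prob P (?E S n)" for S n
  proof -
    have "{v. real_of_int v / real n \<in> uminus ` S} = uminus ` {v. real_of_int v / real n \<in> S}"
    proof -
      have "x \<in> uminus ` S \<longleftrightarrow> - x \<in> S" for x by (auto intro: rev_image_eqI[of "- x"])
      moreover have "v \<in> uminus ` T \<longleftrightarrow> - v \<in> T" for v :: int and T by (auto intro: rev_image_eqI[of "- v"])
      ultimately show ?thesis by auto
    qed
    then have "?E (uminus ` S) n = {X. X n \<in> uminus ` {v. real_of_int v / real n \<in> S}}" by blast
    then show ?thesis
      using averaged_prob_mirror[OF assms(1,2) A2_indep A2_ident, of n "{v. real_of_int v / real n \<in> S}"] by simp
  qed
  \<comment> \<open>Reduces negative x to positive points for the mirrored law, to which the locale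
    applies as well.\<close>
  have I_neg: "I_X P x = I_X ?Q (- x)" if "x < 0" for x
    using that by (simp add: I_X_def)
  have lower: "- (INF x\<in>G. I_X P x) \<le> liminf (\<lambda>n. ereal (1 / real n) * elog (averaged_prob P (?E G n)))" (is "_ \<le> ?L")
    if G: "openin (top_of_set {-1..1}) G" for G
  proof -
    have "- I_X P x \<le> ?L" if x: "x \<in> G" for x
    proof -
      obtain e where e: "e > 0" "ball x e \<inter> {-1..1} \<subseteq> G" "x \<in> {-1..1}"
        using G x unfolding openin_contains_ball by blast
      show ?thesis
      proof (cases "x \<ge> 0")
        case True
        show ?thesis
          by (rule P.local_lower[OF True _ e(1)]) (use e in \<open>auto simp: dist_real_def abs_minus_commute intro!: subsetD[OF e(2)]\<close>)
      next
        case False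
        have "- I_X ?Q (- x) \<le> liminf (\<lambda>n. ereal (1 / real n) * elog (averaged_prob ?Q (?E (uminus ` G) n)))"
        proof (rule Q.local_lower[OF _ _ e(1)])
          fix y assume y: "\<bar>y - - x\<bar> < e" "\<bar>y\<bar> \<le> 1"
          then have "- y \<in> ball x e \<inter> {-1..1}" by (auto simp: dist_real_def)
          then have "- y \<in> G" using e(2) by blast
          then show "y \<in> uminus ` G" by (rule rev_image_eqI) simp
        qed (use False e(3) in auto)
        then show ?thesis using False by (simp only: mirror I_neg not_le)
      qed
    qed
    then have "- ?L \<le> (INF x\<in>G. I_X P x)"
      by (intro INF_greatest) (simp add: ereal_uminus_le_reorder)
    then show ?thesis by (simp add: ereal_uminus_le_reorder)
  qed
  have upper: "limsup (\<lambda>n. ereal (1 / real n) * elog (averaged_prob P (?E F n))) \<le> - (INF x\<in>F. I_X P x)" (is "?L \<le> _")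
    if F: "closedin (top_of_set {-1..1}) F" for F
  proof (rule ccontr)
    assume "\<not> ?L \<le> - (INF x\<in>F. I_X P x)"
    then have "- (INF x\<in>F. I_X P x) < ?L" by (simp only: not_le)
    \<comment> \<open>A real r strictly between the two sides reduces the claim to one exponential
      bound with rate r.\<close>
    from ereal_dense2[OF this] obtain r where r: "- (INF x\<in>F. I_X P x) < ereal r" "ereal r < ?L" by blast
    have "ereal (- r) < (INF x\<in>F. I_X P x)" using r(1) by (simp add: ereal_uminus_less_reorder)
    then have I: "ereal (- r) < I_X P x" if "x \<in> F" for x
      using that by (rule less_INF_D)
    have clF: "closed F" "F \<subseteq> {-1..1}" using F by (simp_all add: closedin_closed_eq)
    have "\<exists>K>0. \<forall>n>0. averaged_prob P (?E F n) \<le> ennreal (K * exp (real n * r))"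
    proof (cases "0 \<in> F")
      case True
      \<comment> \<open>The rate vanishes at 0, so r is positive, and bounding the probability by 1
        suffices.\<close>
      then have "r > 0" using I[OF True] by (simp add: I_X_def zero_ereal_def)
      then have "1 \<le> ennreal (1 * exp (real n * r))" for n by simp
      then have "averaged_prob P (?E F n) \<le> ennreal (1 * exp (real n * r))" for n
        by (rule order_trans[OF P.averaged_prob_le_1])
      then show ?thesis by (intro exI[of _ 1]) simp
    next
      case False
      obtain K1 where K1: "K1 > 0" "\<And>n. n > 0 \<Longrightarrow> averaged_prob P (?E (F \<inter> {0<..}) n) \<le> ennreal (K1 * exp (real n * r))"
        using P.closed_positive_part[OF clF False I] by blast
      have Iq: "ereal (- r) < I_X ?Q x" if x: "x \<in> uminus ` F" "x > 0" for x
        using I[of "- x"] I_neg[of "- x"] x by auto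
      have "closed (uminus ` F)" using clF(1) by (rule closed_negations)
      moreover have "uminus ` F \<subseteq> {-1..1}" "0 \<notin> uminus ` F" using clF(2) False by auto
      ultimately obtain K2 where K2: "K2 > 0" "\<And>n. n > 0 \<Longrightarrow> averaged_prob ?Q (?E (uminus ` F \<inter> {0<..}) n) \<le> ennreal (K2 * exp (real n * r))"
        using Q.closed_positive_part[OF _ _ _ Iq] by blast
      \<comment> \<open>Together with \<open>mirror\<close> this turns the estimate for the positive
        part of the reflected set under \<open>?Q\<close> into one for the negative part of F under
        P.\<close>
      have neg: "uminus ` F \<inter> {0<..} = uminus ` (F \<inter> {..<0})" by auto
      show ?thesis
      proof (intro exI[of _ "K1 + K2"] conjI allI impI)
        show "K1 + K2 > 0" using K1(1) K2(1) by simp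
        fix n :: nat assume n: "n > 0"
        have "F = (F \<inter> {0<..}) \<union> (F \<inter> {..<0})" using False by (auto simp: not_less less_le)
        then have "averaged_prob P (?E F n) = averaged_prob P {X. X n \<in> {v. real_of_int v / real n \<in> F \<inter> {0<..}} \<union> {v. real_of_int v / real n \<in> F \<inter> {..<0}}}"
          by (intro arg_cong[of _ _ "averaged_prob P"]) blast
        also have "\<dots> \<le> averaged_prob P (?E (F \<inter> {0<..}) n) + averaged_prob P (?E (F \<inter> {..<0}) n)"
          using P.averaged_prob_Un_le[of n "{v. real_of_int v / real n \<in> F \<inter> {0<..}}" "{v. real_of_int v / real n \<in> F \<inter> {..<0}}"]
          by simp
        also have "\<dots> \<le> ennreal (K1 * exp (real n * r)) + ennreal (K2 * exp (real n * r))"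
          using K1(2)[OF n] K2(2)[OF n] unfolding neg mirror by (rule add_mono)
        also have "\<dots> = ennreal ((K1 + K2) * exp (real n * r))"
          using K1(1) K2(1) by (simp add: distrib_right flip: ennreal_plus)
        finally show "averaged_prob P (?E F n) \<le> ennreal ((K1 + K2) * exp (real n * r))" .
      qed
    qed
    then obtain K where "K > 0" "\<And>n. n > 0 \<Longrightarrow> averaged_prob P (?E F n) \<le> ennreal (K * exp (real n * r))" by blast
    then have "?L \<le> ereal r" by (rule limsup_elog_le)
    with r(2) show False by simp
  qed
  from lower upper show ?thesis by blast
qed

end
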